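(* Let $\mathcal{N}$ be the Kirk--Silber network, the $\Delta$-clique network, or the tournament network in $\mathbb{R}^4$, and assume that all globally transverse eigenvalues of $\mathcal{N}$ are negative. Then every trajectory asymptotic to $\mathcal{N}$ is asymptotic to at most one component cycle of $\mathcal{N}$ (its $\omega$-limit set does not contain more than one of the component heteroclinic cycles of $\mathcal{N}$), and, for any two given distinct component cycles, it can switch from the one to the other only once; in particular it cannot regularly or irregularly cycle between component cycles.
   Context: **System.** On $\mathbb{R}^4$ consider $\dot x_j=x_j\big(1-\|x\|_2^2+\sum_{k\ne j}\alpha_{kj}x_k^2\big)$, $j=1,\dots,4$. The coordinate axes and hyperplanes are flow-invariant; $\xi_j$ is the equilibrium at unit distance along the positive $x_j$-axis, and $\alpha_{kj}$ is the eigenvalue of the linearisation at $\xi_k$ in the $x_j$ direction. "$\xi_j\to\xi_k$" denotes the heteroclinic orbit from $\xi_j$ to $\xi_k$ in the $(x_j,x_k)$ coordinate plane, which exists when $\alpha_{jk}>0$ and $\alpha_{kj}<0$. Define the cycles $\mathcal{C}_{[3]}=\xi_1\to\xi_2\to\xi_3\to\xi_1$, $\mathcal{C}_{[4]}=\xi_1\to\xi_2\to\xi_4\to\xi_1$, $\mathcal{C}_{[34]}=\xi_1\to\xi_2\to\xi_3\to\xi_4\to\xi_1$. In all three networks $\alpha_{12},\alpha_{23},\alpha_{24},\alpha_{41}>0$ and $\alpha_{21},\alpha_{32},\alpha_{42},\alpha_{14}<0$. In addition: - Kirk--Silber network $\mathcal{C}_{[3]}\cup\mathcal{C}_{[4]}$: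 $\alpha_{31}>0$, $\alpha_{13}<0$; the globally transverse eigenvalues are $\alpha_{34},\alpha_{43}$. - $\Delta$-clique network $\mathcal{C}_{[4]}\cup\mathcal{C}_{[34]}$: $\alpha_{34}>0$, $\alpha_{43}<0$; the globally transverse eigenvalues are $\alpha_{13},\alpha_{31}$. - Tournament network $\mathcal{C}_{[3]}\cup\mathcal{C}_{[4]}\cup\mathcal{C}_{[34]}$: $\alpha_{31},\alpha_{34}>0$, $\alpha_{13},\alpha_{43}<0$; there are no globally transverse eigenvalues. A globally transverse eigenvalue at an equilibrium is one that is transverse (neither radial, contracting nor expanding) with respect to every cycle of the network through that equilibrium. The dynamics of trajectories near the network is described, to lowest order, by return maps to cross-sections near the equilibria; as in the usual construction, trajectories that land on the separatrix between domains of the return map leading to different cycles are not considered. **Terminology.** A trajectory is asymptotic to an invariant set if its $\omega$-limit set is contained in that set. The itinerary of a trajectory near $\mathcal{N}$ is the sequence of indices of the equilibria it successively visits. The root sequences of a cycle $\xi_{j_1}\to\cdots\to\xi_{j_m}\to\xi_{j_1}$ are the cyclic shifts of $(j_1\dots j_m)$. A trajectory switches from a cycle $\mathcal{C}_1$ to a cycle $\mathcal{C}_2$ if its itinerary contains, as consecutive entries, $\mathcal{X}_1\mathcal{X}_2$ for some root sequence $\mathcal{X}_i$ of $\mathcal{C}_i$, $i=1,2$.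
   Formalization: A switch X1 X2 is counted only if X1 and X2 start at the same equilibrium and X2 is followed by its first entry, separately for each pair of root sequences; otherwise the itinerary 1234 1234 ... would already contain infinitely many switches (4123 412). *)

theory Defs
  imports "HOL-Analysis.Analysis"
begin

text \<open>The index type \<^typ>\<open>4\<close> has the elements 1, 2, 3, 4 (with 4 = 0).
  In \<open>\<alpha> k j\<close> the first index is the equilibrium, the second the direction.\<close>

definition vf :: "(4 \<Rightarrow> 4 \<Rightarrow> real) \<Rightarrow> real^4 \<Rightarrow> real^4" where
  "vf \<alpha> x = (\<chi> j. x $ j * (1 - (norm x)\<^sup>2 + (\<Sum>k\<in>UNIV - {j}. \<alpha> k j * (x $ k)\<^sup>2)))"

definition trajectory :: "(4 \<Rightarrow> 4 \<Rightarrow> real) \<Rightarrow> (real \<Rightarrow> real^4) \<Rightarrow> bool" where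
  "trajectory \<alpha> x \<longleftrightarrow>
     (\<forall>t\<ge>0. (x has_vector_derivative vf \<alpha> (x t)) (at t within {0..}))"

definition omega_limit :: "(real \<Rightarrow> real^4) \<Rightarrow> (real^4) set" where
  "omega_limit x =
     {y. \<exists>t :: nat \<Rightarrow> real. filterlim t at_top sequentially \<and> (\<lambda>n. x (t n)) \<longlonglongrightarrow> y}"

definition asymptotic_to :: "(real \<Rightarrow> real^4) \<Rightarrow> (real^4) set \<Rightarrow> bool" where
  "asymptotic_to x S \<longleftrightarrow> omega_limit x \<subseteq> S"

definition \<xi> :: "4 \<Rightarrow> real^4" where
  "\<xi> j = axis j 1"

text \<open>The set of points of the heteroclinic orbit from \<open>\<xi> j\<close> to \<open>\<xi> k\<close> in the
  \<open>(x\<^sub>j, x\<^sub>k)\<close> coordinate plane. The one-sided limits force both coordinates to be positive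
  along it, and all solutions \<open>\<gamma>\<close> below are time shifts of one another.\<close>

definition connection :: "(4 \<Rightarrow> 4 \<Rightarrow> real) \<Rightarrow> 4 \<Rightarrow> 4 \<Rightarrow> (real^4) set" where
  "connection \<alpha> j k =
     {y. \<exists>\<gamma>. (\<forall>t. (\<gamma> has_vector_derivative vf \<alpha> (\<gamma> t)) (at t)) \<and>
             (\<forall>t. \<forall>i. i \<noteq> j \<and> i \<noteq> k \<longrightarrow> \<gamma> t $ i = 0) \<and>
             (\<gamma> \<longlongrightarrow> \<xi> j) at_bot \<and> (\<gamma> \<longlongrightarrow> \<xi> k) at_top \<and> y \<in> range \<gamma>}"

text \<open>A cycle \<open>\<xi> j\<^sub>1 \<rightarrow> \<dots> \<rightarrow> \<xi> j\<^sub>m \<rightarrow> \<xi> j\<^sub>1\<close> is given by the list \<open>[j\<^sub>1, \<dots>, j\<^sub>m]\<close>.\<close>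

definition edges :: "4 list \<Rightarrow> (4 \<times> 4) set" where
  "edges C = {(C ! i, C ! (Suc i mod length C)) | i. i < length C}"

definition cycle_set :: "(4 \<Rightarrow> 4 \<Rightarrow> real) \<Rightarrow> 4 list \<Rightarrow> (real^4) set" where
  "cycle_set \<alpha> C = \<xi> ` set C \<union> (\<Union>(j, k)\<in>edges C. connection \<alpha> j k)"

definition root_sequences :: "4 list \<Rightarrow> 4 list set" where
  "root_sequences C = {rotate n C | n. True}"

datatype network_kind = Kirk_Silber | Delta_Clique | Tournament

fun component_cycles :: "network_kind \<Rightarrow> 4 list set" where
  "component_cycles Kirk_Silber = {[1, 2, 3], [1, 2, 4]}"
| "component_cycles Delta_Clique = {[1, 2, 4], [1, 2, 3, 4]}"
| "component_cycles Tournament = {[1, 2, 3], [1, 2, 4], [1, 2, 3, 4]}"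

definition network :: "(4 \<Rightarrow> 4 \<Rightarrow> real) \<Rightarrow> network_kind \<Rightarrow> (real^4) set" where
  "network \<alpha> K = (\<Union>C\<in>component_cycles K. cycle_set \<alpha> C)"

definition common_signs :: "(4 \<Rightarrow> 4 \<Rightarrow> real) \<Rightarrow> bool" where
  "common_signs \<alpha> \<longleftrightarrow>
     \<alpha> 1 2 > 0 \<and> \<alpha> 2 3 > 0 \<and> \<alpha> 2 4 > 0 \<and> \<alpha> 4 1 > 0 \<and>
     \<alpha> 2 1 < 0 \<and> \<alpha> 3 2 < 0 \<and> \<alpha> 4 2 < 0 \<and> \<alpha> 1 4 < 0"

fun network_signs :: "(4 \<Rightarrow> 4 \<Rightarrow> real) \<Rightarrow> network_kind \<Rightarrow> bool" where
  "network_signs \<alpha> Kirk_Silber \<longleftrightarrow> common_signs \<alpha> \<and> \<alpha> 3 1 > 0 \<and> \<alpha> 1 3 < 0"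
| "network_signs \<alpha> Delta_Clique \<longleftrightarrow> common_signs \<alpha> \<and> \<alpha> 3 4 > 0 \<and> \<alpha> 4 3 < 0"
| "network_signs \<alpha> Tournament \<longleftrightarrow>
     common_signs \<alpha> \<and> \<alpha> 3 1 > 0 \<and> \<alpha> 3 4 > 0 \<and> \<alpha> 1 3 < 0 \<and> \<alpha> 4 3 < 0"

text \<open>\<open>j \<noteq> k\<close> excludes the radial direction, \<open>(j, k) \<in> edges C\<close> is the contracting and
  \<open>(k, j) \<in> edges C\<close> the expanding direction at \<open>\<xi> k\<close> with respect to \<open>C\<close>.\<close>

definition globally_transverse :: "network_kind \<Rightarrow> 4 \<Rightarrow> 4 \<Rightarrow> bool" where
  "globally_transverse K k j \<longleftrightarrow>
     j \<noteq> k \<and> (\<exists>C\<in>component_cycles K. k \<in> set C) \<and>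
     (\<forall>C\<in>component_cycles K. k \<in> set C \<longrightarrow> (j, k) \<notin> edges C \<and> (k, j) \<notin> edges C)"

text \<open>Itineraries record visits to the \<open>\<epsilon>\<close>-balls around the equilibria from time \<open>s\<close> on;
  returns to the same ball without visiting another one in between count as one visit. Since an
  itinerary may be finite (a trajectory may converge to an equilibrium) or infinite, it is
  described by its finite initial segments.\<close>

definition visited :: "(real \<Rightarrow> real^4) \<Rightarrow> real \<Rightarrow> real set \<Rightarrow> 4 set" where
  "visited x \<epsilon> T = {i. \<exists>t\<in>T. dist (x t) (\<xi> i) < \<epsilon>}"

definition itinerary_segment :: "(real \<Rightarrow> real^4) \<Rightarrow> real \<Rightarrow> real \<Rightarrow> 4 list \<Rightarrow> bool" where
  "itinerary_segment x \<epsilon> s w \<longleftrightarrow>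
     (\<exists>\<tau> :: nat \<Rightarrow> real. \<tau> 0 = s \<and>
        (\<forall>n < length w. \<tau> n < \<tau> (Suc n) \<and> visited x \<epsilon> {\<tau> n..<\<tau> (Suc n)} = {w ! n}) \<and>
        (\<forall>n. Suc n < length w \<longrightarrow> w ! n \<noteq> w ! Suc n))"

definition infinite_itinerary :: "(real \<Rightarrow> real^4) \<Rightarrow> real \<Rightarrow> real \<Rightarrow> (nat \<Rightarrow> 4) \<Rightarrow> bool" where
  "infinite_itinerary x \<epsilon> s a \<longleftrightarrow> (\<forall>n. itinerary_segment x \<epsilon> s (map a [0..<n]))"

text \<open>\<open>X\<close> and \<open>Y\<close> are root sequences of the two cycles. Both cycles have to be traversed
  completely, including their closing connections: the closing connection of the first cycle leads
  to the first entry of \<open>Y\<close>, so that \<open>X\<close> and \<open>Y\<close> start at the same equilibrium, and \<open>Y\<close> is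
  followed by its own first entry. Without this the periodic itinerary \<open>1234 1234 \<dots>\<close> of a
  trajectory that follows a single cycle forever would contain switches, since it
  contains \<open>4123\<close> followed by \<open>412\<close> and \<open>412\<close> followed by \<open>3412\<close>.\<close>

definition switch_at :: "4 list \<Rightarrow> 4 list \<Rightarrow> 4 list \<Rightarrow> nat \<Rightarrow> bool" where
  "switch_at w X Y n \<longleftrightarrow>
     hd X = hd Y \<and> (\<exists>u v. w = u @ (X @ Y @ [hd Y]) @ v \<and> length u = n)"

text \<open>One and the same switch is seen in several pairs of root sequences (\<open>123 1241\<close>,
  \<open>231 2412\<close>, ...), hence switches are counted for each such pair separately.\<close>

definition switches_at_most_once :: "4 list \<Rightarrow> 4 list \<Rightarrow> 4 list \<Rightarrow> bool" where
  "switches_at_most_once w C C' \<longleftrightarrow>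
     (\<forall>X\<in>root_sequences C. \<forall>Y\<in>root_sequences C'. \<forall>n m.
        switch_at w X Y n \<and> switch_at w X Y m \<longrightarrow> n = m)"

definition cycles_between :: "network_kind \<Rightarrow> (nat \<Rightarrow> 4) \<Rightarrow> bool" where
  "cycles_between K a \<longleftrightarrow>
     infinite {n. \<exists>C\<in>component_cycles K. \<exists>C'\<in>component_cycles K. C \<noteq> C' \<and>
       (\<exists>X\<in>root_sequences C. \<exists>Y\<in>root_sequences C'. \<exists>l. switch_at (map a [0..<l]) X Y n)}"

definition eventually_periodic :: "(nat \<Rightarrow> 4) \<Rightarrow> bool" where
  "eventually_periodic a \<longleftrightarrow> (\<exists>p>0. \<exists>N. \<forall>n\<ge>N. a (n + p) = a n)"

definition regularly_cycles :: "network_kind \<Rightarrow> (nat \<Rightarrow> 4) \<Rightarrow> bool" where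
  "regularly_cycles K a \<longleftrightarrow> cycles_between K a \<and> eventually_periodic a"

definition irregularly_cycles :: "network_kind \<Rightarrow> (nat \<Rightarrow> 4) \<Rightarrow> bool" where
  "irregularly_cycles K a \<longleftrightarrow> cycles_between K a \<and> \<not> eventually_periodic a"

end

theory Submission
  imports Defs "HOL-Real_Asymp.Real_Asymp"
begin

text \<open>In logarithmic coordinates the dynamics near the network is linear. While a trajectory stays near
  \<open>\<xi> k\<close> for a time \<open>T\<close>, the logarithm of its \<open>j\<close>-th coordinate changes by \<open>\<alpha> k j T\<close>, up to an error that does
  not depend on \<open>T\<close>. At \<open>\<xi>\<close>2 the trajectory goes to \<open>\<xi>\<close>3 or \<open>\<xi>\<close>4 according to the sign of
  \<open>\<alpha> 2 4 ln x\<^sub>3 - \<alpha> 2 3 ln x\<^sub>4\<close>, and a similar expression decides at \<open>\<xi>\<close>3 between \<open>\<xi>\<close>1 and \<open>\<xi>\<close>4. One turn around the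
  network acts on the ratio of \<open>ln x\<^sub>4\<close> and \<open>ln x\<^sub>3\<close> as an increasing map if the globally transverse
  eigenvalues are negative, so that each threshold can be crossed in one direction only. For each choice
  this monotonicity is made explicit by a linear combination of logarithms that does not increase at
  any of the equilibria visited during a turn, but would have to increase if the choice were reversed
  in the unfavourable direction (\<open>no_turn\<close>, \<open>choice_at_2\<close>, \<open>choice_at_3\<close>). Which direction is favourable depends on
  the signs of two expressions \<open>W\<close> and \<open>V\<close> in the eigenvalues.

  The bounded errors have to be beaten even where these expressions vanish. This is possible because
  a trajectory that stays within a small distance \<open>\<delta>\<close> of the network has a logarithmic distance of the
  order \<open>- ln \<delta>\<close> from the separatrix at each choice. For the error bound (\<open>log_growth_while_dominated\<close>)
  the shares \<open>x\<^sub>i\<^sup>2 / \<bar>x\<bar>\<^sup>2\<close> are considered; they satisfy a replicator equation. A potential for the passage of a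
  vertex, which is bounded and increases at least like the distance to the vertex, shows that the
  deviations from linearity are integrable.

  Near the network the dominating share changes only along edges (\<open>exit_along_edge\<close>). A trajectory that
  passes from one edge to the next comes so close to the vertex in between that it enters the ball of
  radius \<open>\<epsilon>\<close> there (\<open>enters_ball\<close>), so that consecutive letters of an itinerary are crossings of edges. The
  claims on switching are then statements on words in which a choice is not reversed twice. For the
  claim on limit sets, each connection has to be known to be nonempty (\<open>exists_connection\<close>, by an
  explicit solution of the planar system): a trajectory that accumulates at all points of a cycle
  crosses all of its edges again and again (\<open>frequent_crossing\<close>), which excludes a second cycle.\<close>

section \<open>Monotonicity along a half-line\<close>

lemma nondecreasing_within:
  fixes f :: "real \<Rightarrow> real"
  assumes "a \<le> b"
    and der: "\<And>t. t \<in> {a..b} \<Longrightarrow> (f has_real_derivative f' t) (at t within {a..b})"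
    and pos: "\<And>t. t \<in> {a..b} \<Longrightarrow> f' t \<ge> 0"
  shows "f a \<le> f b"
proof (rule DERIV_nonneg_imp_increasing_open[OF \<open>a \<le> b\<close>])
  fix t assume t: "a < t" "t < b"
  have "(f has_real_derivative f' t) (at t)"
    using der[of t] t by (simp add: at_within_Icc_at)
  then show "\<exists>y. DERIV f t :> y \<and> y \<ge> 0" using pos[of t] t by auto
next
  show "continuous_on {a..b} f"
    using der by (meson DERIV_continuous continuous_on_eq_continuous_within)
qed

text \<open>At the last time before \<open>b\<close> at which the bound still holds, the function would be increasing.\<close>

lemma barrier:
  fixes f :: "real \<Rightarrow> real"
  assumes ab: "a \<le> b"
    and der: "\<And>t. t \<in> {a..b} \<Longrightarrow> (f has_real_derivative f' t) (at t within {a..b})"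
    and pos: "\<And>t. t \<in> {a..b} \<Longrightarrow> f t = c \<Longrightarrow> f' t > 0"
    and start: "f a \<ge> c"
  shows "f b \<ge> c"
proof (rule ccontr)
  assume nb: "\<not> c \<le> f b"
  have cont: "continuous_on {a..b} f"
    using der by (meson DERIV_continuous continuous_on_eq_continuous_within)
  define S where "S = {t \<in> {a..b}. c \<le> f t}"
  have "compact S"
  proof -
    have "closed S" unfolding S_def
      using continuous_on_closed_Collect_le[of "{a..b}" "\<lambda>_. c" f] cont by simp
    moreover have "bounded S" unfolding S_def by (rule bounded_subset[of "{a..b}"]) auto
    ultimately show ?thesis by (simp add: compact_eq_bounded_closed)
  qed
  moreover have "S \<noteq> {}" using start ab by (auto simp: S_def)
  ultimately obtain u where u: "u \<in> S" and umax: "\<And>t. t \<in> S \<Longrightarrow> t \<le> u"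
    using compact_attains_sup[of S] by blast
  have ub: "u \<in> {a..b}" "c \<le> f u" "u < b"
    using u nb by (auto simp: S_def less_le)
  have "f u = c"
  proof (rule ccontr)
    assume "f u \<noteq> c"
    then have "f b \<le> c" "c \<le> f u" "f u > c" using ub nb by auto
    moreover have "continuous_on {u..b} f" using cont by (rule continuous_on_subset) (use ub in auto)
    ultimately obtain v where "u \<le> v" "v \<le> b" "f v = c"
      using IVT2'[of f b c u] ub by auto
    then have "v \<in> S" using ub by (auto simp: S_def)
    then have "v = u" using umax \<open>u \<le> v\<close> by force
    then show False using \<open>f v = c\<close> \<open>f u \<noteq> c\<close> by simp
  qed
  then have "f' u > 0" using pos ub by auto
  then obtain d where "d > 0" and d: "\<And>h. h > 0 \<Longrightarrow> u + h \<in> {a..b} \<Longrightarrow> h < d \<Longrightarrow> f u < f (u + h)"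
    using has_real_derivative_pos_inc_right[OF der[OF ub(1)]] by blast
  define h where "h = min (d/2) (b - u)"
  have h: "h > 0" "u + h \<in> {a..b}" "h < d" using \<open>d > 0\<close> ub by (auto simp: h_def)
  then have "u + h \<in> S" using d[OF h] \<open>f u = c\<close> by (simp add: S_def)
  then show False using umax h(1) by force
qed

lemma linear_ode_zero_iff:
  fixes y g :: "real \<Rightarrow> real"
  assumes ab: "a \<le> b"
    and der: "\<And>t. t \<in> {a..b} \<Longrightarrow> (y has_real_derivative g t * y t) (at t within {a..b})"
    and cont: "continuous_on {a..b} g"
  shows "y a = 0 \<longleftrightarrow> y b = 0"
proof -
  define I where "I t = integral {a..t} g" for t
  have I: "(I has_real_derivative g t) (at t within {a..b})" if "t \<in> {a..b}" for t
    unfolding I_def has_real_derivative_iff_has_vector_derivative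
    by (rule integral_has_vector_derivative[OF cont that])
  define z where "z t = y t * exp (- I t)" for t
  have z: "(z has_real_derivative 0) (at t within {a..b})" if "t \<in> {a..b}" for t
  proof -
    have "(z has_real_derivative
        (g t * y t) * exp (- I t) + exp (- I t) * (- g t) * y t) (at t within {a..b})"
      unfolding z_def by (rule DERIV_mult[OF der[OF that]])
        (auto intro!: derivative_eq_intros I that)
    then show ?thesis by (simp add: algebra_simps)
  qed
  have "z a \<le> z b" by (rule nondecreasing_within[OF ab z]) auto
  moreover have "- z a \<le> - z b"
  proof (rule nondecreasing_within[OF ab])
    show "((\<lambda>t. - z t) has_real_derivative 0) (at t within {a..b})" if "t \<in> {a..b}" for t
      using DERIV_minus[OF z[OF that]] by simp
  qed simp
  ultimately have "z a = z b" by simp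
  then show ?thesis unfolding z_def by (metis exp_not_eq_zero mult_eq_0_iff)
qed

section \<open>Replicator fitness near a network\<close>

text \<open>The vocabulary of the replicator equation \<open>p\<^sub>i' = \<rho> p\<^sub>i (fitness p i - mean_fitness p)\<close>, which the shares
  \<open>x\<^sub>i\<^sup>2 / \<bar>x\<bar>\<^sup>2\<close> of a solution satisfy. It no longer contains the radial dynamics.\<close>

definition fitness :: "(4 \<Rightarrow> 4 \<Rightarrow> real) \<Rightarrow> (4 \<Rightarrow> real) \<Rightarrow> 4 \<Rightarrow> real" where
  "fitness \<beta> p i = (\<Sum>l\<in>UNIV. \<beta> l i * p l)"

definition mean_fitness :: "(4 \<Rightarrow> 4 \<Rightarrow> real) \<Rightarrow> (4 \<Rightarrow> real) \<Rightarrow> real" where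
  "mean_fitness \<beta> p = (\<Sum>i\<in>UNIV. p i * fitness \<beta> p i)"

definition near_edges :: "(4 \<times> 4) set \<Rightarrow> real \<Rightarrow> (4 \<Rightarrow> real) \<Rightarrow> bool" where
  "near_edges E \<eta> p \<longleftrightarrow> (\<exists>(j, k)\<in>E. \<forall>i. i \<noteq> j \<and> i \<noteq> k \<longrightarrow> p i \<le> \<eta>)"

definition dominates :: "(4 \<Rightarrow> real) \<Rightarrow> 4 \<Rightarrow> bool" where
  "dominates p k \<longleftrightarrow> (\<forall>i. p i \<le> p k)"

lemma sum_split2:
  fixes f :: "4 \<Rightarrow> real"
  assumes "k \<noteq> l"
  shows "sum f UNIV = f k + f l + sum f (UNIV - {k, l})"
proof -
  have "sum f UNIV = f k + sum f (UNIV - {k})" by (simp add: sum.remove)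
  also have "sum f (UNIV - {k}) = f l + sum f (UNIV - {k} - {l})"
    by (rule sum.remove) (use assms in auto)
  also have "UNIV - {k} - {l} = UNIV - {k, l}" by auto
  finally show ?thesis by simp
qed

lemma card_rest2: "k \<noteq> l \<Longrightarrow> card (UNIV - {k, l :: 4}) = 2"
  by (subst card_Diff_subset) auto

locale replicator_signs =
  fixes \<beta> :: "4 \<Rightarrow> 4 \<Rightarrow> real" and E :: "(4 \<times> 4) set" and c A :: real
  assumes diag: "\<beta> k k = 0"
    and c_pos: "0 < c"
    and lower: "i \<noteq> j \<Longrightarrow> c \<le> \<bar>\<beta> i j\<bar>"
    and upper: "\<bar>\<beta> i j\<bar> \<le> A"
    and edge: "(j, k) \<in> E \<Longrightarrow> \<beta> j k > 0 \<and> \<beta> k j < 0"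
begin

lemma c_le_A: "c \<le> A"
  using lower[of 1 2] upper[of 1 2] by simp

lemma A_pos: "0 < A" using c_le_A c_pos by simp

lemma edge_lower: "(j, k) \<in> E \<Longrightarrow> j \<noteq> k \<and> c \<le> \<beta> j k \<and> \<beta> k j \<le> - c"
  using edge[of j k] lower[of j k] lower[of k j] diag by fastforce

lemma edge_antisym: "(j, k) \<in> E \<Longrightarrow> (k, j) \<notin> E"
  using edge[of j k] edge[of k j] by auto

context
  fixes p :: "4 \<Rightarrow> real"
  assumes p_nonneg: "\<And>i. 0 \<le> p i" and p_sum: "sum p UNIV = 1"
begin

lemma p_le_1: "p i \<le> 1"
  using p_nonneg p_sum member_le_sum[of i UNIV p] by auto

lemma sum_others: "sum p (UNIV - {k}) = 1 - p k"
  using p_sum by (simp add: sum.remove[of UNIV k p])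

lemma abs_weighted_le:
  assumes "\<And>i. i \<in> S \<Longrightarrow> \<bar>w i\<bar> \<le> B"
  shows "\<bar>\<Sum>i\<in>S. w i * p i\<bar> \<le> B * sum p S"
proof -
  have "\<bar>\<Sum>i\<in>S. w i * p i\<bar> \<le> (\<Sum>i\<in>S. \<bar>w i * p i\<bar>)" by (rule sum_abs)
  also have "\<dots> \<le> (\<Sum>i\<in>S. B * p i)"
    by (rule sum_mono) (auto simp: abs_mult p_nonneg assms intro!: mult_right_mono)
  finally show ?thesis by (simp add: sum_distrib_left)
qed

lemma fitness_bound: "\<bar>fitness \<beta> p i\<bar> \<le> A"
  using abs_weighted_le[of UNIV "\<lambda>l. \<beta> l i" A] upper p_sum by (simp add: fitness_def)

lemma fitness_self: "\<bar>fitness \<beta> p k\<bar> \<le> A * (1 - p k)"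
proof -
  have "fitness \<beta> p k = (\<Sum>l\<in>UNIV - {k}. \<beta> l k * p l)"
    by (simp add: fitness_def sum.remove[of UNIV k] diag)
  then show ?thesis using abs_weighted_le[of "UNIV - {k}" "\<lambda>l. \<beta> l k" A] upper sum_others by simp
qed

lemma mean_fitness_bound: "\<bar>mean_fitness \<beta> p\<bar> \<le> 2 * A * (1 - p k)"
proof -
  have "mean_fitness \<beta> p = p k * fitness \<beta> p k + (\<Sum>l\<in>UNIV - {k}. fitness \<beta> p l * p l)"
    by (simp add: mean_fitness_def sum.remove[of UNIV k] mult.commute)
  moreover have "\<bar>\<Sum>l\<in>UNIV - {k}. fitness \<beta> p l * p l\<bar> \<le> A * (1 - p k)"
    using abs_weighted_le[of "UNIV - {k}" "fitness \<beta> p" A] fitness_bound sum_others by simp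
  moreover have "\<bar>p k * fitness \<beta> p k\<bar> \<le> A * (1 - p k)"
    using fitness_self[of k] p_nonneg[of k] p_le_1[of k]
    by (auto simp: abs_mult intro: order_trans[OF mult_left_le_one_le])
  ultimately show ?thesis by linarith
qed

lemma growth_near_vertex:
  "\<bar>fitness \<beta> p i - mean_fitness \<beta> p - \<beta> k i\<bar> \<le> 4 * A * (1 - p k)"
proof -
  have "fitness \<beta> p i = \<beta> k i * p k + (\<Sum>l\<in>UNIV - {k}. \<beta> l i * p l)"
    by (simp add: fitness_def sum.remove[of UNIV k])
  moreover have "\<bar>\<Sum>l\<in>UNIV - {k}. \<beta> l i * p l\<bar> \<le> A * (1 - p k)"
    using abs_weighted_le[of "UNIV - {k}" "\<lambda>l. \<beta> l i" A] upper sum_others by simp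
  moreover have "\<bar>\<beta> k i * (1 - p k)\<bar> \<le> A * (1 - p k)"
    using upper[of k i] p_le_1[of k] by (simp add: abs_mult mult_right_mono)
  ultimately show ?thesis using mean_fitness_bound[of k]
    by (simp add: algebra_simps)
qed

lemma growth_bound: "\<bar>fitness \<beta> p i - mean_fitness \<beta> p\<bar> \<le> 3 * A"
proof -
  have "\<bar>mean_fitness \<beta> p\<bar> \<le> 2 * A * (1 - p i)" by (rule mean_fitness_bound)
  also have "\<dots> \<le> 2 * A * 1" using A_pos p_nonneg[of i] by (intro mult_left_mono) auto
  finally show ?thesis using fitness_bound[of i] by simp
qed

lemma near_pair:
  assumes near: "near_edges E \<eta> p" and "k \<noteq> l" "\<eta> < p k" "\<eta> < p l"
  shows "(k, l) \<in> E \<or> (l, k) \<in> E" "\<And>i. i \<noteq> k \<Longrightarrow> i \<noteq> l \<Longrightarrow> p i \<le> \<eta>"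
proof -
  obtain a b where ab: "(a, b) \<in> E" "\<And>i. i \<noteq> a \<Longrightarrow> i \<noteq> b \<Longrightarrow> p i \<le> \<eta>"
    using near by (auto simp: near_edges_def)
  then have "k \<in> {a, b}" "l \<in> {a, b}" using assms(3,4) by fastforce+
  then have "{a, b} = {k, l}" using \<open>k \<noteq> l\<close> by auto
  then show "(k, l) \<in> E \<or> (l, k) \<in> E" "\<And>i. i \<noteq> k \<Longrightarrow> i \<noteq> l \<Longrightarrow> p i \<le> \<eta>"
    using ab by (auto simp: doubleton_eq_iff)
qed

lemma rest_le:
  assumes "k \<noteq> l" "\<And>i. i \<noteq> k \<Longrightarrow> i \<noteq> l \<Longrightarrow> p i \<le> \<eta>"
  shows "sum p (UNIV - {k, l}) \<le> 2 * \<eta>"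
  using sum_bounded_above[of "UNIV - {k, l}" p \<eta>] assms by (simp add: card_rest2)

text \<open>If only \<open>k\<close> and \<open>l\<close> are present, the mean fitness is \<open>(\<beta> k l + \<beta> l k) p\<^sub>k p\<^sub>l\<close>; the other two shares
  perturb the rates by their size.\<close>

lemma growth_near_edge:
  assumes kl: "k \<noteq> l" and small: "\<And>i. i \<noteq> k \<Longrightarrow> i \<noteq> l \<Longrightarrow> p i \<le> \<eta>"
  shows "\<bar>fitness \<beta> p l - mean_fitness \<beta> p - p k * (\<beta> k l * p k - \<beta> l k * p l)\<bar> \<le> 10 * A * \<eta>"
    and "\<bar>fitness \<beta> p l - fitness \<beta> p k - (\<beta> k l * p k - \<beta> l k * p l)\<bar> \<le> 4 * A * \<eta>"
proof -
  let ?R = "UNIV - {k, l}"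
  note rest = rest_le[OF kl small]
  have eta: "A * sum p ?R \<le> 2 * A * \<eta>" using mult_left_mono[OF rest, of A] A_pos by simp
  define fl where "fl = (\<Sum>i\<in>?R. \<beta> i l * p i)"
  define fk where "fk = (\<Sum>i\<in>?R. \<beta> i k * p i)"
  define m where "m = (\<Sum>i\<in>?R. fitness \<beta> p i * p i)"
  have b: "\<bar>fl\<bar> \<le> 2 * A * \<eta>" "\<bar>fk\<bar> \<le> 2 * A * \<eta>" "\<bar>m\<bar> \<le> 2 * A * \<eta>"
    using abs_weighted_le[of ?R "\<lambda>i. \<beta> i l" A] abs_weighted_le[of ?R "\<lambda>i. \<beta> i k" A]
      abs_weighted_le[of ?R "fitness \<beta> p" A] upper fitness_bound eta
    unfolding fl_def fk_def m_def by fastforce+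
  have Fl: "fitness \<beta> p l = \<beta> k l * p k + fl"
    unfolding fitness_def fl_def sum_split2[OF kl] by (simp add: diag)
  have Fk: "fitness \<beta> p k = \<beta> l k * p l + fk"
    unfolding fitness_def fk_def sum_split2[OF kl] by (simp add: diag)
  have M: "mean_fitness \<beta> p = p k * fitness \<beta> p k + p l * fitness \<beta> p l + m"
    unfolding mean_fitness_def m_def sum_split2[OF kl] by (simp add: mult.commute)
  define r where "r = sum p ?R"
  have pl: "p l = 1 - p k - r" using p_sum sum_split2[OF kl, of p] by (simp add: r_def)
  have r: "0 \<le> r" "r \<le> 2 * \<eta>" using rest by (auto simp: r_def intro!: sum_nonneg p_nonneg)
  have "fitness \<beta> p l - mean_fitness \<beta> p
      = (1 - p l) * fitness \<beta> p l - p k * fitness \<beta> p k - m"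
    unfolding M by (simp add: algebra_simps)
  also have "1 - p l = p k + r" using pl by simp
  also have "(p k + r) * fitness \<beta> p l - p k * fitness \<beta> p k - m
      = p k * (\<beta> k l * p k - \<beta> l k * p l) + (p k * fl - p k * fk + r * fitness \<beta> p l - m)"
    unfolding Fl Fk by (simp add: algebra_simps)
  finally have eq: "fitness \<beta> p l - mean_fitness \<beta> p - p k * (\<beta> k l * p k - \<beta> l k * p l)
      = p k * fl - p k * fk + r * fitness \<beta> p l - m" by simp
  have "\<bar>p k * fl\<bar> \<le> 2 * A * \<eta>" "\<bar>p k * fk\<bar> \<le> 2 * A * \<eta>"
    using b p_nonneg[of k] p_le_1[of k]
    by (auto simp: abs_mult intro: order_trans[OF mult_left_le_one_le])
  moreover have "\<bar>r * fitness \<beta> p l\<bar> \<le> 2 * A * \<eta>"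
  proof -
    have "\<bar>r * fitness \<beta> p l\<bar> \<le> (2 * \<eta>) * A"
      unfolding abs_mult using r fitness_bound[of l] by (intro mult_mono) auto
    then show ?thesis by (simp add: mult_ac)
  qed
  ultimately show "\<bar>fitness \<beta> p l - mean_fitness \<beta> p - p k * (\<beta> k l * p k - \<beta> l k * p l)\<bar> \<le> 10 * A * \<eta>"
    unfolding eq using b(3) by linarith
  show "\<bar>fitness \<beta> p l - fitness \<beta> p k - (\<beta> k l * p k - \<beta> l k * p l)\<bar> \<le> 4 * A * \<eta>"
    unfolding Fl Fk using b by linarith
qed

lemma dominates_ge: "dominates p k \<Longrightarrow> 1 / 4 \<le> p k"
  using p_sum sum_bounded_above[of UNIV p "p k"] by (simp add: dominates_def)

end
end

text \<open>Along a passage of the vertex \<open>k\<close> the incoming share decreases and the outgoing share increases.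
  The potential adds up both effects. It is bounded by 1 and increases at least like \<open>1 - p\<^sub>k\<close>,
  which makes \<open>1 - p\<^sub>k\<close> integrable over the passage, however long it takes.\<close>

definition potential :: "(4 \<Rightarrow> 4 \<Rightarrow> real) \<Rightarrow> 4 \<Rightarrow> (4 \<Rightarrow> real) \<Rightarrow> real" where
  "potential \<beta> k p = (\<Sum>i\<in>UNIV - {k}. sgn (\<beta> k i) * p i)"

context replicator_signs
begin

context
  fixes p :: "4 \<Rightarrow> real" and \<eta> :: real
  assumes p_nonneg: "\<And>i. 0 \<le> p i" and p_sum: "sum p UNIV = 1"
    and near: "near_edges E \<eta> p"
    and eta_pos: "0 < \<eta>" and eta_small: "\<eta> \<le> c\<^sup>2 / (2000 * A\<^sup>2)"
begin

lemma eta_bounds: "A * \<eta> \<le> c\<^sup>2 / (2000 * A)" "A * \<eta> \<le> c / 2000" "\<eta> \<le> 1 / 2000"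
proof -
  have "A * \<eta> \<le> A * (c\<^sup>2 / (2000 * A\<^sup>2))" using eta_small A_pos by (intro mult_left_mono) auto
  also have "\<dots> = c\<^sup>2 / (2000 * A)" using A_pos by (simp add: power2_eq_square)
  finally show 1: "A * \<eta> \<le> c\<^sup>2 / (2000 * A)" .
  also have "\<dots> \<le> c / 2000"
    using A_pos c_pos c_le_A by (simp add: field_simps power2_eq_square)
  finally show 2: "A * \<eta> \<le> c / 2000" .
  then have "A * \<eta> \<le> A * (1 / 2000)" using c_le_A by simp
  then show "\<eta> \<le> 1 / 2000" using A_pos by (simp only: mult_le_cancel_left_pos)
qed

lemma growth_along_edge:
  assumes dom: "dominates p k" and l: "\<eta> < p l" "k \<noteq> l"
  shows "(k, l) \<in> E \<Longrightarrow> c / 16 \<le> fitness \<beta> p l - mean_fitness \<beta> p"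
    and "(l, k) \<in> E \<Longrightarrow> fitness \<beta> p l - mean_fitness \<beta> p \<le> - c / 16"
    and "(l, k) \<in> E \<Longrightarrow> fitness \<beta> p l < fitness \<beta> p k"
proof -
  have pk: "1 / 4 \<le> p k" using dominates_ge[OF p_nonneg p_sum dom] .
  then have "\<eta> < p k" using eta_bounds(3) by simp
  note pair = near_pair[OF p_nonneg p_sum near l(2) this l(1)]
  note g = growth_near_edge[OF p_nonneg p_sum l(2), of \<eta>, OF pair(2)]
  have "p k + p l = 1 - sum p (UNIV - {k, l})" using sum_split2[OF l(2), of p] p_sum by simp
  then have two: "1 / 2 \<le> p k + p l"
    using rest_le[OF p_nonneg p_sum l(2), of \<eta>, OF pair(2)] eta_bounds(3) by simp
  have prod: "(1/4) * (c * (1/2)) \<le> p k * (c * (p k + p l))"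
    using pk two c_pos by (intro mult_mono mult_left_mono) auto
  {
    assume "(k, l) \<in> E"
    then have e: "c \<le> \<beta> k l" "\<beta> l k \<le> - c" using edge_lower by auto
    have "c * p k \<le> \<beta> k l * p k" "\<beta> l k * p l \<le> (- c) * p l"
      using mult_right_mono[OF e(1) p_nonneg] mult_right_mono[OF e(2) p_nonneg] by blast+
    then have "c * (p k + p l) \<le> \<beta> k l * p k - \<beta> l k * p l" by (simp add: algebra_simps)
    then have "p k * (c * (p k + p l)) \<le> p k * (\<beta> k l * p k - \<beta> l k * p l)"
      using p_nonneg by (intro mult_left_mono) auto
    then show "c / 16 \<le> fitness \<beta> p l - mean_fitness \<beta> p"
      using g(1) prod eta_bounds(2) c_pos unfolding abs_le_iff by linarith
  next
    assume "(l, k) \<in> E"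
    then have e: "c \<le> \<beta> l k" "\<beta> k l \<le> - c" using edge_lower by auto
    have "\<beta> k l * p k \<le> (- c) * p k" "c * p l \<le> \<beta> l k * p l"
      using mult_right_mono[OF e(1) p_nonneg] mult_right_mono[OF e(2) p_nonneg] by blast+
    then have *: "c * (p k + p l) \<le> - (\<beta> k l * p k - \<beta> l k * p l)" by (simp add: algebra_simps)
    then have "p k * (c * (p k + p l)) \<le> p k * (- (\<beta> k l * p k - \<beta> l k * p l))"
      using p_nonneg by (intro mult_left_mono) auto
    then have "p k * (c * (p k + p l)) \<le> - (p k * (\<beta> k l * p k - \<beta> l k * p l))"
      by (simp only: mult_minus_right)
    then show "fitness \<beta> p l - mean_fitness \<beta> p \<le> - c / 16"
      using g(1) prod eta_bounds(2) c_pos unfolding abs_le_iff by linarith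
    have "c * (1/2) \<le> c * (p k + p l)" using two c_pos by (intro mult_left_mono) auto
    then show "fitness \<beta> p l < fitness \<beta> p k"
      using * g(2) eta_bounds(2) c_pos unfolding abs_le_iff by linarith
  }
qed

text \<open>Close to the vertex each coordinate grows at a rate close to its own eigenvalue, so every
  summand has the right sign. Away from the vertex only the coordinate \<open>l\<close> of the nearby edge
  matters, and the edge is traversed in its own direction.\<close>

lemma potential_rate:
  assumes dom: "dominates p k"
  shows "c / 32 * (1 - p k)
    \<le> (\<Sum>i\<in>UNIV - {k}. sgn (\<beta> k i) * (p i * (fitness \<beta> p i - mean_fitness \<beta> p)))"
    (is "_ \<le> ?G")
proof (cases "1 - p k \<le> c / (8 * A)")
  case True
  then have q: "4 * A * (1 - p k) \<le> c / 2" using A_pos by (simp add: field_simps)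
  have "c / 2 * p i \<le> sgn (\<beta> k i) * (p i * (fitness \<beta> p i - mean_fitness \<beta> p))"
    if "i \<noteq> k" for i
  proof -
    have g: "\<bar>fitness \<beta> p i - mean_fitness \<beta> p - \<beta> k i\<bar> \<le> c / 2"
      using growth_near_vertex[OF p_nonneg p_sum, of i k] q by linarith
    have "c / 2 \<le> sgn (\<beta> k i) * (fitness \<beta> p i - mean_fitness \<beta> p)"
      using g lower[of k i] that c_pos by (auto simp: sgn_if abs_le_iff abs_if split: if_splits)
    then have "p i * (c / 2) \<le> p i * (sgn (\<beta> k i) * (fitness \<beta> p i - mean_fitness \<beta> p))"
      using p_nonneg by (intro mult_left_mono) auto
    then show ?thesis by (simp add: mult_ac)
  qed
  then have "(\<Sum>i\<in>UNIV - {k}. c / 2 * p i) \<le> ?G" by (intro sum_mono) auto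
  then have *: "c / 2 * (1 - p k) \<le> ?G"
    by (simp only: sum_distrib_left[symmetric] sum_others[OF p_nonneg p_sum])
  have "c / 32 * (1 - p k) \<le> c / 2 * (1 - p k)"
    using c_pos p_le_1[OF p_nonneg p_sum, of k] by (intro mult_right_mono) auto
  with * show ?thesis by linarith
next
  case False
  have "\<exists>l. l \<noteq> k \<and> \<eta> < p l"
  proof (rule ccontr)
    assume "\<not> ?thesis"
    then have "sum p (UNIV - {k}) \<le> 3 * \<eta>"
      using sum_bounded_above[of "UNIV - {k}" p \<eta>] by (force simp: card_Diff_subset)
    then have "c / (8 * A) \<le> 3 * \<eta>" using sum_others[OF p_nonneg p_sum, of k] False by simp
    then have "c \<le> 24 * (A * \<eta>)" using A_pos by (simp add: field_simps)
    then show False using eta_bounds(2) c_pos by simp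
  qed
  then obtain l where l: "l \<noteq> k" "k \<noteq> l" "\<eta> < p l" by metis
  have "\<eta> < p k" using dom l(3) by (auto simp: dominates_def intro: less_le_trans)
  note pair = near_pair[OF p_nonneg p_sum near l(2) this l(3)]
  let ?g = "\<lambda>i. fitness \<beta> p i - mean_fitness \<beta> p"
  have "c / 16 \<le> sgn (\<beta> k l) * ?g l"
    using pair(1)
  proof
    assume "(k, l) \<in> E"
    then show ?thesis using growth_along_edge(1)[OF dom l(3,2)] edge by simp
  next
    assume "(l, k) \<in> E"
    then show ?thesis using growth_along_edge(2)[OF dom l(3,2)] edge by simp
  qed
  then have "p l * (c / 16) \<le> p l * (sgn (\<beta> k l) * ?g l)"
    using p_nonneg by (intro mult_left_mono) auto
  then have main: "c / 16 * p l \<le> sgn (\<beta> k l) * (p l * ?g l)" by (simp add: mult_ac)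
  have set: "UNIV - {k} - {l} = UNIV - {k, l}" by auto
  note rest = rest_le[OF p_nonneg p_sum l(2), of \<eta>, OF pair(2)]
  have "\<bar>\<Sum>i\<in>UNIV - {k, l}. (sgn (\<beta> k i) * ?g i) * p i\<bar> \<le> 3 * A * sum p (UNIV - {k, l})"
  proof (rule abs_weighted_le[OF p_nonneg p_sum])
    fix i show "\<bar>sgn (\<beta> k i) * ?g i\<bar> \<le> 3 * A"
      using growth_bound[OF p_nonneg p_sum, of i] A_pos by (auto simp: abs_mult sgn_if)
  qed
  also have "\<dots> \<le> 3 * A * (2 * \<eta>)" using rest A_pos by (intro mult_left_mono) auto
  finally have "\<bar>\<Sum>i\<in>UNIV - {k, l}. sgn (\<beta> k i) * (p i * ?g i)\<bar> \<le> 6 * (A * \<eta>)"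
    by (simp add: mult_ac)
  moreover have "?G = sgn (\<beta> k l) * (p l * ?g l)
      + (\<Sum>i\<in>UNIV - {k, l}. sgn (\<beta> k i) * (p i * ?g i))"
    using l(1) set by (subst sum.remove[of _ l]) auto
  ultimately have G: "c / 16 * p l - 6 * (A * \<eta>) \<le> ?G" using main by linarith
  have "1 - p k - 2 * \<eta> \<le> p l" using sum_split2[OF l(2), of p] p_sum rest by simp
  then have "c / 16 * (1 - p k - 2 * \<eta>) \<le> c / 16 * p l"
    using c_pos by (intro mult_left_mono) auto
  moreover have "c * \<eta> \<le> A * \<eta>" using c_le_A eta_pos by (intro mult_right_mono) auto
  moreover have "c / 32 * (c / (8 * A)) \<le> c / 32 * (1 - p k)"
    using False c_pos by (intro mult_left_mono) auto
  moreover have "c / 32 * (c / (8 * A)) = c\<^sup>2 / (256 * A)" by (simp add: power2_eq_square)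
  moreover have "7 * (c\<^sup>2 / (2000 * A)) \<le> c\<^sup>2 / (256 * A)"
    using A_pos by (simp add: field_simps)
  moreover have "c / 16 * (1 - p k - 2 * \<eta>) = 2 * (c / 32 * (1 - p k)) - 1 / 8 * (c * \<eta>)"
    by (simp add: field_simps)
  ultimately show ?thesis using G eta_bounds(1) by linarith
qed

lemma potential_bound: "\<bar>potential \<beta> k p\<bar> \<le> 1 - p k"
  using abs_weighted_le[OF p_nonneg p_sum, of "UNIV - {k}" "\<lambda>i. sgn (\<beta> k i)" 1]
    sum_others[OF p_nonneg p_sum, of k]
  by (simp add: potential_def sgn_if)

lemma potential_near_edge:
  assumes "k \<noteq> l" "\<And>i. i \<noteq> k \<Longrightarrow> i \<noteq> l \<Longrightarrow> p i \<le> \<eta>"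
  shows "\<bar>potential \<beta> k p - sgn (\<beta> k l) * p l\<bar> \<le> 2 * \<eta>"
proof -
  have set: "UNIV - {k} - {l} = UNIV - {k, l}" by auto
  have "potential \<beta> k p - sgn (\<beta> k l) * p l = (\<Sum>i\<in>UNIV - {k, l}. sgn (\<beta> k i) * p i)"
    unfolding potential_def using assms(1) set by (subst sum.remove[of _ l]) auto
  moreover have "\<bar>\<Sum>i\<in>UNIV - {k, l}. sgn (\<beta> k i) * p i\<bar> \<le> 1 * sum p (UNIV - {k, l})"
    by (rule abs_weighted_le[OF p_nonneg p_sum]) (simp add: sgn_if)
  ultimately show ?thesis using rest_le[OF p_nonneg p_sum assms] by simp
qed

lemma potential_zero_imp_vertex:
  assumes dom: "dominates p k" and zero: "potential \<beta> k p = 0"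
  shows "1 - p k \<le> 4 * \<eta>"
proof (cases "\<exists>l. l \<noteq> k \<and> \<eta> < p l")
  case True
  then obtain l where l: "k \<noteq> l" "\<eta> < p l" by metis
  then have "\<eta> < p k" using dom by (auto simp: dominates_def intro: less_le_trans)
  note pair = near_pair[OF p_nonneg p_sum near l(1) this l(2)]
  have "p l \<le> 2 * \<eta>"
    using potential_near_edge[OF l(1) pair(2)] zero p_nonneg[of l] lower[OF l(1)] c_pos
    by (auto simp: sgn_if abs_mult split: if_splits)
  moreover have "1 - p k = p l + sum p (UNIV - {k, l})" using sum_split2[OF l(1), of p] p_sum by simp
  ultimately show ?thesis using rest_le[OF p_nonneg p_sum l(1) pair(2)] by simp
next
  case False
  then have "sum p (UNIV - {k}) \<le> 3 * \<eta>"
    using sum_bounded_above[of "UNIV - {k}" p \<eta>] by (force simp: card_Diff_subset)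
  then show ?thesis using sum_others[OF p_nonneg p_sum, of k] eta_pos by simp
qed

end
end

section \<open>Orbits of the replicator equation near a network\<close>

locale replicator_orbit = replicator_signs +
  fixes p :: "real \<Rightarrow> 4 \<Rightarrow> real" and \<rho> :: "real \<Rightarrow> real" and \<eta> s :: real
  assumes nonneg: "s \<le> t \<Longrightarrow> 0 \<le> p t i"
    and sum1: "s \<le> t \<Longrightarrow> sum (p t) UNIV = 1"
    and rho_pos: "s \<le> t \<Longrightarrow> 0 < \<rho> t"
    and rho_cont: "continuous_on {s..} \<rho>"
    and deriv: "s \<le> t \<Longrightarrow> ((\<lambda>t. p t i) has_real_derivative
        \<rho> t * (p t i * (fitness \<beta> (p t) i - mean_fitness \<beta> (p t)))) (at t within {s..})"
    and near: "s \<le> t \<Longrightarrow> near_edges E \<eta> (p t)"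
    and eta_pos: "0 < \<eta>" and eta_small: "\<eta> \<le> c\<^sup>2 / (2000 * A\<^sup>2)"
begin

lemmas eta_le = eta_bounds(3)[OF nonneg sum1 near eta_pos eta_small, OF order_refl order_refl order_refl]

lemma p_cont: "continuous_on {s..} (\<lambda>t. p t i)"
  using deriv by (meson DERIV_continuous atLeast_iff continuous_on_eq_continuous_within)

lemma dom_ge: "s \<le> t \<Longrightarrow> dominates (p t) k \<Longrightarrow> 1 / 4 \<le> p t k"
  using dominates_ge nonneg sum1 by blast

lemma deriv_Icc: "s \<le> a \<Longrightarrow> t \<in> {a..b} \<Longrightarrow> ((\<lambda>t. p t i) has_real_derivative
    \<rho> t * (p t i * (fitness \<beta> (p t) i - mean_fitness \<beta> (p t)))) (at t within {a..b})"
  by (rule DERIV_subset[OF deriv]) auto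

lemma zero_iff:
  assumes "s \<le> a" "a \<le> b"
  shows "p a j = 0 \<longleftrightarrow> p b j = 0"
proof (rule linear_ode_zero_iff[OF assms(2)])
  let ?g = "\<lambda>t. \<rho> t * (fitness \<beta> (p t) j - mean_fitness \<beta> (p t))"
  fix t assume "t \<in> {a..b}"
  then show "((\<lambda>t. p t j) has_real_derivative ?g t * p t j) (at t within {a..b})"
    using deriv_Icc[OF assms(1), of t b j] by (simp add: mult_ac)
next
  have sub: "{a..b} \<subseteq> {s..}" using assms by auto
  show "continuous_on {a..b} (\<lambda>t. \<rho> t * (fitness \<beta> (p t) j - mean_fitness \<beta> (p t)))"
    unfolding fitness_def mean_fitness_def
    by (intro continuous_intros continuous_on_subset[OF rho_cont sub]
        continuous_on_subset[OF p_cont sub])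
qed

lemma unique_tie:
  assumes "s \<le> t" "dominates (p t) k" "l \<noteq> k" "p t l = p t k"
  shows "(k, l) \<in> E \<or> (l, k) \<in> E" "\<And>i. i \<noteq> k \<Longrightarrow> i \<noteq> l \<Longrightarrow> p t i \<le> \<eta>"
proof -
  have "1 / 4 \<le> p t k" using dom_ge assms by blast
  then have "\<eta> < p t k" "\<eta> < p t l" using eta_le assms by simp_all
  from near_pair[OF nonneg sum1 near assms(3)[symmetric] this, OF assms(1) assms(1) assms(1)]
  show "(k, l) \<in> E \<or> (l, k) \<in> E" "\<And>i. i \<noteq> k \<Longrightarrow> i \<noteq> l \<Longrightarrow> p t i \<le> \<eta>" by blast+
qed

text \<open>Domination can end only at a tie with some \<open>l\<close>, and an edge \<open>(l, k)\<close> would make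
  \<open>p k\<close> overtake \<open>p l\<close> there.\<close>

lemma exit_along_edge:
  assumes t: "s \<le> t0" "t0 < t1" and dom: "dominates (p t0) k" and leave: "\<not> dominates (p t1) k"
  obtains b l where "t0 \<le> b" "b < t1" "(k, l) \<in> E" "p b l = p b k"
    "\<And>v. v \<in> {t0..b} \<Longrightarrow> dominates (p v) k"
proof -
  define S where "S = {u. t0 \<le> u \<and> u \<le> t1 \<and> \<not> dominates (p u) k}"
  have S: "S \<noteq> {}" "bdd_below S" using t leave by (auto simp: S_def bdd_below_def)
  define b where "b = Inf S"
  have b0: "t0 \<le> b" unfolding b_def by (rule cInf_greatest) (use S in \<open>auto simp: S_def\<close>)
  have "t1 \<in> S" using t leave by (auto simp: S_def)
  then have b1: "b \<le> t1" unfolding b_def using S(2) by (rule cInf_lower)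
  have before: "dominates (p v) k" if "t0 \<le> v" "v < b" for v
  proof (rule ccontr)
    assume "\<not> ?thesis"
    then have "v \<in> S" using that b1 by (auto simp: S_def)
    then show False using cInf_lower[OF _ S(2)] that by (fastforce simp: b_def)
  qed
  have domb: "dominates (p b) k"
  proof (cases "b = t0")
    case True then show ?thesis using dom by simp
  next
    case False
    then have lt: "t0 < b" using b0 by simp
    have "p b i \<le> p b k" for i
    proof -
      have "continuous_on {t0..b} (\<lambda>t. p t k - p t i)"
        by (intro continuous_intros continuous_on_subset[OF p_cont]) (use t in auto)
      then have "((\<lambda>t. p t k - p t i) \<longlongrightarrow> p b k - p b i) (at b within {t0..b})"
        using b0 by (simp add: continuous_on_def)
      then have lim: "((\<lambda>t. p t k - p t i) \<longlongrightarrow> p b k - p b i) (at b within {t0..<b})"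
        by (rule tendsto_within_subset) auto
      have "eventually (\<lambda>t. 0 \<le> p t k - p t i) (at b within {t0..<b})"
        unfolding eventually_at_filter using before by (auto simp: dominates_def)
      moreover have "at b within {t0..<b} \<noteq> bot"
        using lt by (simp add: at_within_eq_bot_iff islimpt_Ico)
      ultimately have "0 \<le> p b k - p b i" using tendsto_lowerbound[OF lim] by blast
      then show ?thesis by simp
    qed
    then show ?thesis by (simp add: dominates_def)
  qed
  then have b1': "b < t1" using b1 leave by (cases "b = t1") auto
  have sb: "s \<le> b" using t b0 by simp
  have "\<exists>l. (k, l) \<in> E \<and> p b l = p b k"
  proof (rule ccontr)
    assume none: "\<not> ?thesis"
    have ev: "eventually (\<lambda>u. p u i \<le> p u k) (at_right b)" for i
    proof (cases "i = k")
      case True then show ?thesis by simp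
    next
      case ik: False
      have tend: "((\<lambda>t. p t k - p t i) \<longlongrightarrow> p b k - p b i) (at_right b)"
      proof (rule tendsto_within_subset)
        show "((\<lambda>t. p t k - p t i) \<longlongrightarrow> p b k - p b i) (at b within {s..})"
          using sb p_cont[of k] p_cont[of i] by (auto simp: continuous_on_def intro: tendsto_diff)
      qed (use sb in auto)
      show ?thesis
      proof (cases "p b i < p b k")
        case True
        then have "eventually (\<lambda>t. 0 < p t k - p t i) (at_right b)"
          using order_tendstoD(1)[OF tend, of 0] by simp
        then show ?thesis by eventually_elim simp
      next
        case False
        then have tie: "p b i = p b k" using domb by (simp add: dominates_def antisym)
        then have e: "(i, k) \<in> E" using unique_tie(1)[OF sb domb ik] none by blast
        have big: "\<eta> < p b i" using dom_ge[OF sb domb] tie eta_le by simp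
        have "fitness \<beta> (p b) i < fitness \<beta> (p b) k"
          using growth_along_edge(3)[OF nonneg sum1 near eta_pos eta_small domb big ik[symmetric] e]
            sb by blast
        then have pos: "0 < \<rho> b * (p b k * (fitness \<beta> (p b) k - fitness \<beta> (p b) i))"
          using rho_pos[OF sb] dom_ge[OF sb domb] by (intro mult_pos_pos) auto
        have "((\<lambda>t. p t k - p t i) has_real_derivative
            \<rho> b * (p b k * (fitness \<beta> (p b) k - fitness \<beta> (p b) i))) (at b within {s..})"
          using DERIV_diff[OF deriv[OF sb, of k] deriv[OF sb, of i]] tie by (simp add: algebra_simps)
        from has_real_derivative_pos_inc_right[OF this pos] obtain d where "d > 0" and
          d: "\<And>h. h > 0 \<Longrightarrow> b + h \<in> {s..} \<Longrightarrow> h < d \<Longrightarrow> p b k - p b i < p (b + h) k - p (b + h) i"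
          by blast
        show ?thesis unfolding eventually_at_right_field
        proof (intro exI[of _ "b + d"] conjI allI impI)
          show "b < b + d" using \<open>d > 0\<close> by simp
          fix u assume "b < u" "u < b + d"
          then show "p u i \<le> p u k" using d[of "u - b"] sb tie by simp
        qed
      qed
    qed
    have "eventually (\<lambda>u. \<forall>i. p u i \<le> p u k) (at_right b)"
      using ev by (simp add: eventually_all_finite)
    then obtain d where d: "d > b" "\<And>u. b < u \<Longrightarrow> u < d \<Longrightarrow> dominates (p u) k"
      by (auto simp: eventually_at_right_field dominates_def)
    obtain u where u: "u \<in> S" "u < d" using cInf_lessD[OF S(1), of d] d(1) b_def by auto
    have "b \<le> u" using cInf_lower[OF u(1) S(2)] b_def by simp
    then have "dominates (p u) k" using d(2)[of u] u(2) domb by (cases "u = b") auto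
    then show False using u(1) by (simp add: S_def)
  qed
  then obtain l where "(k, l) \<in> E" "p b l = p b k" by blast
  then show ?thesis using that[of b l] b0 b1' before domb by (metis atLeastAtMost_iff less_eq_real_def)
qed

end

context replicator_orbit
begin

lemma potential_deriv:
  assumes "s \<le> a" "t \<in> {a..b}"
  shows "((\<lambda>t. potential \<beta> k (p t)) has_real_derivative \<rho> t * (\<Sum>i\<in>UNIV - {k}.
      sgn (\<beta> k i) * (p t i * (fitness \<beta> (p t) i - mean_fitness \<beta> (p t))))) (at t within {a..b})"
proof -
  have "((\<lambda>t. potential \<beta> k (p t)) has_real_derivative (\<Sum>i\<in>UNIV - {k}.
      sgn (\<beta> k i) * (\<rho> t * (p t i * (fitness \<beta> (p t) i - mean_fitness \<beta> (p t))))))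
      (at t within {a..b})"
    unfolding potential_def by (intro DERIV_sum DERIV_cmult deriv_Icc assms)
  then show ?thesis by (simp add: sum_distrib_left mult_ac)
qed

text \<open>The deviation of the growth rate of \<open>ln (p j)\<close> from the eigenvalue \<open>\<beta> k j\<close> is at most
  \<open>4 A (1 - p k)\<close>, which the bounded function \<open>potential \<beta> k\<close> integrates. Hence the error does
  not depend on how long the orbit stays near the equilibrium.\<close>

lemma log_growth_while_dominated:
  assumes ab: "s \<le> a" "a \<le> b" and dom: "\<And>v. v \<in> {a..b} \<Longrightarrow> dominates (p v) k"
  obtains T where "0 \<le> T"
    "\<And>j. 0 < p a j \<Longrightarrow> \<bar>ln (p b j) - ln (p a j) - \<beta> k j * T\<bar> \<le> 256 * A / c"
proof -
  define \<tau> where "\<tau> t = integral {a..t} \<rho>" for t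
  have cont: "continuous_on {a..b} \<rho>" using continuous_on_subset[OF rho_cont] ab by auto
  have tau: "(\<tau> has_real_derivative \<rho> t) (at t within {a..b})" if "t \<in> {a..b}" for t
    unfolding \<tau>_def has_real_derivative_iff_has_vector_derivative
    by (rule integral_has_vector_derivative[OF cont that])
  have tau_a: "\<tau> a = 0" by (simp add: \<tau>_def)
  define L where "L = 128 * A / c"
  have L: "L \<ge> 0" using A_pos c_pos by (simp add: L_def)
  show ?thesis
  proof (rule that)
    show "0 \<le> \<tau> b" using nondecreasing_within[OF ab(2) tau] rho_pos ab tau_a
      by (force simp: less_imp_le)
    fix j assume pj: "0 < p a j"
    define f where "f t = ln (p t j) - \<beta> k j * \<tau> t" for t
    define g where "g t = fitness \<beta> (p t) j - mean_fitness \<beta> (p t) - \<beta> k j" for t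
    define S where "S t = (\<Sum>i\<in>UNIV - {k}.
      sgn (\<beta> k i) * (p t i * (fitness \<beta> (p t) i - mean_fitness \<beta> (p t))))" for t
    have f: "(f has_real_derivative \<rho> t * g t) (at t within {a..b})" if t: "t \<in> {a..b}" for t
    proof -
      have "p t j \<noteq> 0" using zero_iff[of a t j] pj t ab by auto
      then have pos: "0 < p t j" using nonneg[of t j] t ab by (simp add: less_le)
      have "((\<lambda>t. ln (p t j)) has_real_derivative
          1 / p t j * (\<rho> t * (p t j * (fitness \<beta> (p t) j - mean_fitness \<beta> (p t)))))
          (at t within {a..b})"
        by (rule DERIV_chain2[OF DERIV_ln_divide[OF pos] deriv_Icc[OF ab(1) t]])
      then have "(f has_real_derivative
          1 / p t j * (\<rho> t * (p t j * (fitness \<beta> (p t) j - mean_fitness \<beta> (p t))))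
          - \<beta> k j * \<rho> t) (at t within {a..b})"
        unfolding f_def by (rule DERIV_diff) (rule DERIV_cmult[OF tau[OF t]])
      moreover have "1 / p t j * (\<rho> t * (p t j * (fitness \<beta> (p t) j - mean_fitness \<beta> (p t))))
          - \<beta> k j * \<rho> t = \<rho> t * g t"
        using pos by (simp add: g_def field_simps)
      ultimately show ?thesis by simp
    qed
    have G: "((\<lambda>t. L * potential \<beta> k (p t)) has_real_derivative L * (\<rho> t * S t)) (at t within {a..b})"
      if "t \<in> {a..b}" for t
      unfolding S_def by (rule DERIV_cmult[OF potential_deriv[OF ab(1) that]])
    have rate: "\<bar>\<rho> t * g t\<bar> \<le> L * (\<rho> t * S t)" if t: "t \<in> {a..b}" for t
    proof -
      have st: "s \<le> t" using t ab by auto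
      have "c / 32 * (1 - p t k) \<le> S t"
        unfolding S_def by (rule potential_rate[OF nonneg sum1 near eta_pos eta_small])
          (use st dom t in auto)
      then have "L * (c / 32 * (1 - p t k)) \<le> L * S t" using L by (intro mult_left_mono)
      moreover have "L * (c / 32 * (1 - p t k)) = 4 * A * (1 - p t k)" using c_pos by (simp add: L_def)
      moreover have "\<bar>g t\<bar> \<le> 4 * A * (1 - p t k)"
        unfolding g_def by (rule growth_near_vertex[OF nonneg sum1]) (use st in auto)
      ultimately have "\<bar>g t\<bar> \<le> L * S t" by linarith
      then have "\<rho> t * \<bar>g t\<bar> \<le> \<rho> t * (L * S t)" using rho_pos[OF st] by (intro mult_left_mono) auto
      then show ?thesis using rho_pos[OF st] by (simp add: abs_mult mult_ac)
    qed
    have up: "(\<lambda>t. L * potential \<beta> k (p t) - f t) a \<le> (\<lambda>t. L * potential \<beta> k (p t) - f t) b"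
    proof (rule nondecreasing_within[OF ab(2)])
      fix t assume t: "t \<in> {a..b}"
      show "((\<lambda>t. L * potential \<beta> k (p t) - f t) has_real_derivative L * (\<rho> t * S t) - \<rho> t * g t)
          (at t within {a..b})" by (intro DERIV_diff G f t)
      show "0 \<le> L * (\<rho> t * S t) - \<rho> t * g t" using rate[OF t] by simp
    qed
    have lo: "(\<lambda>t. L * potential \<beta> k (p t) + f t) a \<le> (\<lambda>t. L * potential \<beta> k (p t) + f t) b"
    proof (rule nondecreasing_within[OF ab(2)])
      fix t assume t: "t \<in> {a..b}"
      show "((\<lambda>t. L * potential \<beta> k (p t) + f t) has_real_derivative L * (\<rho> t * S t) + \<rho> t * g t)
          (at t within {a..b})" by (intro DERIV_add G f t)
      show "0 \<le> L * (\<rho> t * S t) + \<rho> t * g t" using rate[OF t] by simp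
    qed
    have b1: "\<bar>potential \<beta> k (p t)\<bar> \<le> 1" if "s \<le> t" for t
      using potential_bound[OF nonneg sum1 near eta_pos eta_small, OF that that that, of k] nonneg[OF that, of k]
      by linarith
    have "\<bar>L * potential \<beta> k (p t)\<bar> \<le> L" if "s \<le> t" for t
      using mult_left_mono[OF b1[OF that] L] L by (simp add: abs_mult)
    from this[of a] this[of b] have "\<bar>f b - f a\<bar> \<le> 2 * L"
      using up lo ab by (simp add: abs_le_iff)
    moreover have "f b - f a = ln (p b j) - ln (p a j) - \<beta> k j * \<tau> b" by (simp add: f_def tau_a)
    ultimately show "\<bar>ln (p b j) - ln (p a j) - \<beta> k j * \<tau> b\<bar> \<le> 256 * A / c"
      by (simp add: L_def)
  qed
qed

text \<open>The potential of \<open>k\<close> is negative on an incoming edge and positive on an outgoing one, and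
  where it vanishes no second coordinate can be large.\<close>

lemma passes_near_vertex:
  assumes ab: "s \<le> a" "a \<le> b" and dom: "\<And>v. v \<in> {a..b} \<Longrightarrow> dominates (p v) k"
    and j: "(j, k) \<in> E" "p a j = p a k" and l: "(k, l) \<in> E" "p b l = p b k"
  obtains t where "t \<in> {a..b}" "1 - p t k \<le> 4 * \<eta>"
proof -
  have sb: "s \<le> b" using ab by simp
  have da: "dominates (p a) k" and db: "dominates (p b) k" using dom ab by auto
  have jk: "j \<noteq> k" "l \<noteq> k" using edge_lower j l by blast+
  have "\<bar>potential \<beta> k (p a) - sgn (\<beta> k j) * p a j\<bar> \<le> 2 * \<eta>"
    using potential_near_edge[OF nonneg sum1 near eta_pos eta_small, OF ab(1) ab(1) ab(1)
      jk(1)[symmetric] unique_tie(2)[OF ab(1) da jk(1) j(2)]] by blast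
  then have 1: "potential \<beta> k (p a) \<le> 0"
    using edge[OF j(1)] dom_ge[OF ab(1) da] j(2) eta_le by simp
  have "\<bar>potential \<beta> k (p b) - sgn (\<beta> k l) * p b l\<bar> \<le> 2 * \<eta>"
    using potential_near_edge[OF nonneg sum1 near eta_pos eta_small, OF sb sb sb
      jk(2)[symmetric] unique_tie(2)[OF sb db jk(2) l(2)]] by blast
  then have 2: "0 \<le> potential \<beta> k (p b)"
    using edge[OF l(1)] dom_ge[OF sb db] l(2) eta_le by simp
  have "continuous_on {a..b} (\<lambda>t. potential \<beta> k (p t))"
    using potential_deriv[OF ab(1)] by (meson DERIV_continuous continuous_on_eq_continuous_within)
  then obtain t where t: "a \<le> t" "t \<le> b" "potential \<beta> k (p t) = 0"
    using IVT'[of "\<lambda>t. potential \<beta> k (p t)" a 0 b, OF 1 2 ab(2)] by blast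
  have st: "s \<le> t" using t ab by simp
  have "1 - p t k \<le> 4 * \<eta>"
    using potential_zero_imp_vertex[OF nonneg sum1 near eta_pos eta_small, OF st st st _ t(3)] dom t
    by auto
  then show ?thesis using that[of t] t by auto
qed

text \<open>At the level \<open>1 / 4\<close> the point lies near the edge from \<open>k\<close> to \<open>l\<close>, where the share of \<open>l\<close> increases.\<close>

lemma outgoing_share_persists:
  assumes ab: "s \<le> a" "a \<le> b" and dom: "\<And>v. v \<in> {a..b} \<Longrightarrow> dominates (p v) k"
    and l: "(k, l) \<in> E" "1 / 4 \<le> p a l"
  shows "1 / 4 \<le> p b l"
proof (rule barrier[OF ab(2) deriv_Icc[OF ab(1)] _ l(2)])
  fix t assume t: "t \<in> {a..b}" "p t l = 1 / 4"
  have st: "s \<le> t" using t ab by auto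
  have "c / 16 \<le> fitness \<beta> (p t) l - mean_fitness \<beta> (p t)"
    using growth_along_edge(1)[OF nonneg sum1 near eta_pos eta_small, OF st st st dom[OF t(1)] _ _ l(1)]
      t eta_le edge_lower[OF l(1)] by simp
  then show "0 < \<rho> t * (p t l * (fitness \<beta> (p t) l - mean_fitness \<beta> (p t)))"
    using rho_pos[OF st] t(2) c_pos by (intro mult_pos_pos) auto
qed

text \<open>The symbolic description of an orbit: between consecutive crossings a single share dominates, and
  the crossed edges form a path in the graph \<open>E\<close>.\<close>

definition crossing :: "real \<Rightarrow> 4 \<Rightarrow> 4 \<Rightarrow> bool" where
  "crossing t j k \<longleftrightarrow> (j, k) \<in> E \<and> dominates (p t) k \<and> p t j = p t k"

definition stays :: "4 \<Rightarrow> real \<Rightarrow> real \<Rightarrow> bool" where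
  "stays k a b \<longleftrightarrow> (\<forall>v\<in>{a..b}. dominates (p v) k)"

lemma crossing_unique:
  assumes "s \<le> t" "crossing t j k" "dominates (p t) i"
  shows "i = j \<or> i = k"
proof (rule ccontr)
  assume "\<not> ?thesis"
  moreover have "j \<noteq> k" using edge_lower assms(2) by (auto simp: crossing_def)
  ultimately have "p t i \<le> \<eta>" using unique_tie(2)[of t k j i] assms by (auto simp: crossing_def)
  then show False using dom_ge[OF assms(1,3)] eta_le by simp
qed

lemma crossing_functional:
  assumes "s \<le> t" "crossing t j k" "crossing t m n"
  shows "j = m \<and> k = n"
proof -
  have "dominates (p t) j" "dominates (p t) k" "dominates (p t) m" "dominates (p t) n"
    using assms(2,3) by (auto simp: crossing_def dominates_def)
  then have "m \<in> {j, k}" "n \<in> {j, k}" "j \<in> {m, n}" "k \<in> {m, n}"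
    using crossing_unique[OF assms(1)] assms(2,3) by blast+
  moreover have "(j, k) \<in> E" "(m, n) \<in> E" using assms by (auto simp: crossing_def)
  moreover have "j \<noteq> k" "m \<noteq> n" using edge_lower calculation by blast+
  ultimately show ?thesis using edge_antisym by blast
qed

lemma not_dominated_before_crossing:
  assumes a: "s \<le> a" "a < b" and cr: "crossing b m n"
  shows "\<exists>v\<in>{a..<b}. \<not> dominates (p v) n"
proof -
  have sb: "s \<le> b" and mn: "m \<noteq> n" "(m, n) \<in> E" and dom: "dominates (p b) n" and tie: "p b m = p b n"
    using a cr edge_lower by (auto simp: crossing_def)
  have "\<eta> < p b m" using dom_ge[OF sb dom] tie eta_le by simp
  then have "fitness \<beta> (p b) m < fitness \<beta> (p b) n"
    using growth_along_edge(3)[OF nonneg sum1 near eta_pos eta_small dom _ mn(1)[symmetric] mn(2)] sb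
    by blast
  then have pos: "0 < \<rho> b * (p b n * (fitness \<beta> (p b) n - fitness \<beta> (p b) m))"
    using rho_pos[OF sb] dom_ge[OF sb dom] by (intro mult_pos_pos) auto
  have "((\<lambda>t. p t n - p t m) has_real_derivative
      \<rho> b * (p b n * (fitness \<beta> (p b) n - fitness \<beta> (p b) m))) (at b within {s..})"
    using DERIV_diff[OF deriv[OF sb, of n] deriv[OF sb, of m]] tie by (simp add: algebra_simps)
  from has_real_derivative_pos_inc_left[OF this pos] obtain d where "d > 0" and
    d: "\<And>h. h > 0 \<Longrightarrow> b - h \<in> {s..} \<Longrightarrow> h < d \<Longrightarrow> p (b - h) n - p (b - h) m < p b n - p b m"
    by blast
  define h where "h = min (d / 2) (b - a)"
  have h: "h > 0" "b - h \<in> {s..}" "h < d" "b - h \<in> {a..<b}"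
    using \<open>d > 0\<close> a by (auto simp: h_def)
  from d[OF h(1-3)] tie have "\<not> dominates (p (b - h)) n" by (auto simp: dominates_def not_le)
  then show ?thesis using h(4) by blast
qed

lemma next_crossing:
  assumes ab: "s \<le> a" "a \<le> b" and cr: "crossing a j k" "crossing b m n" and ne: "(j, k) \<noteq> (m, n)"
  obtains b' l where "a < b'" "b' \<le> b" "crossing b' k l" "stays k a b'"
proof -
  have lt: "a < b" using ab crossing_functional[of a j k m n] cr ne by (cases "a = b") auto
  have da: "dominates (p a) k" using cr by (simp add: crossing_def)
  have "\<exists>b' l. a \<le> b' \<and> b' \<le> b \<and> crossing b' k l \<and> stays k a b'"
  proof (cases "stays k a b")
    case True
    then have "dominates (p b) k" using ab by (simp add: stays_def)
    then have "k = m \<or> k = n" using crossing_unique[of b m n k] cr(2) ab by simp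
    moreover have "k \<noteq> n"
      using not_dominated_before_crossing[OF ab(1) lt cr(2)] True by (auto simp: stays_def)
    ultimately show ?thesis using True cr(2) ab by blast
  next
    case False
    then obtain v where v: "a \<le> v" "v \<le> b" "\<not> dominates (p v) k" by (auto simp: stays_def)
    then have "a < v" using da by (cases "a = v") auto
    from exit_along_edge[OF ab(1) this da v(3)] obtain b' l where
      "a \<le> b'" "b' < v" "(k, l) \<in> E" "p b' l = p b' k" "\<And>v. v \<in> {a..b'} \<Longrightarrow> dominates (p v) k" by blast
    moreover from this have "dominates (p b') l" by (auto simp: dominates_def)
    ultimately show ?thesis using v(2) by (auto simp: crossing_def stays_def intro!: exI[of _ b'] exI[of _ l])
  qed
  then obtain b' l where b': "a \<le> b'" "b' \<le> b" "crossing b' k l" "stays k a b'" by blast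
  have "a \<noteq> b'"
  proof
    assume "a = b'"
    then have "j = k" using crossing_functional[OF ab(1) cr(1)] b'(3) by blast
    then show False using cr(1) edge_lower by (auto simp: crossing_def)
  qed
  then show ?thesis using that[of b' l] b' by simp
qed

text \<open>In the comparisons below the orbit has to be followed from the last choice of one kind to the
  first choice of the other kind.\<close>

lemma last_crossing:
  assumes ab: "s \<le> a" "a \<le> b" and cr: "crossing a j k" "(j, k) \<in> J"
  obtains t m n where "a \<le> t" "t \<le> b" "crossing t m n" "(m, n) \<in> J"
    "\<And>u m n. t < u \<Longrightarrow> u \<le> b \<Longrightarrow> (m, n) \<in> J \<Longrightarrow> \<not> crossing u m n"
proof -
  define S where "S = (\<Union>(m, n)\<in>J \<inter> E. {t\<in>{a..b}. p t n \<le> p t m} \<inter> (\<Inter>i. {t\<in>{a..b}. p t i \<le> p t n}))"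
  have S: "t \<in> S \<longleftrightarrow> t \<in> {a..b} \<and> (\<exists>(m, n)\<in>J. crossing t m n)" for t
  proof -
    have *: "p t m = p t n \<longleftrightarrow> p t n \<le> p t m" if "dominates (p t) n" for m n
      using that by (auto simp: dominates_def intro: antisym)
    have "t \<in> S \<longleftrightarrow> t \<in> {a..b} \<and> (\<exists>(m, n)\<in>J. (m, n) \<in> E \<and> dominates (p t) n \<and> p t n \<le> p t m)"
      unfolding S_def dominates_def by blast
    then show ?thesis using * unfolding crossing_def by blast
  qed
  have cont: "continuous_on {a..b} (\<lambda>t. p t i)" for i
    using continuous_on_subset[OF p_cont] ab by auto
  have "finite (J \<inter> E)" by (rule finite_subset[of _ UNIV]) auto
  then have "closed S" unfolding S_def case_prod_unfold
    by (intro closed_UN closed_Int closed_INT ballI continuous_on_closed_Collect_le cont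
        closed_atLeastAtMost)
  moreover have "bounded S" by (rule bounded_subset[of "{a..b}"]) (auto simp: S)
  moreover have "a \<in> S" using ab cr by (auto simp: S)
  ultimately obtain t where t: "t \<in> S" "\<And>u. u \<in> S \<Longrightarrow> u \<le> t"
    using compact_attains_sup[of S] by (auto simp: compact_eq_bounded_closed)
  obtain m n where "(m, n) \<in> J" "crossing t m n" "a \<le> t" "t \<le> b" using t(1) by (auto simp: S)
  moreover have "\<not> crossing u m n" if "t < u" "u \<le> b" "(m, n) \<in> J" for u m n
    using t(2)[of u] that \<open>a \<le> t\<close> by (fastforce simp: S)
  ultimately show ?thesis using that by blast
qed

end

section \<open>Log-linear functionals and irreversible choices\<close>

lemma ln_quarter: "- 2 \<le> ln (1 / 4 :: real)"
proof -
  have "(2::real) \<le> exp 1" using exp_ge_add_one_self[of 1] by simp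
  then have "(2::real) * 2 \<le> exp 1 * exp 1" by (intro mult_mono) auto
  then have "(4::real) \<le> exp 2" by (simp add: exp_add[symmetric])
  then have "ln (4::real) \<le> 2" using ln_le_cancel_iff[of 4 "exp 2"] by simp
  then show ?thesis by (simp add: ln_div)
qed

text \<open>The signs shared by the three networks. The remaining eigenvalues \<open>\<beta> 3 1\<close> and \<open>\<beta> 3 4\<close> distinguish
  them.\<close>

locale three_cycle_signs = replicator_signs +
  assumes edges_sub: "E \<subseteq> {(1, 2), (2, 3), (2, 4), (3, 1), (3, 4), (4, 1)}"
    and pos: "0 < \<beta> 1 2" "0 < \<beta> 2 3" "0 < \<beta> 2 4" "0 < \<beta> 4 1"
    and neg: "\<beta> 2 1 < 0" "\<beta> 3 2 < 0" "\<beta> 4 2 < 0" "\<beta> 1 4 < 0" "\<beta> 1 3 < 0" "\<beta> 4 3 < 0"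

text \<open>The additional assumption makes \<open>- ln \<eta>\<close>, the logarithmic distance to the separatrices, larger than
  all errors that accumulate during one turn.\<close>

locale three_cycle_orbit = replicator_orbit + three_cycle_signs +
  assumes eta_large: "40 * A\<^sup>2 * (256 * A / c + 1) < c\<^sup>2 * (- ln \<eta>)"
begin

definition K where "K = 256 * A / c"
abbreviation B where "B \<equiv> - ln \<eta>"

lemma K_nonneg: "0 \<le> K" using A_pos c_pos by (simp add: K_def)

lemma eta_large_K: "40 * A\<^sup>2 * (K + 1) < c\<^sup>2 * B"
  using eta_large by (simp add: K_def)

lemma B_pos: "0 < B"
proof -
  have "0 \<le> 40 * A\<^sup>2 * (K + 1)" using K_nonneg by simp
  then have "0 < c\<^sup>2 * B" using eta_large_K by linarith
  then show ?thesis by (rule zero_less_mult_pos) (use c_pos in simp)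
qed

lemma bounds: "c \<le> \<beta> 2 3" "c \<le> \<beta> 2 4" "c \<le> - \<beta> 4 2"
  using lower[of 2 3] lower[of 2 4] lower[of 4 2] pos neg by auto

lemma successors:
  "crossing t 1 l \<Longrightarrow> l = 2" "crossing t 2 l \<Longrightarrow> l = 3 \<or> l = 4"
  "crossing t 3 l \<Longrightarrow> l = 1 \<or> l = 4" "crossing t 4 l \<Longrightarrow> l = 1"
  using edges_sub by (auto simp: crossing_def)

text \<open>Coordinate hyperplanes are invariant: a share that vanishes once vanishes forever. Only the
  logarithms of the other shares carry information.\<close>

definition alive :: "4 \<Rightarrow> bool" where
  "alive j \<longleftrightarrow> 0 < p s j"

lemma alive_iff: "s \<le> t \<Longrightarrow> alive j \<longleftrightarrow> 0 < p t j"
  using zero_iff[of s t j] nonneg[of s j] nonneg[of t j] by (auto simp: alive_def less_le)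

lemma crossing_alive: "s \<le> t \<Longrightarrow> crossing t j k \<Longrightarrow> alive j \<and> alive k"
  using dom_ge[of t k] by (auto simp: crossing_def alive_iff[of t])

lemma crossing_ln:
  assumes st: "s \<le> t" and cr: "crossing t j k" and i: "i = j \<or> i = k"
  shows "- 2 \<le> ln (p t i)"
proof -
  have "1 / 4 \<le> p t i" using dom_ge[OF st, of k] cr i by (auto simp: crossing_def)
  then have "ln (1 / 4) \<le> ln (p t i)" by simp
  then show ?thesis using ln_quarter by linarith
qed

lemma ln_nonpos: "s \<le> t \<Longrightarrow> ln (p t i) \<le> 0"
  using p_le_1[OF nonneg sum1, of t] nonneg[of t i] by (cases "p t i = 0") (auto simp: less_le)

lemma crossing_ln_small:
  assumes st: "s \<le> t" and cr: "crossing t j k" and i: "alive i" "\<not> (i = j \<or> i = k)"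
  shows "ln (p t i) \<le> - B"
proof -
  have "j \<noteq> k" using cr edge_lower by (auto simp: crossing_def)
  then have "p t i \<le> \<eta>" using unique_tie(2)[OF st, of k j i] cr i by (auto simp: crossing_def)
  moreover have "0 < p t i" using i(1) alive_iff[OF st] by simp
  ultimately show ?thesis by simp
qed

definition log_weight :: "(4 \<Rightarrow> real) \<Rightarrow> real \<Rightarrow> real" where
  "log_weight w t = (\<Sum>j\<in>UNIV. w j * ln (p t j))"

definition admissible :: "(4 \<Rightarrow> real) \<Rightarrow> bool" where
  "admissible w \<longleftrightarrow> (\<forall>j. \<bar>w j\<bar> \<le> 2 * A\<^sup>2 \<and> (w j \<noteq> 0 \<longrightarrow> alive j))"

text \<open>During a passage of \<open>\<xi> k\<close> the logarithms change by \<open>\<beta> k j\<close> times the same duration \<open>T\<close>, up to bounded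
  errors. A combination whose rate at \<open>\<xi> k\<close> is not positive therefore cannot grow by more than these
  errors. Four coordinates with weights of size \<open>2 A\<^sup>2\<close> give the factor 8.\<close>

lemma log_weight_stays:
  assumes ab: "s \<le> a" "a \<le> b" and st: "stays k a b" and w: "admissible w"
    and rate: "(\<Sum>j\<in>UNIV. w j * \<beta> k j) \<le> 0"
  shows "log_weight w b \<le> log_weight w a + 8 * A\<^sup>2 * K"
proof -
  have dom: "dominates (p v) k" if "v \<in> {a..b}" for v using st that by (simp add: stays_def)
  obtain T where T: "0 \<le> T"
    "\<And>j. 0 < p a j \<Longrightarrow> \<bar>ln (p b j) - ln (p a j) - \<beta> k j * T\<bar> \<le> 256 * A / c"
    using log_growth_while_dominated[OF ab dom] by blast
  have "w j * ln (p b j) \<le> w j * ln (p a j) + T * (w j * \<beta> k j) + 2 * A\<^sup>2 * K" for j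
  proof (cases "w j = 0")
    case True then show ?thesis using K_nonneg by simp
  next
    case False
    then have "\<bar>ln (p b j) - ln (p a j) - \<beta> k j * T\<bar> \<le> K"
      using T(2)[of j] w alive_iff[OF ab(1)] by (simp add: admissible_def K_def)
    then have "\<bar>w j\<bar> * \<bar>ln (p b j) - ln (p a j) - \<beta> k j * T\<bar> \<le> 2 * A\<^sup>2 * K"
      using w K_nonneg by (intro mult_mono) (auto simp: admissible_def)
    then have "w j * (ln (p b j) - ln (p a j) - \<beta> k j * T) \<le> 2 * A\<^sup>2 * K"
      by (metis abs_ge_self abs_mult order_trans)
    then show ?thesis by (simp add: algebra_simps)
  qed
  then have "log_weight w b \<le> (\<Sum>j\<in>UNIV. w j * ln (p a j) + T * (w j * \<beta> k j) + 2 * A\<^sup>2 * K)"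
    unfolding log_weight_def by (intro sum_mono) auto
  also have "\<dots> = log_weight w a + T * (\<Sum>j\<in>UNIV. w j * \<beta> k j) + 8 * A\<^sup>2 * K"
    by (simp add: log_weight_def sum.distrib sum_distrib_left)
  also have "\<dots> \<le> log_weight w a + 0 + 8 * A\<^sup>2 * K"
    using mult_nonneg_nonpos[OF T(1) rate] by linarith
  finally show ?thesis by simp
qed

text \<open>At a crossing the logarithms of the two shares on the edge lie between \<open>-2\<close> and 0, the others are
  at most \<open>-B\<close>. With the signs required of the weights the combination is bounded above at the first
  crossing, and it is at least of the order \<open>c\<^sup>2 B\<close> at the second one.\<close>

lemma no_climb:
  assumes w: "admissible w" and a: "s \<le> a" "crossing a j k" and b: "s \<le> b" "crossing b m n"
    and lo: "\<forall>i. i = j \<or> i = k \<or> 0 \<le> w i" and hi: "\<forall>i. i = m \<or> i = n \<or> w i \<le> 0"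
    and i: "i \<noteq> m" "i \<noteq> n" "w i \<le> - c\<^sup>2"
    and le: "log_weight w b \<le> log_weight w a + 24 * A\<^sup>2 * K"
  shows False
proof -
  have wb: "\<bar>w l\<bar> \<le> 2 * A\<^sup>2" for l using w by (simp add: admissible_def)
  have edge_term: "\<bar>w l * ln (p t l)\<bar> \<le> 4 * A\<^sup>2" if "s \<le> t" "- 2 \<le> ln (p t l)" for l t
  proof -
    have "\<bar>ln (p t l)\<bar> \<le> 2" using that(2) ln_nonpos[OF that(1), of l] by linarith
    then have "\<bar>w l\<bar> * \<bar>ln (p t l)\<bar> \<le> (2 * A\<^sup>2) * 2" using wb by (intro mult_mono) auto
    then show ?thesis by (simp add: abs_mult)
  qed
  have "w l * ln (p a l) \<le> 4 * A\<^sup>2" for l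
  proof (cases "l = j \<or> l = k")
    case True
    then show ?thesis using edge_term[OF a(1) crossing_ln[OF a True]] by (simp add: abs_le_iff)
  next
    case False
    then have "w l * ln (p a l) \<le> 0"
      using lo ln_nonpos[OF a(1), of l] by (auto intro: mult_nonneg_nonpos)
    then show ?thesis using zero_le_power2[of A] by linarith
  qed
  then have "log_weight w a \<le> (\<Sum>l::4\<in>UNIV. 4 * A\<^sup>2)" unfolding log_weight_def by (intro sum_mono) auto
  then have up: "log_weight w a \<le> 16 * A\<^sup>2" by simp
  have "(if l = i then c\<^sup>2 * B else 0) - 4 * A\<^sup>2 \<le> w l * ln (p b l)" for l
  proof (cases "l = m \<or> l = n")
    case True
    then show ?thesis using edge_term[OF b(1) crossing_ln[OF b True]] i by (auto simp: abs_le_iff)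
  next
    case False
    then have neg: "w l \<le> 0" using hi by blast
    show ?thesis
    proof (cases "l = i")
      case True
      have "0 < c\<^sup>2" using c_pos by simp
      then have "w i \<noteq> 0" using i(3) by linarith
      then have "alive i" using w by (simp add: admissible_def)
      then have "B \<le> - ln (p b i)" using crossing_ln_small[OF b, of i] i by simp
      then have "c\<^sup>2 * B \<le> (- w i) * (- ln (p b i))"
        using i(3) neg True B_pos by (intro mult_mono) auto
      then have "c\<^sup>2 * B \<le> w i * ln (p b i)" by (simp only: minus_mult_minus)
      then have "c\<^sup>2 * B - 4 * A\<^sup>2 \<le> w i * ln (p b i)" using zero_le_power2[of A] by linarith
      then show ?thesis using True by simp
    next
      case False
      have "0 \<le> w l * ln (p b l)" using neg ln_nonpos[OF b(1), of l] by (simp add: mult_nonpos_nonpos)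
      then have "0 - 4 * A\<^sup>2 \<le> w l * ln (p b l)" using zero_le_power2[of A] by linarith
      then show ?thesis using False by simp
    qed
  qed
  then have "(\<Sum>l\<in>UNIV. (if l = i then c\<^sup>2 * B else 0) - 4 * A\<^sup>2) \<le> log_weight w b"
    unfolding log_weight_def by (intro sum_mono) auto
  then have lw: "c\<^sup>2 * B - 16 * A\<^sup>2 \<le> log_weight w b" by (simp add: sum_subtractf)
  have "40 * A\<^sup>2 * (K + 1) = 24 * A\<^sup>2 * K + 16 * A\<^sup>2 * K + 40 * A\<^sup>2" by (simp add: algebra_simps)
  moreover have "0 \<le> A\<^sup>2 * K" using K_nonneg by simp
  ultimately show False using le up lw eta_large_K zero_le_power2[of A] by linarith
qed

lemma prod_le: "\<bar>\<beta> i j * \<beta> k l\<bar> \<le> A\<^sup>2"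
  unfolding abs_mult power2_eq_square using upper A_pos by (intro mult_mono) auto

lemma A_prod_le: "\<bar>A * \<beta> k l\<bar> \<le> A\<^sup>2"
  unfolding abs_mult power2_eq_square using upper A_pos by (intro mult_mono) auto

lemma prod_ge: "c \<le> x \<Longrightarrow> c \<le> y \<Longrightarrow> c\<^sup>2 \<le> x * y"
  unfolding power2_eq_square using c_pos by (intro mult_mono) auto

text \<open>\<open>W\<close> is the rate of change at \<open>\<xi>\<close>1 of the combination of the logarithms of coordinates 2, 3 and 4
  that is stationary at \<open>\<xi>\<close>2 and \<open>\<xi>\<close>4, and \<open>- V\<close> that of the combination for coordinates 1, 3 and 4
  that is stationary at \<open>\<xi>\<close>2 and \<open>\<xi>\<close>3.\<close>

definition W where "W = \<beta> 2 4 * \<beta> 4 3 * \<beta> 1 2 - \<beta> 4 2 * (\<beta> 2 4 * \<beta> 1 3 - \<beta> 2 3 * \<beta> 1 4)"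

definition V where "V = - \<beta> 3 1 * \<beta> 1 4 * \<beta> 2 3 + (\<beta> 3 1 * \<beta> 2 4 - \<beta> 3 4 * \<beta> 2 1) * \<beta> 1 3"

definition weights :: "real \<Rightarrow> real \<Rightarrow> real \<Rightarrow> real \<Rightarrow> 4 \<Rightarrow> real" where
  "weights w1 w2 w3 w4 i = (if i = 1 then w1 else if i = 2 then w2 else if i = 3 then w3 else w4)"

lemma weights_simps:
  "weights w1 w2 w3 w4 1 = w1" "weights w1 w2 w3 w4 2 = w2"
  "weights w1 w2 w3 w4 3 = w3" "weights w1 w2 w3 w4 4 = w4"
  by (simp_all add: weights_def)

text \<open>Three passages suffice for every comparison; a shorter turn is padded with a trivial one.\<close>

lemma no_turn:
  assumes t: "s \<le> t0" "t0 \<le> t1" "t1 \<le> t2" "t2 \<le> t3"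
    and cr: "crossing t0 j k" "crossing t3 m n"
    and st: "stays k1 t0 t1" "stays k2 t1 t2" "stays k3 t2 t3"
    and w: "\<forall>i. \<bar>w i\<bar> \<le> 2 * A\<^sup>2" "\<forall>i. i \<in> {j, k, m, n} \<or> w i = 0"
    and rates: "\<forall>l\<in>{k1, k2, k3}. (\<Sum>i\<in>UNIV. w i * \<beta> l i) \<le> 0"
    and lo: "\<forall>i. i = j \<or> i = k \<or> 0 \<le> w i" and hi: "\<forall>i. i = m \<or> i = n \<or> w i \<le> 0"
    and i: "i \<noteq> m" "i \<noteq> n" "w i \<le> - c\<^sup>2"
  shows False
proof -
  have s: "s \<le> t1" "s \<le> t2" "s \<le> t3" using t by auto
  have adm: "admissible w"
    using crossing_alive[OF t(1) cr(1)] crossing_alive[OF s(3) cr(2)] w by (auto simp: admissible_def)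
  have "log_weight w t1 \<le> log_weight w t0 + 8 * A\<^sup>2 * K"
    by (rule log_weight_stays[OF t(1,2) st(1) adm]) (use rates in simp)
  moreover have "log_weight w t2 \<le> log_weight w t1 + 8 * A\<^sup>2 * K"
    by (rule log_weight_stays[OF s(1) t(3) st(2) adm]) (use rates in simp)
  moreover have "log_weight w t3 \<le> log_weight w t2 + 8 * A\<^sup>2 * K"
    by (rule log_weight_stays[OF s(2) t(4) st(3) adm]) (use rates in simp)
  ultimately have le: "log_weight w t3 \<le> log_weight w t0 + 24 * A\<^sup>2 * K" by linarith
  show False by (rule no_climb[OF adm t(1) cr(1) s(3) cr(2) lo hi i le])
qed

lemma no_turn_4_then_3:
  assumes W: "W \<le> 0"
    and t: "s \<le> t0" "t0 \<le> t1" "t1 \<le> t2" "t2 \<le> t3"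
    and cr: "crossing t0 2 4" "crossing t3 2 3"
    and st: "stays 4 t0 t1" "stays 1 t1 t2" "stays 2 t2 t3"
  shows False
proof -
  let ?w = "weights 0 (\<beta> 2 4 * \<beta> 4 3) (- (\<beta> 4 2 * \<beta> 2 4)) (\<beta> 4 2 * \<beta> 2 3)"
  show False
  proof (rule no_turn[OF t cr st, of ?w 4])
    show "\<forall>i. \<bar>?w i\<bar> \<le> 2 * A\<^sup>2"
      using prod_le[of 2 4 4 3] prod_le[of 4 2 2 4] prod_le[of 4 2 2 3] zero_le_power2[of A]
      unfolding forall_4 weights_simps by linarith
    show "\<forall>l\<in>{4, 1, 2}. (\<Sum>i\<in>UNIV. ?w i * \<beta> l i) \<le> 0"
      using W by (simp add: sum_4 weights_simps diag W_def V_def algebra_simps)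
    show "\<forall>i. i = 2 \<or> i = 4 \<or> 0 \<le> ?w i" "\<forall>i. i = 2 \<or> i = 3 \<or> ?w i \<le> 0"
      using mult_neg_pos[OF neg(3) pos(3)] mult_neg_pos[OF neg(3) pos(2)] mult_pos_neg[OF pos(3) neg(6)]
      unfolding forall_4 weights_simps by simp_all
    show "?w 4 \<le> - c\<^sup>2" using prod_ge[OF bounds(3,1)] by (simp add: weights_simps)
  qed (simp_all add: forall_4 weights_simps)
qed

lemma no_turn_31_then_4:
  assumes D: "0 \<le> \<beta> 2 4 * \<beta> 1 3 - \<beta> 2 3 * \<beta> 1 4"
    and t: "s \<le> t0" "t0 \<le> t1" "t1 \<le> t2"
    and cr: "crossing t0 3 1" "crossing t2 2 4"
    and st: "stays 1 t0 t1" "stays 2 t1 t2"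
  shows False
proof -
  let ?w = "weights 0 0 (- (A * \<beta> 2 4)) (A * \<beta> 2 3)"
  have st0: "stays 1 t0 t0" using cr(1) by (simp add: stays_def crossing_def)
  show False
  proof (rule no_turn[OF t(1) order_refl t(2,3) cr st0 st, of ?w 3])
    show "\<forall>i. \<bar>?w i\<bar> \<le> 2 * A\<^sup>2"
      using A_prod_le[of 2 4] A_prod_le[of 2 3] zero_le_power2[of A] unfolding forall_4 weights_simps by linarith
    show "\<forall>l\<in>{1, 1, 2}. (\<Sum>i\<in>UNIV. ?w i * \<beta> l i) \<le> 0"
      using mult_left_mono[OF D, of A] A_pos by (simp add: sum_4 weights_simps diag W_def V_def algebra_simps)
    show "\<forall>i. i = 3 \<or> i = 1 \<or> 0 \<le> ?w i" "\<forall>i. i = 2 \<or> i = 4 \<or> ?w i \<le> 0"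
      using mult_pos_pos[OF A_pos pos(2)] mult_pos_pos[OF A_pos pos(3)] unfolding forall_4 weights_simps by simp_all
    show "?w 3 \<le> - c\<^sup>2" using prod_ge[OF c_le_A bounds(2)] by (simp add: weights_simps)
  qed (simp_all add: forall_4 weights_simps)
qed

lemma no_turn_34_then_4:
  assumes W: "0 \<le> W"
    and t: "s \<le> t0" "t0 \<le> t1" "t1 \<le> t2" "t2 \<le> t3"
    and cr: "crossing t0 3 4" "crossing t3 2 4"
    and st: "stays 4 t0 t1" "stays 1 t1 t2" "stays 2 t2 t3"
  shows False
proof -
  let ?w = "weights 0 (- (\<beta> 2 4 * \<beta> 4 3)) (\<beta> 4 2 * \<beta> 2 4) (- (\<beta> 4 2 * \<beta> 2 3))"
  show False
  proof (rule no_turn[OF t cr st, of ?w 3])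
    show "\<forall>i. \<bar>?w i\<bar> \<le> 2 * A\<^sup>2"
      using prod_le[of 2 4 4 3] prod_le[of 4 2 2 4] prod_le[of 4 2 2 3] zero_le_power2[of A]
      unfolding forall_4 weights_simps by linarith
    show "\<forall>l\<in>{4, 1, 2}. (\<Sum>i\<in>UNIV. ?w i * \<beta> l i) \<le> 0"
      using W by (simp add: sum_4 weights_simps diag W_def V_def algebra_simps)
    show "\<forall>i. i = 3 \<or> i = 4 \<or> 0 \<le> ?w i" "\<forall>i. i = 2 \<or> i = 4 \<or> ?w i \<le> 0"
      using mult_neg_pos[OF neg(3) pos(3)] mult_neg_pos[OF neg(3) pos(2)] mult_pos_neg[OF pos(3) neg(6)]
      unfolding forall_4 weights_simps by simp_all
    show "?w 3 \<le> - c\<^sup>2" using prod_ge[OF bounds(3,2)] by (simp add: weights_simps)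
  qed (simp_all add: forall_4 weights_simps)
qed

lemma no_turn_31_then_34:
  assumes V: "0 \<le> V" and b: "0 < \<beta> 3 1" "0 < \<beta> 3 4"
    and t: "s \<le> t0" "t0 \<le> t1" "t1 \<le> t2" "t2 \<le> t3"
    and cr: "crossing t0 3 1" "crossing t3 3 4"
    and st: "stays 1 t0 t1" "stays 2 t1 t2" "stays 3 t2 t3"
  shows False
proof -
  let ?w = "weights (- (\<beta> 3 4 * \<beta> 2 3)) 0 (- (\<beta> 3 1 * \<beta> 2 4 - \<beta> 3 4 * \<beta> 2 1)) (\<beta> 3 1 * \<beta> 2 3)"
  show False
  proof (rule no_turn[OF t cr st, of ?w 1])
    show "\<forall>i. \<bar>?w i\<bar> \<le> 2 * A\<^sup>2"
      using prod_le[of 3 4 2 3] prod_le[of 3 1 2 4] prod_le[of 3 4 2 1] prod_le[of 3 1 2 3]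
        zero_le_power2[of A] unfolding forall_4 weights_simps by linarith
    show "\<forall>l\<in>{1, 2, 3}. (\<Sum>i\<in>UNIV. ?w i * \<beta> l i) \<le> 0"
      using V by (simp add: sum_4 weights_simps diag W_def V_def algebra_simps)
    show "\<forall>i. i = 3 \<or> i = 1 \<or> 0 \<le> ?w i" "\<forall>i. i = 3 \<or> i = 4 \<or> ?w i \<le> 0"
      using mult_pos_pos[OF b(1) pos(2)] mult_pos_pos[OF b(2) pos(2)] mult_pos_pos[OF b(1) pos(3)]
        mult_pos_neg[OF b(2) neg(1)] unfolding forall_4 weights_simps by simp_all
    show "?w 1 \<le> - c\<^sup>2" using prod_ge[of "\<beta> 3 4" "\<beta> 2 3"] lower[of 3 4] b bounds(1) by (simp add: weights_simps)
  qed (simp_all add: forall_4 weights_simps)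
qed

lemma no_turn_4_then_31:
  assumes V: "V \<le> 0" and b: "0 < \<beta> 3 1" "0 < \<beta> 3 4"
    and t: "s \<le> t0" "t0 \<le> t1" "t1 \<le> t2" "t2 \<le> t3"
    and cr: "crossing t0 4 1" "crossing t3 3 1"
    and st: "stays 1 t0 t1" "stays 2 t1 t2" "stays 3 t2 t3"
  shows False
proof -
  let ?w = "weights (\<beta> 3 4 * \<beta> 2 3) 0 (\<beta> 3 1 * \<beta> 2 4 - \<beta> 3 4 * \<beta> 2 1) (- (\<beta> 3 1 * \<beta> 2 3))"
  show False
  proof (rule no_turn[OF t cr st, of ?w 4])
    show "\<forall>i. \<bar>?w i\<bar> \<le> 2 * A\<^sup>2"
      using prod_le[of 3 4 2 3] prod_le[of 3 1 2 4] prod_le[of 3 4 2 1] prod_le[of 3 1 2 3]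
        zero_le_power2[of A] unfolding forall_4 weights_simps by linarith
    show "\<forall>l\<in>{1, 2, 3}. (\<Sum>i\<in>UNIV. ?w i * \<beta> l i) \<le> 0"
      using V by (simp add: sum_4 weights_simps diag W_def V_def algebra_simps)
    show "\<forall>i. i = 4 \<or> i = 1 \<or> 0 \<le> ?w i" "\<forall>i. i = 3 \<or> i = 1 \<or> ?w i \<le> 0"
      using mult_pos_pos[OF b(1) pos(2)] mult_pos_pos[OF b(2) pos(2)] mult_pos_pos[OF b(1) pos(3)]
        mult_pos_neg[OF b(2) neg(1)] unfolding forall_4 weights_simps by simp_all
    show "?w 4 \<le> - c\<^sup>2" using prod_ge[of "\<beta> 3 1" "\<beta> 2 3"] lower[of 3 1] b bounds(1) by (simp add: weights_simps)
  qed (simp_all add: forall_4 weights_simps)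
qed

definition never_after :: "(4 \<times> 4) set \<Rightarrow> (4 \<times> 4) set \<Rightarrow> bool" where
  "never_after J J' \<longleftrightarrow> (\<forall>a b j k m n. s \<le> a \<longrightarrow> a \<le> b \<longrightarrow> (j, k) \<in> J \<longrightarrow> (m, n) \<in> J' \<longrightarrow>
     crossing a j k \<longrightarrow> \<not> crossing b m n)"

lemma last_crossing_single:
  assumes "s \<le> a" "a \<le> b" "crossing a j k"
  obtains t where "s \<le> t" "t \<le> b" "crossing t j k" "\<And>u. t < u \<Longrightarrow> u \<le> b \<Longrightarrow> \<not> crossing u j k"
proof (rule last_crossing[OF assms, of "{(j, k)}"])
  fix t m n
  assume t: "a \<le> t" "t \<le> b" "crossing t m n" "(m, n) \<in> {(j, k)}"
    and last: "\<And>u m n. t < u \<Longrightarrow> u \<le> b \<Longrightarrow> (m, n) \<in> {(j, k)} \<Longrightarrow> \<not> crossing u m n"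
  have "s \<le> t" using t(1) assms(1) by simp
  moreover have "crossing t j k" using t(3,4) by simp
  moreover have "\<not> crossing u j k" if "t < u" "u \<le> b" for u using last[OF that] by simp
  ultimately show thesis using that[of t] t(2) by blast
qed simp

lemma after_crossing:
  assumes "s \<le> a" "a \<le> b" "crossing a j k" "crossing b m n" "j \<noteq> m \<or> k \<noteq> n"
  shows "k = 1 \<Longrightarrow> \<exists>t. a < t \<and> t \<le> b \<and> s \<le> t \<and> stays 1 a t \<and> crossing t 1 2"
    and "k = 2 \<Longrightarrow> \<exists>t. a < t \<and> t \<le> b \<and> s \<le> t \<and> stays 2 a t \<and> (crossing t 2 3 \<or> crossing t 2 4)"
    and "k = 3 \<Longrightarrow> \<exists>t. a < t \<and> t \<le> b \<and> s \<le> t \<and> stays 3 a t \<and> (crossing t 3 1 \<or> crossing t 3 4)"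
    and "k = 4 \<Longrightarrow> \<exists>t. a < t \<and> t \<le> b \<and> s \<le> t \<and> stays 4 a t \<and> crossing t 4 1"
proof -
  have "(j, k) \<noteq> (m, n)" using assms(5) by simp
  then obtain t l where t: "a < t" "t \<le> b" "crossing t k l" "stays k a t"
    by (rule next_crossing[OF assms(1-4)])
  have "s \<le> t" using t(1) assms(1) by simp
  show "k = 1 \<Longrightarrow> \<exists>t. a < t \<and> t \<le> b \<and> s \<le> t \<and> stays 1 a t \<and> crossing t 1 2"
    using successors(1)[of t l] t \<open>s \<le> t\<close> by (intro exI[of _ t]) simp
  show "k = 2 \<Longrightarrow> \<exists>t. a < t \<and> t \<le> b \<and> s \<le> t \<and> stays 2 a t \<and> (crossing t 2 3 \<or> crossing t 2 4)"
    using successors(2)[of t l] t \<open>s \<le> t\<close> by (intro exI[of _ t]) auto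
  show "k = 3 \<Longrightarrow> \<exists>t. a < t \<and> t \<le> b \<and> s \<le> t \<and> stays 3 a t \<and> (crossing t 3 1 \<or> crossing t 3 4)"
    using successors(3)[of t l] t \<open>s \<le> t\<close> by (intro exI[of _ t]) auto
  show "k = 4 \<Longrightarrow> \<exists>t. a < t \<and> t \<le> b \<and> s \<le> t \<and> stays 4 a t \<and> crossing t 4 1"
    using successors(4)[of t l] t \<open>s \<le> t\<close> by (intro exI[of _ t]) simp
qed

lemma next_choice_at_2:
  assumes "s \<le> a" "a \<le> b" "crossing a j 1" "crossing b m n" "j \<noteq> m \<or> 1 \<noteq> n" "1 \<noteq> m"
  shows "\<exists>t t'. a < t \<and> t < t' \<and> t' \<le> b \<and> s \<le> t' \<and> stays 1 a t \<and> stays 2 t t' \<and>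
    (crossing t' 2 3 \<or> crossing t' 2 4)"
proof -
  obtain t where t: "a < t" "t \<le> b" "s \<le> t" "stays 1 a t" "crossing t 1 2"
    using after_crossing(1)[OF assms(1-5) refl] by blast
  obtain t' where "t < t'" "t' \<le> b" "s \<le> t'" "stays 2 t t'" "crossing t' 2 3 \<or> crossing t' 2 4"
    using after_crossing(2)[OF t(3,2,5) assms(4) disjI1[OF assms(6)] refl] by blast
  then show ?thesis using t by blast
qed

text \<open>The choice between \<open>\<xi>\<close>3 and \<open>\<xi>\<close>4 at \<open>\<xi>\<close>2 is repeated forever once it has been made in the direction
  favoured by the sign of \<open>W\<close>. In the first case this is \<open>\<xi>\<close>4: the turn from 2 through 4 and 1 back to 2
  cannot be continued to 3. In the second case it is \<open>\<xi>\<close>3, and both ways back from \<open>\<xi>\<close>3 to \<open>\<xi>\<close>2 have to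
  be considered.\<close>

lemma choice_at_2:
  "never_after {(2, 4)} {(2, 3)} \<or> never_after {(2, 3)} {(2, 4)}"
proof (cases "W \<le> 0")
  case True
  have "False" if ab: "s \<le> a" "a \<le> b" and cr: "crossing a 2 4" "crossing b 2 3" for a b
  proof -
    obtain t0 where t0: "s \<le> t0" "t0 \<le> b" "crossing t0 2 4"
      and last: "\<And>u. t0 < u \<Longrightarrow> u \<le> b \<Longrightarrow> \<not> crossing u 2 4"
      using last_crossing_single[OF ab cr(1)] by blast
    have ne: "(4::4) \<noteq> 3" "(4::4) \<noteq> 2" "(1::4) \<noteq> 2" by simp_all
    obtain t1 where t1: "t0 < t1" "t1 \<le> b" "s \<le> t1" "stays 4 t0 t1" "crossing t1 4 1"
      using after_crossing(4)[OF t0 cr(2) disjI2[OF ne(1)] refl] by blast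
    obtain t2 t3 where t2: "t1 < t2" "t2 < t3" "t3 \<le> b" "s \<le> t3" "stays 1 t1 t2" "stays 2 t2 t3"
      "crossing t3 2 3 \<or> crossing t3 2 4"
      using next_choice_at_2[OF t1(3,2,5) cr(2) disjI1[OF ne(2)] ne(3)] by blast
    have "\<not> crossing t3 2 4" using last[of t3] t1(1) t2(1-3) by linarith
    then have "crossing t3 2 3" using t2(7) by blast
    then show False
      using no_turn_4_then_3[OF True t0(1) _ _ _ t0(3) _ t1(4) t2(5,6)] t1(1) t2(1,2) by simp
  qed
  then show ?thesis unfolding never_after_def by blast
next
  case False
  have D: "0 \<le> \<beta> 2 4 * \<beta> 1 3 - \<beta> 2 3 * \<beta> 1 4"
  proof (rule ccontr)
    assume "\<not> ?thesis"
    then have "0 \<le> (- \<beta> 4 2) * (- (\<beta> 2 4 * \<beta> 1 3 - \<beta> 2 3 * \<beta> 1 4))"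
      using neg by (intro mult_nonneg_nonneg) auto
    moreover have "0 \<le> \<beta> 2 4 * (- \<beta> 4 3) * \<beta> 1 2"
      using pos neg by (intro mult_nonneg_nonneg) auto
    ultimately show False using False unfolding W_def by (simp add: algebra_simps)
  qed
  have "False" if ab: "s \<le> a" "a \<le> b" and cr: "crossing a 2 3" "crossing b 2 4" for a b
  proof -
    obtain t0 where t0: "s \<le> t0" "t0 \<le> b" "crossing t0 2 3"
      and last: "\<And>u. t0 < u \<Longrightarrow> u \<le> b \<Longrightarrow> \<not> crossing u 2 3"
      using last_crossing_single[OF ab cr(1)] by blast
    have ne: "(3::4) \<noteq> 2" "(3::4) \<noteq> 4" "(1::4) \<noteq> 2" "(4::4) \<noteq> 2" by simp_all
    obtain t1 where t1: "t0 < t1" "t1 \<le> b" "s \<le> t1" "stays 3 t0 t1" "crossing t1 3 1 \<or> crossing t1 3 4"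
      using after_crossing(3)[OF t0 cr(2) disjI2[OF ne(2)] refl] by blast
    show False
    proof (cases "crossing t1 3 1")
      case c1: True
      obtain t2 t3 where t2: "t1 < t2" "t2 < t3" "t3 \<le> b" "s \<le> t3" "stays 1 t1 t2" "stays 2 t2 t3"
        "crossing t3 2 3 \<or> crossing t3 2 4"
        using next_choice_at_2[OF t1(3,2) c1 cr(2) disjI1[OF ne(1)] ne(3)] by blast
      have "\<not> crossing t3 2 3" using last[of t3] t1(1) t2(1-3) by linarith
      then have "crossing t3 2 4" using t2(7) by blast
      then show False
        using no_turn_31_then_4[OF D t1(3) _ _ c1 _ t2(5,6)] t2(1,2) by simp
    next
      case False
      then have c1: "crossing t1 3 4" using t1(5) by blast
      obtain t2 where t2: "t1 < t2" "t2 \<le> b" "s \<le> t2" "stays 4 t1 t2" "crossing t2 4 1"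
        using after_crossing(4)[OF t1(3,2) c1 cr(2) disjI1[OF ne(1)] refl] by blast
      obtain t3 t4 where t3: "t2 < t3" "t3 < t4" "t4 \<le> b" "s \<le> t4" "stays 1 t2 t3" "stays 2 t3 t4"
        "crossing t4 2 3 \<or> crossing t4 2 4"
        using next_choice_at_2[OF t2(3,2,5) cr(2) disjI1[OF ne(4)] ne(3)] by blast
      have "\<not> crossing t4 2 3" using last[of t4] t1(1) t2(1) t3(1-3) by linarith
      then have "crossing t4 2 4" using t3(7) by blast
      then show False
        using no_turn_34_then_4[OF _ t1(3) _ _ _ c1 _ t2(4) t3(5,6)] t2(1) t3(1,2) \<open>\<not> W \<le> 0\<close> by simp
    qed
  qed
  then show ?thesis unfolding never_after_def by blast
qed

text \<open>The same for the choice between closing the cycle at \<open>\<xi>\<close>3 and passing through \<open>\<xi>\<close>4. The crossing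
  \<open>(2, 4)\<close> counts as a choice against the connection from \<open>\<xi>\<close>3 to \<open>\<xi>\<close>1, because a trajectory may take it
  on the way from one passage of \<open>\<xi>\<close>3 to the next.\<close>

lemma choice_at_3:
  assumes b: "0 < \<beta> 3 1" "0 < \<beta> 3 4"
  shows "never_after {(3, 1)} {(3, 4), (2, 4)} \<or> never_after {(3, 4), (2, 4)} {(3, 1)}"
proof (cases "0 \<le> V")
  case True
  have D: "0 \<le> \<beta> 2 4 * \<beta> 1 3 - \<beta> 2 3 * \<beta> 1 4"
  proof -
    have "0 \<le> \<beta> 3 4 * (- \<beta> 2 1) * (- \<beta> 1 3)" using b neg by (intro mult_nonneg_nonneg) auto
    then have "0 \<le> \<beta> 3 1 * (\<beta> 2 4 * \<beta> 1 3 - \<beta> 2 3 * \<beta> 1 4)"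
      using True by (simp add: V_def algebra_simps)
    then show ?thesis using b by (simp add: zero_le_mult_iff)
  qed
  have "False" if ab: "s \<le> a" "a \<le> b" and cr: "crossing a 3 1" "crossing b m 4" and m: "m = 3 \<or> m = 2"
    for a b m
  proof -
    obtain t0 where t0: "s \<le> t0" "t0 \<le> b" "crossing t0 3 1"
      and last: "\<And>u. t0 < u \<Longrightarrow> u \<le> b \<Longrightarrow> \<not> crossing u 3 1"
      using last_crossing_single[OF ab cr(1)] by blast
    have ne: "(1::4) \<noteq> 4" "1 \<noteq> m" "(3::4) \<noteq> 4" using m by auto
    obtain t1 t2 where t2: "t0 < t1" "t1 < t2" "t2 \<le> b" "s \<le> t2" "stays 1 t0 t1" "stays 2 t1 t2"
      "crossing t2 2 3 \<or> crossing t2 2 4"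
      using next_choice_at_2[OF t0 cr(2) disjI2[OF ne(1)] ne(2)] by blast
    show False
    proof (cases "crossing t2 2 3")
      case False
      then have "crossing t2 2 4" using t2(7) by blast
      then show False
        using no_turn_31_then_4[OF D t0(1) _ _ t0(3) _ t2(5,6)] t2(1,2) by simp
    next
      case c2: True
      obtain t3 where t3: "t2 < t3" "t3 \<le> b" "s \<le> t3" "stays 3 t2 t3" "crossing t3 3 1 \<or> crossing t3 3 4"
        using after_crossing(3)[OF t2(4,3) c2 cr(2) disjI2[OF ne(3)] refl] by blast
      have "\<not> crossing t3 3 1" using last[of t3] t2(1,2) t3(1,2) by linarith
      then have "crossing t3 3 4" using t3(5) by blast
      then show False
        using no_turn_31_then_34[OF True b t0(1) _ _ _ t0(3) _ t2(5,6) t3(4)] t2(1,2) t3(1) by simp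
    qed
  qed
  then show ?thesis unfolding never_after_def by blast
next
  case False
  have "False" if ab: "s \<le> a" "a \<le> b" and cr: "crossing a m 4" "crossing b 3 1" and m: "m = 3 \<or> m = 2"
    for a b m
  proof -
    have J: "(m, 4) \<in> {(3, 4), (2, 4 :: 4)}" using m by auto
    obtain t0 m0 n0 where t0': "a \<le> t0" "t0 \<le> b" "crossing t0 m0 n0" "(m0, n0) \<in> {(3, 4), (2, 4)}"
      and last: "\<And>u m n. t0 < u \<Longrightarrow> u \<le> b \<Longrightarrow> (m, n) \<in> {(3, 4), (2, 4)} \<Longrightarrow> \<not> crossing u m n"
      using last_crossing[OF ab cr(1) J] by blast
    have t0: "s \<le> t0" "t0 \<le> b" "crossing t0 m0 4" using t0' ab by auto
    have last': "\<not> crossing u 2 4" "\<not> crossing u 3 4" if "t0 < u" "u \<le> b" for u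
      using last[OF that] by blast+
    have ne: "(4::4) \<noteq> 1" "(4::4) \<noteq> 3" "(1::4) \<noteq> 3" "(2::4) \<noteq> 3" "(3::4) \<noteq> 1" by simp_all
    obtain t1 where t1: "t0 < t1" "t1 \<le> b" "s \<le> t1" "stays 4 t0 t1" "crossing t1 4 1"
      using after_crossing(4)[OF t0 cr(2) disjI2[OF ne(1)] refl] by blast
    obtain t2 t3 where t3: "t1 < t2" "t2 < t3" "t3 \<le> b" "s \<le> t3" "stays 1 t1 t2" "stays 2 t2 t3"
      "crossing t3 2 3 \<or> crossing t3 2 4"
      using next_choice_at_2[OF t1(3,2,5) cr(2) disjI1[OF ne(2)] ne(3)] by blast
    have "\<not> crossing t3 2 4" using last'(1)[of t3] t1(1) t3(1-3) by linarith
    then have c3: "crossing t3 2 3" using t3(7) by blast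
    obtain t4 where t4: "t3 < t4" "t4 \<le> b" "s \<le> t4" "stays 3 t3 t4" "crossing t4 3 1 \<or> crossing t4 3 4"
      using after_crossing(3)[OF t3(4,3) c3 cr(2) disjI2[OF ne(5)] refl] by blast
    have "\<not> crossing t4 3 4" using last'(2)[of t4] t1(1) t3(1,2) t4(1,2) by linarith
    then have "crossing t4 3 1" using t4(5) by blast
    then show False
      using no_turn_4_then_31[OF _ b t1(3) _ _ _ t1(5) _ t3(5,6) t4(4)] t3(1,2) t4(1) False by simp
  qed
  then show ?thesis unfolding never_after_def by blast
qed

end

section \<open>Shares of the squared norm satisfy a replicator equation\<close>

definition offdiag :: "(4 \<Rightarrow> 4 \<Rightarrow> real) \<Rightarrow> 4 \<Rightarrow> 4 \<Rightarrow> real" where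
  "offdiag \<alpha> k j = (if k = j then 0 else \<alpha> k j)"

definition share :: "real^4 \<Rightarrow> 4 \<Rightarrow> real" where
  "share x i = (x $ i)\<^sup>2 / (norm x)\<^sup>2"

lemma norm_sq_sum: "(norm (x :: real^4))\<^sup>2 = (\<Sum>i\<in>UNIV. (x $ i)\<^sup>2)"
  unfolding power2_norm_eq_inner by (simp add: inner_vec_def power2_eq_square)

lemma share_mult_norm: "(norm x)\<^sup>2 * share x i = (x $ i)\<^sup>2"
  by (cases "x = 0") (auto simp: share_def)

lemma share_nonneg: "0 \<le> share x i"
  by (simp add: share_def)

lemma share_sum: "x \<noteq> 0 \<Longrightarrow> sum (share x) UNIV = 1"
  by (simp add: share_def sum_divide_distrib[symmetric] norm_sq_sum[symmetric])

lemma vf_nth: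
  "vf \<alpha> x $ j = x $ j * (1 - (norm x)\<^sup>2 + (norm x)\<^sup>2 * fitness (offdiag \<alpha>) (share x) j)"
proof -
  have "(norm x)\<^sup>2 * fitness (offdiag \<alpha>) (share x) j = (\<Sum>l\<in>UNIV. offdiag \<alpha> l j * ((norm x)\<^sup>2 * share x l))"
    by (simp add: fitness_def sum_distrib_left mult_ac)
  also have "\<dots> = (\<Sum>l\<in>UNIV - {j}. \<alpha> l j * (x $ l)\<^sup>2)"
    by (simp add: sum.remove[of UNIV j] share_mult_norm offdiag_def)
  finally show ?thesis by (simp add: vf_def)
qed

lemma norm_sq_mean:
  "(\<Sum>i\<in>UNIV. (x $ i)\<^sup>2 * fitness \<beta> (share x) i) = (norm x)\<^sup>2 * mean_fitness \<beta> (share x)"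
  unfolding mean_fitness_def sum_distrib_left share_mult_norm[symmetric] by (simp add: mult_ac)

context
  fixes \<alpha> :: "4 \<Rightarrow> 4 \<Rightarrow> real" and x :: "real \<Rightarrow> real^4" and t :: real and S :: "real set"
  assumes sol: "(x has_vector_derivative vf \<alpha> (x t)) (at t within S)"
begin

lemma nth_deriv: "((\<lambda>t. x t $ i) has_real_derivative vf \<alpha> (x t) $ i) (at t within S)"
  unfolding has_real_derivative_iff_has_vector_derivative
  by (rule bounded_linear.has_vector_derivative[OF bounded_linear_vec_nth sol])

lemma sq_deriv: "((\<lambda>t. (x t $ i)\<^sup>2) has_real_derivative
   2 * (x t $ i)\<^sup>2 * (1 - (norm (x t))\<^sup>2 + (norm (x t))\<^sup>2 * fitness (offdiag \<alpha>) (share (x t)) i))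
   (at t within S)"
proof -
  have "((\<lambda>t. (x t $ i)\<^sup>2) has_real_derivative 2 * x t $ i * (vf \<alpha> (x t) $ i)) (at t within S)"
    by (auto intro!: derivative_eq_intros nth_deriv)
  then show ?thesis by (simp add: vf_nth power2_eq_square mult_ac)
qed

lemma norm_sq_deriv: "((\<lambda>t. (norm (x t))\<^sup>2) has_real_derivative
   2 * (norm (x t))\<^sup>2 * (1 - (norm (x t))\<^sup>2 + (norm (x t))\<^sup>2 * mean_fitness (offdiag \<alpha>) (share (x t))))
   (at t within S)"
proof -
  let ?R = "(norm (x t))\<^sup>2"
  have "(\<Sum>i\<in>UNIV. 2 * (x t $ i)\<^sup>2 * (1 - ?R + ?R * fitness (offdiag \<alpha>) (share (x t)) i))
     = (\<Sum>i\<in>UNIV. 2 * (1 - ?R) * (x t $ i)\<^sup>2 + 2 * ?R * ((x t $ i)\<^sup>2 * fitness (offdiag \<alpha>) (share (x t)) i))"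
    by (rule sum.cong) (auto simp: algebra_simps)
  also have "\<dots> = 2 * (1 - ?R) * ?R + 2 * ?R * (?R * mean_fitness (offdiag \<alpha>) (share (x t)))"
    by (simp only: sum.distrib sum_distrib_left[symmetric] norm_sq_mean norm_sq_sum[symmetric])
  also have "\<dots> = 2 * ?R * (1 - ?R + ?R * mean_fitness (offdiag \<alpha>) (share (x t)))"
    by (simp add: algebra_simps)
  finally have eq: "(\<Sum>i\<in>UNIV. 2 * (x t $ i)\<^sup>2 * (1 - ?R + ?R * fitness (offdiag \<alpha>) (share (x t)) i))
     = 2 * ?R * (1 - ?R + ?R * mean_fitness (offdiag \<alpha>) (share (x t)))" .
  have "((\<lambda>t. \<Sum>i\<in>UNIV. (x t $ i)\<^sup>2) has_real_derivative
     (\<Sum>i\<in>UNIV. 2 * (x t $ i)\<^sup>2 * (1 - ?R + ?R * fitness (offdiag \<alpha>) (share (x t)) i))) (at t within S)"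
    by (intro DERIV_sum sq_deriv)
  then show ?thesis unfolding eq norm_sq_sum[symmetric] .
qed

lemma share_deriv:
  assumes "x t \<noteq> 0"
  shows "((\<lambda>t. share (x t) i) has_real_derivative 2 * (norm (x t))\<^sup>2 *
    (share (x t) i * (fitness (offdiag \<alpha>) (share (x t)) i - mean_fitness (offdiag \<alpha>) (share (x t)))))
    (at t within S)"
proof -
  let ?R = "(norm (x t))\<^sup>2" and ?f = "fitness (offdiag \<alpha>) (share (x t)) i"
  let ?m = "mean_fitness (offdiag \<alpha>) (share (x t))"
  have R: "?R \<noteq> 0" using assms by simp
  have "((\<lambda>t. (x t $ i)\<^sup>2 / (norm (x t))\<^sup>2) has_real_derivative
    ((2 * (x t $ i)\<^sup>2 * (1 - ?R + ?R * ?f)) * ?R - (x t $ i)\<^sup>2 * (2 * ?R * (1 - ?R + ?R * ?m))) / (?R * ?R))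
    (at t within S)"
    by (rule DERIV_divide[OF sq_deriv norm_sq_deriv R])
  moreover have "((2 * (x t $ i)\<^sup>2 * (1 - ?R + ?R * ?f)) * ?R - (x t $ i)\<^sup>2 * (2 * ?R * (1 - ?R + ?R * ?m))) / (?R * ?R)
    = 2 * ?R * (share (x t) i * (?f - ?m))"
    using R by (simp add: share_mult_norm[symmetric] field_simps del: share_mult_norm)
  ultimately show ?thesis by (simp add: share_def)
qed

end

lemma tendsto_share_axis:
  assumes "(\<gamma> \<longlongrightarrow> \<xi> j) F"
  shows "((\<lambda>t. share (\<gamma> t) i) \<longlongrightarrow> (if i = j then 1 else 0)) F"
    and "((\<lambda>t. (norm (\<gamma> t))\<^sup>2) \<longlongrightarrow> 1) F"
    and "((\<lambda>t. \<gamma> t $ i) \<longlongrightarrow> (if i = j then 1 else 0)) F"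
proof -
  have xi: "norm (\<xi> j) = 1" by (simp add: \<xi>_def)
  have xi': "\<xi> j $ i = (if i = j then 1 else 0)" by (simp add: \<xi>_def axis_def)
  show n: "((\<lambda>t. (norm (\<gamma> t))\<^sup>2) \<longlongrightarrow> 1) F"
    using tendsto_power[OF tendsto_norm[OF assms], of 2] xi by simp
  show c: "((\<lambda>t. \<gamma> t $ i) \<longlongrightarrow> (if i = j then 1 else 0)) F"
    using tendsto_vec_nth[OF assms, of i] xi' by simp
  have "((\<lambda>t. (\<gamma> t $ i)\<^sup>2 / (norm (\<gamma> t))\<^sup>2) \<longlongrightarrow> (if i = j then 1 else 0)\<^sup>2 / 1) F"
    by (intro tendsto_divide tendsto_power c n) simp
  then show "((\<lambda>t. share (\<gamma> t) i) \<longlongrightarrow> (if i = j then 1 else 0)) F"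
    by (cases "i = j") (simp_all add: share_def)
qed

section \<open>A priori bounds for the network\<close>

text \<open>All that has to be known about the points of a network in order to control its neighbourhoods.\<close>

definition edge_point :: "(4 \<times> 4) set \<Rightarrow> real \<Rightarrow> real \<Rightarrow> real^4 \<Rightarrow> bool" where
  "edge_point E m M y \<longleftrightarrow> m \<le> norm y \<and> norm y \<le> M \<and> (\<forall>i. 0 \<le> y $ i) \<and>
     (\<exists>(j, k)\<in>E. \<forall>i. i \<noteq> j \<and> i \<noteq> k \<longrightarrow> y $ i = 0)"

lemma entire_solution_zero_iff:
  assumes sol: "\<And>t. (\<gamma> has_vector_derivative vf \<alpha> (\<gamma> t)) (at t)" and "a \<le> b"
  shows "\<gamma> a $ i = 0 \<longleftrightarrow> \<gamma> b $ i = 0"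
proof (rule linear_ode_zero_iff[OF assms(2)])
  let ?g = "\<lambda>t. 1 - (norm (\<gamma> t))\<^sup>2 + (\<Sum>k\<in>UNIV - {i}. \<alpha> k i * (\<gamma> t $ k)\<^sup>2)"
  show "((\<lambda>t. \<gamma> t $ i) has_real_derivative ?g t * \<gamma> t $ i) (at t within {a..b})" for t
    using nth_deriv[OF has_vector_derivative_at_within[OF sol[of t], of "{a..b}"], where i = i]
    by (simp add: vf_def mult.commute)
  have "continuous_on {a..b} \<gamma>"
    by (meson has_vector_derivative_continuous sol continuous_at_imp_continuous_on)
  then show "continuous_on {a..b} ?g" by (intro continuous_intros)
qed

context replicator_signs
begin

context
  fixes \<alpha> :: "4 \<Rightarrow> 4 \<Rightarrow> real" and \<gamma> :: "real \<Rightarrow> real^4" and j k :: 4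
  assumes beta: "\<beta> = offdiag \<alpha>"
    and e: "(j, k) \<in> E"
    and sol: "\<And>t. (\<gamma> has_vector_derivative vf \<alpha> (\<gamma> t)) (at t)"
    and plane: "\<And>t i. i \<noteq> j \<Longrightarrow> i \<noteq> k \<Longrightarrow> \<gamma> t $ i = 0"
    and bot: "(\<gamma> \<longlongrightarrow> \<xi> j) at_bot" and top: "(\<gamma> \<longlongrightarrow> \<xi> k) at_top"
begin

text \<open>A coordinate that changed its sign would vanish at some time, hence at all times, against its limit
  1 at one of the two ends.\<close>

lemma connection_coord_nonneg: "0 \<le> \<gamma> t $ i"
proof -
  have jk: "j \<noteq> k" using edge_lower[OF e] by simp
  have cont: "continuous_on S (\<lambda>t. \<gamma> t $ i)" for S i
    using nth_deriv[OF has_vector_derivative_at_within[OF sol]]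
    by (meson DERIV_continuous continuous_on_eq_continuous_within)
  have J: "0 \<le> \<gamma> t $ j"
  proof (rule ccontr)
    assume neg: "\<not> ?thesis"
    have "eventually (\<lambda>u. 0 < \<gamma> u $ j) at_bot"
      using order_tendstoD(1)[OF tendsto_share_axis(3)[OF bot, of j], of 0] by simp
    then obtain u where u: "0 < \<gamma> u $ j" "u \<le> t"
      by (metis (mono_tags, lifting) eventually_at_bot_linorder linear order_refl)
    then obtain v where "u \<le> v" "v \<le> t" "\<gamma> v $ j = 0"
      using IVT2'[of "\<lambda>t. \<gamma> t $ j" t 0 u] neg cont by auto
    then show False using entire_solution_zero_iff[OF sol, of v t j] neg by simp
  qed
  have K: "0 \<le> \<gamma> t $ k"
  proof (rule ccontr)
    assume neg: "\<not> ?thesis"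
    have "eventually (\<lambda>u. 0 < \<gamma> u $ k) at_top"
      using order_tendstoD(1)[OF tendsto_share_axis(3)[OF top, of k], of 0] by simp
    then obtain u where u: "0 < \<gamma> u $ k" "t \<le> u"
      by (metis (mono_tags, lifting) eventually_at_top_linorder linear order_refl)
    then obtain v where "t \<le> v" "v \<le> u" "\<gamma> v $ k = 0"
      using IVT'[of "\<lambda>t. \<gamma> t $ k" t 0 u] neg cont by auto
    then show False using entire_solution_zero_iff[OF sol, of t v k] neg by simp
  qed
  show ?thesis using J K plane[of i t] by (cases "i = j"; cases "i = k") auto
qed

text \<open>Small norms grow. For large norms the growth of the mean is compensated by the share of
  \<open>k\<close>, which increases along the connection.\<close>

lemma connection_norm_bounds:
  "1 / (2 + 4 * A) \<le> (norm (\<gamma> t))\<^sup>2" "(norm (\<gamma> t))\<^sup>2 \<le> exp (1 + 4 * A / c)"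
proof -
  let ?m = "1 / (2 + 4 * A)"
  let ?R = "\<lambda>t. (norm (\<gamma> t))\<^sup>2"
  let ?mu = "\<lambda>t. mean_fitness \<beta> (share (\<gamma> t))"
  have jk: "j \<noteq> k" using edge_lower[OF e] by simp
  have mpos: "0 < ?m" "?m < 1" using A_pos by auto
  have dR: "(?R has_real_derivative 2 * ?R u * (1 - ?R u + ?R u * ?mu u)) (at u within S)" for u S
    unfolding beta by (rule norm_sq_deriv[OF has_vector_derivative_at_within[OF sol]])
  have low: "?m \<le> ?R t" for t
  proof -
    have "eventually (\<lambda>u. ?m < ?R u) at_bot"
      by (rule order_tendstoD(1)[OF tendsto_share_axis(2)[OF bot] mpos(2)])
    then obtain a where a: "?m < ?R a" "a \<le> t"
      by (metis (mono_tags, lifting) eventually_at_bot_linorder linear order_refl)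
    show ?thesis
    proof (rule barrier[OF a(2) dR])
      fix u assume eq: "?R u = ?m"
      then have "\<gamma> u \<noteq> 0" using mpos by auto
      from mean_fitness_bound[OF share_nonneg share_sum[OF this], of k]
      have "\<bar>?mu u\<bar> \<le> 2 * A * (1 - share (\<gamma> u) k)" .
      also have "\<dots> \<le> 2 * A * 1" using A_pos share_nonneg by (intro mult_left_mono) auto
      finally have "?m * (- (2 * A)) \<le> ?m * ?mu u" using mpos by (intro mult_left_mono) auto
      moreover have "1 - ?m + ?m * (- (2 * A)) = 1 - ?m * (1 + 2 * A)"
        by (simp only: distrib_left mult_1_right mult_minus_right)
      moreover have "?m * (1 + 2 * A) = 1 / 2"
      proof -
        have "2 + 4 * A \<noteq> 0" using A_pos by simp
        then show ?thesis by (simp add: field_simps)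
      qed
      ultimately have "0 < 1 - ?m + ?m * ?mu u" by linarith
      then show "0 < 2 * ?R u * (1 - ?R u + ?R u * ?mu u)" unfolding eq using mpos by simp
    qed (use a in simp)
  qed
  then show "?m \<le> ?R t" .
  have Rpos: "0 < ?R u" for u using low[of u] mpos by linarith
  then have nz: "\<gamma> u \<noteq> 0" for u by (metis norm_zero power_zero_numeral less_irrefl)
  define L where "L = 4 * A / c"
  define f where "f u = L * share (\<gamma> u) k - ln (?R u)" for u
  define g where "g u = fitness \<beta> (share (\<gamma> u)) k - ?mu u" for u
  have df: "(f has_real_derivative L * (2 * ?R u * (share (\<gamma> u) k * g u))
      - 2 * (1 - ?R u + ?R u * ?mu u)) (at u within S)" for u S
  proof -
    have "((\<lambda>u. ln (?R u)) has_real_derivative 1 / ?R u * (2 * ?R u * (1 - ?R u + ?R u * ?mu u)))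
        (at u within S)"
      by (rule DERIV_chain2[OF DERIV_ln_divide[OF Rpos] dR])
    then have ln: "((\<lambda>u. ln (?R u)) has_real_derivative 2 * (1 - ?R u + ?R u * ?mu u)) (at u within S)"
      using Rpos[of u] by simp
    show ?thesis unfolding f_def g_def
      by (intro DERIV_diff ln DERIV_cmult)
        (use share_deriv[OF has_vector_derivative_at_within[OF sol] nz] in \<open>simp add: beta\<close>)
  qed
  have "eventually (\<lambda>u. - 1 < f u) at_bot"
  proof (rule order_tendstoD(1))
    have "(f \<longlongrightarrow> L * 0 - ln 1) at_bot"
      unfolding f_def using tendsto_share_axis(1)[OF bot, of k] tendsto_share_axis(2)[OF bot] jk
      by (intro tendsto_diff tendsto_mult_left tendsto_ln) auto
    then show "(f \<longlongrightarrow> 0) at_bot" by simp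
  qed simp
  then obtain a where a: "- 1 < f a" "a \<le> t"
    by (metis (mono_tags, lifting) eventually_at_bot_linorder linear order_refl)
  have "- 1 \<le> f t"
  proof (rule barrier[OF a(2) df])
    fix u assume eq: "f u = - 1"
    let ?pj = "share (\<gamma> u) j" and ?pk = "share (\<gamma> u) k"
    note nn = share_nonneg[of "\<gamma> u"] and s1 = share_sum[OF nz[of u]]
    have zero: "share (\<gamma> u) i \<le> 0" if "i \<noteq> j" "i \<noteq> k" for i using plane[OF that] by (simp add: share_def)
    have two: "?pj + ?pk = 1"
      using sum_split2[OF jk, of "share (\<gamma> u)"] s1 plane by (simp add: share_def)
    have grow: "g u = ?pj * (\<beta> j k * ?pj - \<beta> k j * ?pk)"
      using growth_near_edge(1)[OF nn s1 jk zero] by (simp add: g_def)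
    have "c * ?pj \<le> \<beta> j k * ?pj" "\<beta> k j * ?pk \<le> (- c) * ?pk"
      using edge_lower[OF e] mult_right_mono[OF _ nn] by blast+
    then have "c * (?pj + ?pk) \<le> \<beta> j k * ?pj - \<beta> k j * ?pk" by (simp add: algebra_simps)
    then have "?pj * c \<le> g u" unfolding grow using two nn by (intro mult_left_mono) auto
    then have "?pk * (?pj * c) \<le> ?pk * g u" using nn by (intro mult_left_mono)
    then have "L * (?pk * (?pj * c)) \<le> L * (?pk * g u)" using A_pos c_pos
      by (intro mult_left_mono[of "?pk * (?pj * c)" "?pk * g u" L]) (auto simp: L_def)
    moreover have "L * (?pk * (?pj * c)) = 4 * A * (?pj * ?pk)" using c_pos by (simp add: L_def)
    ultimately have 1: "4 * A * (?pj * ?pk) \<le> L * (?pk * g u)" by simp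
    have "?mu u \<le> 4 * A * (?pj * ?pk)"
    proof -
      have "?mu u \<le> 2 * A * ?pj" "?mu u \<le> 2 * A * ?pk"
      proof -
        have e: "1 - ?pk = ?pj" "1 - ?pj = ?pk" using two by simp_all
        show "?mu u \<le> 2 * A * ?pj"
          using mean_fitness_bound[OF nn s1, of k] unfolding e by (simp add: abs_le_iff)
        show "?mu u \<le> 2 * A * ?pk"
          using mean_fitness_bound[OF nn s1, of j] unfolding e by (simp add: abs_le_iff)
      qed
      then have "?pk * ?mu u + ?pj * ?mu u \<le> ?pk * (2 * A * ?pj) + ?pj * (2 * A * ?pk)"
        using nn by (intro add_mono mult_left_mono)
      moreover have "?pk * ?mu u + ?pj * ?mu u = ?mu u" using two by (metis add.commute distrib_right mult_1)
      ultimately show ?thesis by (simp add: mult_ac)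
    qed
    then have "?R u * ?mu u \<le> ?R u * (L * (?pk * g u))" using 1 Rpos[of u] by (intro mult_left_mono) auto
    moreover have "1 < ?R u"
    proof -
      have "0 \<le> L * ?pk" using nn A_pos c_pos by (simp add: L_def)
      then have "0 < ln (?R u)" using eq by (simp add: f_def)
      then show ?thesis using Rpos[of u] by (simp only: ln_gt_zero_iff)
    qed
    ultimately show "0 < L * (2 * ?R u * (?pk * g u)) - 2 * (1 - ?R u + ?R u * ?mu u)"
      by (simp add: algebra_simps)
  qed (use a in simp)
  moreover have "L * share (\<gamma> t) k \<le> L * 1"
    using p_le_1[OF share_nonneg share_sum[OF nz]] A_pos c_pos
    by (intro mult_left_mono) (auto simp: L_def)
  ultimately have "ln (?R t) \<le> 1 + L" by (simp add: f_def)
  then have "exp (ln (?R t)) \<le> exp (1 + L)" by simp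
  then show "?R t \<le> exp (1 + 4 * A / c)" unfolding exp_ln[OF Rpos] L_def .
qed

end

lemma edge_point_of_connection:
  assumes beta: "\<beta> = offdiag \<alpha>" and e: "(j, k) \<in> E" and y: "y \<in> connection \<alpha> j k"
  shows "edge_point E (sqrt (1 / (2 + 4 * A))) (sqrt (exp (1 + 4 * A / c))) y"
proof -
  obtain \<gamma> where g': "\<forall>t. (\<gamma> has_vector_derivative vf \<alpha> (\<gamma> t)) (at t)"
    "\<forall>t. \<forall>i. i \<noteq> j \<and> i \<noteq> k \<longrightarrow> \<gamma> t $ i = 0"
    "(\<gamma> \<longlongrightarrow> \<xi> j) at_bot" "(\<gamma> \<longlongrightarrow> \<xi> k) at_top" "y \<in> range \<gamma>"
    using y unfolding connection_def by blast
  then obtain t where t: "y = \<gamma> t" by blast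
  have g1: "\<And>t. (\<gamma> has_vector_derivative vf \<alpha> (\<gamma> t)) (at t)"
    and g2: "\<And>t i. i \<noteq> j \<Longrightarrow> i \<noteq> k \<Longrightarrow> \<gamma> t $ i = 0" using g' by blast+
  note g = g1 g2 g'(3,4) t
  note b = connection_norm_bounds[OF beta e g(1-4), of t]
  have "sqrt (1 / (2 + 4 * A)) \<le> norm y" "norm y \<le> sqrt (exp (1 + 4 * A / c))"
    using real_sqrt_le_mono[OF b(1)] real_sqrt_le_mono[OF b(2)] g(5) by auto
  moreover have "\<exists>(j, k)\<in>E. \<forall>i. i \<noteq> j \<and> i \<noteq> k \<longrightarrow> y $ i = 0"
    using e g(2,5) by (intro bexI[of _ "(j, k)"]) auto
  ultimately show ?thesis
    using connection_coord_nonneg[OF beta e g(1-4)] unfolding edge_point_def g(5) by blast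
qed

lemma edge_point_of_equilibrium:
  assumes e: "(j, k) \<in> E" and i: "i = j \<or> i = k"
  shows "edge_point E (sqrt (1 / (2 + 4 * A))) (sqrt (exp (1 + 4 * A / c))) (\<xi> i)"
proof -
  have "1 / (2 + 4 * A) \<le> 1" using A_pos by simp
  moreover have "1 \<le> exp (1 + 4 * A / c)" using A_pos c_pos by simp
  ultimately show ?thesis
    using e i tendsto_const[of "\<xi> i"] unfolding edge_point_def
    by (auto simp: \<xi>_def simp flip: axis_def) (auto simp: axis_def)
qed

end

lemma near_edge_points:
  assumes N: "N \<noteq> {}" "\<And>y. y \<in> N \<Longrightarrow> edge_point E m M y" and m: "0 < m" and \<eta>: "0 < \<eta>"
  shows "\<exists>\<delta>>0. \<forall>x. infdist x N < \<delta> \<longrightarrow> m / 2 \<le> norm x \<and> norm x \<le> M + 1 \<and>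
    near_edges E \<eta> (share x) \<and> (\<forall>i. - (1 / 4) \<le> x $ i)"
proof -
  define \<delta> where "\<delta> = min (1 / 4) (min (m / 2) (sqrt \<eta> * (m / 2)))"
  have d: "0 < \<delta>" "\<delta> \<le> 1 / 4" "\<delta> \<le> m / 2" "\<delta> \<le> sqrt \<eta> * (m / 2)"
    using m \<eta> by (auto simp: \<delta>_def)
  show ?thesis
  proof (intro exI[of _ \<delta>] conjI allI impI)
    fix x assume "infdist x N < \<delta>"
    then obtain y where y: "y \<in> N" "dist x y < \<delta>"
      using N(1) by (auto simp: infdist_notempty dest!: cInf_lessD[rotated])
    note ep = N(2)[OF y(1), unfolded edge_point_def]
    have tri: "norm y - \<delta> \<le> norm x" "norm x \<le> norm y + \<delta>"
      using y(2) norm_triangle_ineq2[of x y] norm_triangle_ineq3[of x y] by (auto simp: dist_norm)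
    show nx: "m / 2 \<le> norm x" using tri d ep by linarith
    show "norm x \<le> M + 1" using tri d ep by linarith
    have comp: "\<bar>x $ i - y $ i\<bar> \<le> \<delta>" for i
      using component_le_norm_cart[of "x - y" i] y(2) by (simp add: dist_norm)
    show "- (1 / 4) \<le> x $ i" for i
    proof -
      have "0 \<le> y $ i" using ep by blast
      then show ?thesis using comp[of i] d(2) by linarith
    qed
    obtain j k where jk: "(j, k) \<in> E" "\<And>i. i \<noteq> j \<Longrightarrow> i \<noteq> k \<Longrightarrow> y $ i = 0" using ep by blast
    have "share x i \<le> \<eta>" if "i \<noteq> j" "i \<noteq> k" for i
    proof -
      have "\<bar>x $ i\<bar> \<le> sqrt \<eta> * norm x"
      proof -
        have "sqrt \<eta> * (m / 2) \<le> sqrt \<eta> * norm x" using nx \<eta> by (intro mult_left_mono) auto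
        then show ?thesis using comp[of i] jk(2)[OF that] d(4) by simp
      qed
      then have "\<bar>x $ i\<bar>\<^sup>2 \<le> (sqrt \<eta> * norm x)\<^sup>2" by (intro power_mono) auto
      then have "(x $ i)\<^sup>2 \<le> \<eta> * (norm x)\<^sup>2" using \<eta> by (simp add: power_mult_distrib)
      moreover have "0 < norm x" using nx m by linarith
      ultimately show ?thesis by (simp add: share_def divide_le_eq)
    qed
    then show "near_edges E \<eta> (share x)" using jk(1) by (auto simp: near_edges_def)
  qed (rule d(1))
qed

section \<open>Existence of the planar connections\<close>

text \<open>Time as a function of the state is an antiderivative of \<open>1 / g\<close>. It maps onto the real line because
  \<open>g\<close> is bounded, and its inverse is the solution.\<close>

lemma autonomous_scalar_flow:
  fixes g :: "real \<Rightarrow> real"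
  assumes cont: "\<And>r. isCont g r" and pos: "\<And>r. 0 < g r" and bound: "\<And>r. g r \<le> C"
  obtains r where "\<And>t. (r has_real_derivative g (r t)) (at t)"
    "filterlim r at_top at_top" "filterlim r at_bot at_bot"
proof -
  have C: "0 < C" using pos[of 0] bound[of 0] by linarith
  have "isCont (\<lambda>x. 1 / g x) u" for u
    using cont[of u] pos[of u] by (intro continuous_divide continuous_const) auto
  then have "\<exists>F. \<forall>x. - \<infinity> < ereal x \<longrightarrow> ereal x < \<infinity> \<longrightarrow> (F has_vector_derivative 1 / g x) (at x)"
    by (intro einterval_antiderivative) auto
  then obtain F where "\<forall>x. - \<infinity> < ereal x \<longrightarrow> ereal x < \<infinity> \<longrightarrow> (F has_vector_derivative 1 / g x) (at x)"
    by (rule exE)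
  then have F: "DERIV F x :> 1 / g x" for x
    by (simp add: has_real_derivative_iff_has_vector_derivative)
  have mono: "F x < F y" if "x < y" for x y
  proof (rule DERIV_pos_imp_increasing[OF that])
    show "\<exists>d. DERIV F u :> d \<and> 0 < d" for u
      using F[of u] pos[of u] by (intro exI[of _ "1 / g u"]) simp
  qed
  have growth: "(y - x) / C \<le> F y - F x" if "x \<le> y" for x y
  proof -
    have "(\<lambda>u. F u - u / C) x \<le> (\<lambda>u. F u - u / C) y"
    proof (rule DERIV_nonneg_imp_nondecreasing[OF that])
      fix u
      have "1 / C \<le> 1 / g u" using pos[of u] bound[of u] by (simp add: frac_le)
      moreover have "((\<lambda>u. F u - u / C) has_real_derivative 1 / g u - 1 / C) (at u)"
        using C by (auto intro!: derivative_eq_intros F)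
      ultimately show "\<exists>d. ((\<lambda>u. F u - u / C) has_real_derivative d) (at u) \<and> 0 \<le> d" by auto
    qed
    then show ?thesis by (simp add: diff_divide_distrib)
  qed
  have contF: "isCont F x" for x using F DERIV_isCont by blast
  have "\<exists>x. F x = t" for t
  proof -
    define d where "d = C * \<bar>t - F 0\<bar>"
    have d: "0 \<le> d" "d / C = \<bar>t - F 0\<bar>" using C by (auto simp: d_def)
    have "F (- d) \<le> t" "t \<le> F d" using growth[of "- d" 0] growth[of 0 d] d by auto
    then show ?thesis using IVT[of F "- d" t d] contF d by auto
  qed
  then obtain r where r: "\<And>t. F (r t) = t" by metis
  have rF: "r (F x) = x" for x using mono r by (metis linorder_neqE_linordered_idom less_irrefl)
  have contr: "isCont r t" for t
  proof -
    have "isCont r (F (r t))"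
      by (rule isCont_inverse_function2[of "r t - 1" _ "r t + 1"]) (auto simp: rF contF)
    then show ?thesis by (simp add: r)
  qed
  show ?thesis
  proof (rule that)
    fix t
    have "DERIV r t :> inverse (1 / g (r t))"
      by (rule DERIV_inverse_function[where f = F and a = "t - 1" and b = "t + 1"]) (use F pos r contr in \<open>auto simp: less_imp_neq[symmetric]\<close>)
    then show "(r has_real_derivative g (r t)) (at t)" by simp
  next
    have le: "z \<le> r t" if "F z \<le> t" for z t
      using mono[of "r t" z] r[of t] that by (cases "r t < z") auto
    have ge: "r t \<le> z" if "t \<le> F z" for z t
      using mono[of z "r t"] r[of t] that by (cases "z < r t") auto
    show "filterlim r at_top at_top"
      unfolding filterlim_at_top using eventually_ge_at_top le by (metis (mono_tags, lifting) eventually_mono)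
    show "filterlim r at_bot at_bot"
      unfolding filterlim_at_bot using eventually_le_at_bot ge by (metis (mono_tags, lifting) eventually_mono)
  qed
qed

text \<open>The squared coordinates satisfy \<open>X' = 2 X (1 - X - Y - b Y)\<close> and \<open>Y' = 2 Y (1 - X - Y + a X)\<close>, where \<open>a\<close>
  is the expanding eigenvalue of the first and \<open>- b\<close> the contracting eigenvalue of the second
  equilibrium. As a function of the ratio \<open>Y / X = y powr a\<close> the coordinate \<open>X\<close> solves a linear equation.
  An integrating factor gives the solution \<open>X = Q / P\<close> that starts at 1.\<close>

locale planar_connection =
  fixes a b :: real
  assumes a: "0 < a" and b: "0 < b"
begin

definition \<kappa> where "\<kappa> = 1 / b - 1 / a"
definition P where "P y = a + b * y powr a"
definition J where "J y = integral {0..y} (\<lambda>s. a * P s powr \<kappa>)"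
definition G where "G y = y * P y powr \<kappa>"
definition Q where "Q y = J y / G y"

lemma P_pos: "0 < P y"
  using a b by (simp add: P_def add_pos_nonneg)

lemma G_pos: "0 < y \<Longrightarrow> 0 < G y"
  using P_pos[of y] by (simp add: G_def)

lemma integrand_cont: "continuous_on {0..y} (\<lambda>s. a * P s powr \<kappa>)"
proof -
  have "continuous_on {0..y} P" unfolding P_def
    using a by (intro continuous_intros continuous_on_powr') auto
  then show ?thesis using P_pos by (intro continuous_intros continuous_on_powr) (auto simp: less_imp_neq[symmetric])
qed

lemma J_deriv_within: "0 \<le> y \<Longrightarrow> y \<le> z \<Longrightarrow> (J has_real_derivative a * P y powr \<kappa>) (at y within {0..z})"
  unfolding J_def has_real_derivative_iff_has_vector_derivative
  by (rule integral_has_vector_derivative[OF integrand_cont]) auto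

lemma J_deriv: "0 < y \<Longrightarrow> (J has_real_derivative a * P y powr \<kappa>) (at y)"
  using J_deriv_within[of y "y + 1"] by (simp add: at_within_Icc_at)

lemma J_pos: "0 < y \<Longrightarrow> 0 < J y"
proof -
  assume y: "0 < y"
  have "J 0 < J y"
  proof (rule DERIV_pos_imp_increasing_open[OF y])
    fix x assume "0 < x" "x < y"
    then show "\<exists>d. (J has_real_derivative d) (at x) \<and> 0 < d"
      using J_deriv[of x] a P_pos[of x] by (auto intro!: exI[of _ "a * P x powr \<kappa>"])
  next
    show "continuous_on {0..y} J"
      using J_deriv_within by (meson DERIV_continuous atLeastAtMost_iff continuous_on_eq_continuous_within)
  qed
  then show ?thesis by (simp add: J_def)
qed

lemma P_deriv: "0 < y \<Longrightarrow> (P has_real_derivative a * b * y powr a / y) (at y)"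
  unfolding P_def by (auto intro!: derivative_eq_intros simp: powr_diff)

lemma G_deriv:
  assumes y: "0 < y"
  shows "(G has_real_derivative P y powr \<kappa> * (a * (1 + y powr a) / P y)) (at y)"
proof -
  have Pk: "((\<lambda>y. P y powr \<kappa>) has_real_derivative \<kappa> * P y powr (\<kappa> - 1) * (a * b * y powr a / y)) (at y)"
    by (rule DERIV_chain2[OF has_real_derivative_powr[OF P_pos] P_deriv[OF y]])
  have "(G has_real_derivative 1 * P y powr \<kappa>
      + \<kappa> * P y powr (\<kappa> - 1) * (a * b * y powr a / y) * y) (at y)"
    unfolding G_def by (rule DERIV_mult[OF DERIV_ident Pk])
  moreover have "1 * P y powr \<kappa> + \<kappa> * P y powr (\<kappa> - 1) * (a * b * y powr a / y) * y
      = P y powr \<kappa> * ((P y + (\<kappa> * a * b) * y powr a) / P y)"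
    using y P_pos[of y] by (simp add: powr_diff field_simps)
  moreover have "\<kappa> * a * b = a - b" using a b by (simp add: \<kappa>_def field_simps)
  moreover have "P y + (a - b) * y powr a = a * (1 + y powr a)" by (simp add: P_def algebra_simps)
  ultimately show ?thesis by simp
qed

lemma Q_pos: "0 < y \<Longrightarrow> 0 < Q y"
  using J_pos G_pos by (simp add: Q_def)

lemma Q_deriv:
  assumes y: "0 < y"
  shows "(Q has_real_derivative a / y * (1 - Q y * (1 + y powr a) / P y)) (at y)"
proof -
  have g: "G y \<noteq> 0" "P y powr \<kappa> \<noteq> 0" "P y \<noteq> 0" using G_pos[OF y] P_pos[of y] by auto
  have "(Q has_real_derivative ((a * P y powr \<kappa>) * G y - J y * (P y powr \<kappa> * (a * (1 + y powr a) / P y)))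
     / (G y * G y)) (at y)"
    unfolding Q_def by (rule DERIV_divide[OF J_deriv[OF y] G_deriv[OF y] g(1)])
  moreover have "((a * P y powr \<kappa>) * G y - J y * (P y powr \<kappa> * (a * (1 + y powr a) / P y))) / (G y * G y)
     = a * (P y powr \<kappa> / G y) * (1 - J y / G y * (1 + y powr a) / P y)"
    using g by (simp add: field_simps)
  moreover have "P y powr \<kappa> / G y = 1 / y" using g by (simp add: G_def)
  ultimately show ?thesis by (simp add: Q_def)
qed

lemma Q_at_0: "(Q \<longlongrightarrow> a) (at_right 0)"
proof -
  have P0: "(P \<longlongrightarrow> a) (at_right 0)"
    unfolding P_def using a by real_asymp
  have "(J has_real_derivative a * P 0 powr \<kappa>) (at 0 within {0..1})" by (rule J_deriv_within) auto
  then have "((\<lambda>y. J y / y) \<longlongrightarrow> a * a powr \<kappa>) (at 0 within {0..1})"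
    using a by (simp add: has_field_derivative_iff J_def P_def)
  then have "((\<lambda>y. J y / y) \<longlongrightarrow> a * a powr \<kappa>) (at_right 0)"
    by (simp add: at_within_Icc_at_right)
  then have "((\<lambda>y. (J y / y) / P y powr \<kappa>) \<longlongrightarrow> (a * a powr \<kappa>) / a powr \<kappa>) (at_right 0)"
    using a by (intro tendsto_divide tendsto_powr P0 tendsto_const) auto
  then show ?thesis using a by (simp add: Q_def[abs_def] G_def divide_divide_eq_left')
qed

text \<open>The quotient of the derivatives is \<open>P y / (1 + y powr a)\<close>.\<close>

lemma Q_at_top: "(Q \<longlongrightarrow> b) at_top"
  unfolding Q_def[abs_def]
proof (rule lhospital_at_top_at_top)
  have "filterlim (\<lambda>y. y powr (a / b) * (a * y powr (- a) + b) powr \<kappa>) at_top at_top"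
    using a b by real_asymp
  moreover have ev: "eventually (\<lambda>y. y powr (a / b) * (a * y powr (- a) + b) powr \<kappa> = G y) at_top"
    using eventually_gt_at_top[of 0]
  proof eventually_elim
    case (elim y)
    have "P y = y powr a * (a * y powr (- a) + b)"
      using elim by (simp add: P_def powr_minus field_simps)
    then have "P y powr \<kappa> = y powr (a * \<kappa>) * (a * y powr (- a) + b) powr \<kappa>"
      using a b elim by (simp add: powr_mult powr_powr)
    moreover have "a * \<kappa> = a / b - 1" using a b by (simp add: \<kappa>_def field_simps)
    ultimately show ?case using elim by (simp add: G_def powr_diff)
  qed
  ultimately show "filterlim G at_top at_top" by (simp only: filterlim_cong[OF refl refl ev])
  show "eventually (\<lambda>y. P y powr \<kappa> * (a * (1 + y powr a) / P y) \<noteq> 0) at_top"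
  proof (rule always_eventually, rule allI)
    fix y :: real
    have "0 < 1 + y powr a" by (simp add: add_pos_nonneg)
    then show "P y powr \<kappa> * (a * (1 + y powr a) / P y) \<noteq> 0" using a P_pos[of y] by simp
  qed
  show "eventually (\<lambda>y. DERIV J y :> a * P y powr \<kappa>) at_top"
    using eventually_gt_at_top[of 0] by eventually_elim (rule J_deriv)
  show "eventually (\<lambda>y. DERIV G y :> P y powr \<kappa> * (a * (1 + y powr a) / P y)) at_top"
    using eventually_gt_at_top[of 0] by eventually_elim (rule G_deriv)
  have "((\<lambda>y. (a + b * y powr a) / (1 + y powr a)) \<longlongrightarrow> b) at_top" using a by real_asymp
  moreover have "a * P y powr \<kappa> / (P y powr \<kappa> * (a * (1 + y powr a) / P y)) = (a + b * y powr a) / (1 + y powr a)"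
    for y using a P_pos[of y] by (simp add: P_def)
  ultimately show "((\<lambda>y. a * P y powr \<kappa> / (P y powr \<kappa> * (a * (1 + y powr a) / P y))) \<longlongrightarrow> b) at_top"
    by simp
qed

text \<open>The logarithm of \<open>y\<close> as a function of time.\<close>

lemma log_ratio_flow:
  obtains r where "\<And>t. (r has_real_derivative 2 / a * Q (exp (r t))) (at t)"
    "filterlim r at_top at_top" "filterlim r at_bot at_bot"
proof -
  define g where "g u = 2 / a * Q (exp u)" for u
  have cont: "isCont g u" for u
  proof -
    have "isCont (\<lambda>u. Q (exp u)) u"
      by (rule isCont_o2[OF isCont_exp DERIV_isCont[OF Q_deriv]]) simp_all
    then show ?thesis unfolding g_def by (intro continuous_intros)
  qed
  have pos: "0 < g u" for u using a Q_pos[of "exp u"] by (simp add: g_def)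
  have "(g \<longlongrightarrow> 2 / a * a) at_bot" unfolding g_def
    by (intro tendsto_mult_left filterlim_compose[OF Q_at_0]) real_asymp
  then have "eventually (\<lambda>u. g u < 3) at_bot" using a by (intro order_tendstoD(2)) auto
  then obtain l where l: "\<And>u. u \<le> l \<Longrightarrow> g u < 3" by (auto simp: eventually_at_bot_linorder)
  have "(g \<longlongrightarrow> 2 / a * b) at_top" unfolding g_def
    by (intro tendsto_mult_left filterlim_compose[OF Q_at_top] exp_at_top)
  then have "eventually (\<lambda>u. g u < 2 / a * b + 1) at_top" by (intro order_tendstoD(2)) auto
  then obtain h where h: "\<And>u. h \<le> u \<Longrightarrow> g u < 2 / a * b + 1" by (auto simp: eventually_at_top_linorder)
  have "compact (g ` {l..h})"
    using cont by (intro compact_continuous_image continuous_at_imp_continuous_on) auto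
  then obtain B where B: "\<And>u. u \<in> {l..h} \<Longrightarrow> g u \<le> B"
    by (metis bdd_above.E bounded_imp_bdd_above compact_imp_bounded imageI)
  have "g u \<le> max 3 (max (2 / a * b + 1) B)" for u
    using l[of u] h[of u] B[of u] by (cases "u \<le> l"; cases "h \<le> u") (auto simp: le_max_iff_disj)
  from autonomous_scalar_flow[OF cont pos this] show ?thesis using that unfolding g_def by blast
qed

lemma planar_solution:
  obtains X Y :: "real \<Rightarrow> real" where "\<And>t. 0 < X t" "\<And>t. 0 < Y t"
    "\<And>t. (X has_real_derivative 2 * X t * (1 - (X t + Y t) - b * Y t)) (at t)"
    "\<And>t. (Y has_real_derivative 2 * Y t * (1 - (X t + Y t) + a * X t)) (at t)"
    "(X \<longlongrightarrow> 1) at_bot" "(Y \<longlongrightarrow> 0) at_bot" "(X \<longlongrightarrow> 0) at_top" "(Y \<longlongrightarrow> 1) at_top"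
proof -
  obtain r where r: "\<And>t. (r has_real_derivative 2 / a * Q (exp (r t))) (at t)"
    and rtop: "filterlim r at_top at_top" and rbot: "filterlim r at_bot at_bot"
    using log_ratio_flow by blast
  define y where "y t = exp (r t)" for t
  define v where "v t = y t powr a" for t
  define X where "X t = Q (y t) / P (y t)" for t
  define Y where "Y t = v t * X t" for t
  have y0: "0 < y t" and v0: "0 < v t" for t by (auto simp: y_def v_def)
  have X0: "0 < X t" and Y0: "0 < Y t" for t using Q_pos[OF y0] P_pos v0 by (auto simp: X_def Y_def)
  have dy: "(y has_real_derivative 2 / a * y t * Q (y t)) (at t)" for t
    unfolding y_def by (auto intro!: derivative_eq_intros r)
  have XP: "Q (y t) = X t * P (y t)" for t using P_pos[of "y t"] by (simp add: X_def)
  have dX: "(X has_real_derivative 2 * X t * (1 - (X t + Y t) - b * Y t)) (at t)" for t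
  proof -
    have p: "P (y t) \<noteq> 0" "y t \<noteq> 0" using P_pos[of "y t"] y0[of t] by auto
    have "((\<lambda>z. Q z / P z) has_real_derivative
       ((a / y t * (1 - Q (y t) * (1 + y t powr a) / P (y t))) * P (y t) - Q (y t) * (a * b * y t powr a / y t))
         / (P (y t) * P (y t))) (at (y t))"
      by (rule DERIV_divide[OF Q_deriv P_deriv]) (use y0 p in auto)
    from DERIV_chain2[OF this dy]
    have "(X has_real_derivative
       ((a / y t * (1 - Q (y t) * (1 + y t powr a) / P (y t))) * P (y t) - Q (y t) * (a * b * y t powr a / y t))
         / (P (y t) * P (y t)) * (2 / a * y t * Q (y t))) (at t)" unfolding X_def .
    moreover have "((a / y t * (1 - Q (y t) * (1 + y t powr a) / P (y t))) * P (y t) - Q (y t) * (a * b * y t powr a / y t))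
         / (P (y t) * P (y t)) * (2 / a * y t * Q (y t)) = 2 * X t * (1 - (X t + Y t) - b * Y t)"
      unfolding XP Y_def v_def using p a by (simp add: field_simps)
    ultimately show ?thesis by simp
  qed
  have dv: "(v has_real_derivative 2 * v t * (X t * P (y t))) (at t)" for t
  proof -
    have "(v has_real_derivative a * y t powr (a - 1) * (2 / a * y t * Q (y t))) (at t)"
      unfolding v_def by (rule DERIV_chain2[OF has_real_derivative_powr[OF y0] dy])
    moreover have "a * y t powr (a - 1) * (2 / a * y t * Q (y t)) = 2 * v t * (X t * P (y t))"
      unfolding XP v_def using a y0[of t] by (simp add: powr_diff)
    ultimately show ?thesis by simp
  qed
  have dY: "(Y has_real_derivative 2 * Y t * (1 - (X t + Y t) + a * X t)) (at t)" for t
  proof -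
    have "(Y has_real_derivative 2 * v t * (X t * P (y t)) * X t + 2 * X t * (1 - (X t + Y t) - b * Y t) * v t) (at t)"
      unfolding Y_def[abs_def] by (rule DERIV_mult[OF dv dX[unfolded Y_def]])
    moreover have "2 * v t * (X t * P (y t)) * X t + 2 * X t * (1 - (X t + Y t) - b * Y t) * v t
       = 2 * Y t * (1 - (X t + Y t) + a * X t)"
      by (simp add: Y_def P_def v_def algebra_simps)
    ultimately show ?thesis by simp
  qed
  have ytop: "filterlim y at_top at_top" unfolding y_def by (rule filterlim_compose[OF exp_at_top rtop])
  have ybot: "filterlim y (at_right 0) at_bot" unfolding y_def
    by (rule filterlim_compose[OF _ rbot]) real_asymp
  have "((\<lambda>y. Q y / P y) \<longlongrightarrow> a / a) (at_right 0)"
    using a by (intro tendsto_divide Q_at_0) (auto simp: P_def[abs_def], real_asymp)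
  then have Xbot: "(X \<longlongrightarrow> 1) at_bot"
    unfolding X_def using filterlim_compose[OF _ ybot] a by fastforce
  have "((\<lambda>y. y powr a) \<longlongrightarrow> 0) (at_right 0)" using a by real_asymp
  then have "(v \<longlongrightarrow> 0) at_bot" unfolding v_def using filterlim_compose[OF _ ybot] by blast
  then have Ybot: "(Y \<longlongrightarrow> 0) at_bot" unfolding Y_def using tendsto_mult[OF _ Xbot, of v 0] by simp
  have "((\<lambda>y. Q y * (1 / P y)) \<longlongrightarrow> b * 0) at_top"
    unfolding P_def using a b by (intro tendsto_mult Q_at_top) real_asymp
  then have "((\<lambda>y. Q y / P y) \<longlongrightarrow> 0) at_top" by simp
  then have Xtop: "(X \<longlongrightarrow> 0) at_top" unfolding X_def by (rule filterlim_compose[OF _ ytop])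
  have "((\<lambda>y. (y powr a / P y) * Q y) \<longlongrightarrow> inverse b * b) at_top"
    unfolding P_def using a b by (intro tendsto_mult Q_at_top) real_asymp
  then have "((\<lambda>y. y powr a * (Q y / P y)) \<longlongrightarrow> 1) at_top" using b by simp
  then have Ytop: "(Y \<longlongrightarrow> 1) at_top" unfolding Y_def X_def v_def by (rule filterlim_compose[OF _ ytop])
  show ?thesis by (rule that[OF X0 Y0 dX dY Xbot Ybot Xtop Ytop])
qed

end

lemma exists_connection:
  assumes jk: "j \<noteq> k" "0 < \<alpha> j k" "\<alpha> k j < 0"
  obtains \<gamma> where "\<And>t. (\<gamma> has_vector_derivative vf \<alpha> (\<gamma> t)) (at t)"
    "\<And>t i. i \<noteq> j \<Longrightarrow> i \<noteq> k \<Longrightarrow> \<gamma> t $ i = 0"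
    "(\<gamma> \<longlongrightarrow> \<xi> j) at_bot" "(\<gamma> \<longlongrightarrow> \<xi> k) at_top"
proof -
  interpret planar_connection "\<alpha> j k" "- \<alpha> k j" by unfold_locales (use jk in auto)
  obtain X Y where pos: "\<And>t. 0 < X t" "\<And>t. 0 < Y t"
    and dX: "\<And>t. (X has_real_derivative 2 * X t * (1 - (X t + Y t) - (- \<alpha> k j) * Y t)) (at t)"
    and dY: "\<And>t. (Y has_real_derivative 2 * Y t * (1 - (X t + Y t) + \<alpha> j k * X t)) (at t)"
    and lim: "(X \<longlongrightarrow> 1) at_bot" "(Y \<longlongrightarrow> 0) at_bot" "(X \<longlongrightarrow> 0) at_top" "(Y \<longlongrightarrow> 1) at_top"
    using planar_solution by blast
  define \<gamma> where "\<gamma> t = sqrt (X t) *\<^sub>R \<xi> j + sqrt (Y t) *\<^sub>R \<xi> k" for t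
  have comp: "\<gamma> t $ i = (if i = j then sqrt (X t) else if i = k then sqrt (Y t) else 0)" for t i
    using jk by (simp add: \<gamma>_def \<xi>_def axis_def)
  have sq: "(\<gamma> t $ i)\<^sup>2 = (if i = j then X t else if i = k then Y t else 0)" for t i
    using pos[of t] by (simp add: comp less_imp_le)
  have others: "(\<Sum>i\<in>UNIV - {j, k}. f i * (\<gamma> t $ i)\<^sup>2) = 0" for t and f :: "4 \<Rightarrow> real"
    by (rule sum.neutral) (simp add: sq)
  have R: "(norm (\<gamma> t))\<^sup>2 = X t + Y t" for t
    unfolding norm_sq_sum sum_split2[OF jk(1)] using others[of "\<lambda>_. 1" t] jk by (simp add: sq)
  have S: "(\<Sum>l\<in>UNIV - {i}. \<alpha> l i * (\<gamma> t $ l)\<^sup>2)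
     = (if i = j then \<alpha> k j * Y t else if i = k then \<alpha> j k * X t else \<alpha> j i * X t + \<alpha> k i * Y t)" for t i
  proof -
    have "(\<Sum>l\<in>UNIV - {i}. \<alpha> l i * (\<gamma> t $ l)\<^sup>2) = (\<Sum>l\<in>UNIV. offdiag \<alpha> l i * (\<gamma> t $ l)\<^sup>2)"
      by (simp add: sum.remove[of UNIV i] offdiag_def)
    also have "\<dots> = offdiag \<alpha> j i * X t + offdiag \<alpha> k i * Y t"
      unfolding sum_split2[OF jk(1)] others using jk by (simp add: sq)
    finally show ?thesis using jk by (auto simp: offdiag_def)
  qed
  have root: "((\<lambda>t. sqrt (Z t)) has_real_derivative sqrt (Z t) * w) (at t)"
    if "(Z has_real_derivative 2 * Z t * w) (at t)" "0 < Z t" for Z w t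
  proof -
    have "((\<lambda>t. sqrt (Z t)) has_real_derivative inverse (sqrt (Z t)) / 2 * (2 * Z t * w)) (at t)"
      by (rule DERIV_chain2[OF DERIV_real_sqrt[OF that(2)] that(1)])
    moreover have "inverse (sqrt (Z t)) / 2 * (2 * Z t * w) = sqrt (Z t) * w"
      using that(2) by (simp add: field_simps)
    ultimately show ?thesis by (simp only:)
  qed
  show ?thesis
  proof (rule that)
    fix t
    let ?u = "sqrt (X t) * (1 - (X t + Y t) - (- \<alpha> k j) * Y t)"
    let ?w = "sqrt (Y t) * (1 - (X t + Y t) + \<alpha> j k * X t)"
    have "(\<gamma> has_vector_derivative (sqrt (X t) *\<^sub>R 0 + ?u *\<^sub>R \<xi> j) + (sqrt (Y t) *\<^sub>R 0 + ?w *\<^sub>R \<xi> k)) (at t)"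
      unfolding \<gamma>_def
      by (intro has_vector_derivative_add has_vector_derivative_scaleR root[OF dX pos(1)] root[OF dY pos(2)]
          has_vector_derivative_const)
    moreover have "(sqrt (X t) *\<^sub>R 0 + ?u *\<^sub>R \<xi> j) + (sqrt (Y t) *\<^sub>R 0 + ?w *\<^sub>R \<xi> k) = vf \<alpha> (\<gamma> t)"
    proof -
      have "vf \<alpha> (\<gamma> t) $ i = \<gamma> t $ i * (1 - (X t + Y t) + (if i = j then \<alpha> k j * Y t
          else if i = k then \<alpha> j k * X t else \<alpha> j i * X t + \<alpha> k i * Y t))" for i
        unfolding S[symmetric] by (simp add: vf_def R)
      then show ?thesis using jk(1) by (simp add: vec_eq_iff comp \<xi>_def axis_def)
    qed
    ultimately show "(\<gamma> has_vector_derivative vf \<alpha> (\<gamma> t)) (at t)" by simp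
  next
    show "\<gamma> t $ i = 0" if "i \<noteq> j" "i \<noteq> k" for t i using that by (simp add: comp)
    have "(\<gamma> \<longlongrightarrow> sqrt 1 *\<^sub>R \<xi> j + sqrt 0 *\<^sub>R \<xi> k) at_bot"
      unfolding \<gamma>_def by (intro tendsto_intros lim)
    then show "(\<gamma> \<longlongrightarrow> \<xi> j) at_bot" by simp
    have "(\<gamma> \<longlongrightarrow> sqrt 0 *\<^sub>R \<xi> j + sqrt 1 *\<^sub>R \<xi> k) at_top"
      unfolding \<gamma>_def by (intro tendsto_intros lim)
    then show "(\<gamma> \<longlongrightarrow> \<xi> k) at_top" by simp
  qed
qed

lemma exists_intermediate_connection_point:
  assumes jk: "j \<noteq> k" "0 < \<alpha> j k" "\<alpha> k j < 0"
  obtains y where "y \<in> connection \<alpha> j k" "y \<noteq> 0" "share y k = 1 / 3" "share y j = 2 / 3"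
proof -
  obtain \<gamma> where g: "\<And>t. (\<gamma> has_vector_derivative vf \<alpha> (\<gamma> t)) (at t)"
    "\<And>t i. i \<noteq> j \<Longrightarrow> i \<noteq> k \<Longrightarrow> \<gamma> t $ i = 0" "(\<gamma> \<longlongrightarrow> \<xi> j) at_bot" "(\<gamma> \<longlongrightarrow> \<xi> k) at_top"
    using exists_connection[OF jk] by blast
  have nz: "\<gamma> t \<noteq> 0" for t
  proof
    assume "\<gamma> t = 0"
    then have z: "\<gamma> u $ k = 0" if "t \<le> u" for u
      using entire_solution_zero_iff[OF g(1) that, of k] by simp
    have "eventually (\<lambda>u. 0 < \<gamma> u $ k) at_top"
      using order_tendstoD(1)[OF tendsto_share_axis(3)[OF g(4), of k], of 0] by simp
    then obtain N where N: "\<And>u. N \<le> u \<Longrightarrow> 0 < \<gamma> u $ k" by (auto simp: eventually_at_top_linorder)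
    show False using N[of "max t N"] z[of "max t N"] by simp
  qed
  have cont: "continuous_on S (\<lambda>t. share (\<gamma> t) k)" for S
    using share_deriv[OF has_vector_derivative_at_within[OF g(1)] nz]
    by (meson DERIV_continuous continuous_on_eq_continuous_within)
  have "eventually (\<lambda>t. share (\<gamma> t) k < 1 / 3) at_bot"
    using order_tendstoD(2)[OF tendsto_share_axis(1)[OF g(3), of k], of "1 / 3"] jk by simp
  then obtain t0 where t0: "\<And>t. t \<le> t0 \<Longrightarrow> share (\<gamma> t) k < 1 / 3" by (auto simp: eventually_at_bot_linorder)
  have "eventually (\<lambda>t. 1 / 3 < share (\<gamma> t) k) at_top"
    using order_tendstoD(1)[OF tendsto_share_axis(1)[OF g(4), of k], of "1 / 3"] by simp
  then obtain t1 where t1: "\<And>t. t1 \<le> t \<Longrightarrow> 1 / 3 < share (\<gamma> t) k" by (auto simp: eventually_at_top_linorder)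
  have "\<exists>t\<ge>t0. t \<le> max t0 t1 \<and> share (\<gamma> t) k = 1 / 3"
    by (rule IVT'[OF _ _ _ cont]) (use t0[of t0] t1[of "max t0 t1"] in auto)
  then obtain t where t: "share (\<gamma> t) k = 1 / 3" by blast
  have "share (\<gamma> t) j = 2 / 3"
  proof -
    have "sum (share (\<gamma> t)) (UNIV - {j, k}) = 0"
      by (rule sum.neutral) (auto simp: share_def g(2))
    then show ?thesis
      using sum_split2[OF jk(1), of "share (\<gamma> t)"] share_sum[OF nz[of t]] t by simp
  qed
  moreover have "\<gamma> t \<in> connection \<alpha> j k" unfolding connection_def using g by blast
  ultimately show ?thesis using that nz t by blast
qed

section \<open>Trajectories that stay close to the network\<close>

lemma ball_dominates:
  assumes "dist y (\<xi> k) < 1 / 4"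
  shows "dominates (share y) k" "i \<noteq> k \<Longrightarrow> \<not> dominates (share y) i"
proof -
  have comp: "\<bar>y $ i - \<xi> k $ i\<bar> < 1 / 4" for i
    using component_le_norm_cart[of "y - \<xi> k" i] assms by (simp add: dist_norm)
  have k: "3 / 4 < y $ k" 
  proof -
    have "\<bar>y $ k - 1\<bar> < 1 / 4" using comp[of k] by (simp add: \<xi>_def axis_def)
    then show ?thesis by linarith
  qed
  have less: "share y i < share y k" if "i \<noteq> k" for i
  proof -
    have "\<bar>y $ i\<bar> < 1 / 4" using comp[of i] that by (simp add: \<xi>_def axis_def)
    then have "\<bar>y $ i\<bar> < \<bar>y $ k\<bar>" using k by simp
    then have "\<bar>y $ i\<bar>\<^sup>2 < \<bar>y $ k\<bar>\<^sup>2" by (intro power_strict_mono) auto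
    then have "(y $ i)\<^sup>2 < (y $ k)\<^sup>2" by simp
    moreover have "0 < (norm y)\<^sup>2" using k by auto
    ultimately show ?thesis by (simp add: share_def divide_strict_right_mono)
  qed
  show "dominates (share y) k" unfolding dominates_def
  proof
    show "share y i \<le> share y k" for i using less[of i] by (cases "i = k") auto
  qed
  show "i \<noteq> k \<Longrightarrow> \<not> dominates (share y) i" using less[of i] by (auto simp: dominates_def not_le)
qed

lemma dist_vertex_sq: "(dist y (\<xi> k))\<^sup>2 = (y $ k - 1)\<^sup>2 + ((norm y)\<^sup>2 - (y $ k)\<^sup>2)"
proof -
  have "(dist y (\<xi> k))\<^sup>2 = (norm y)\<^sup>2 + (norm (\<xi> k))\<^sup>2 - 2 * (y \<bullet> \<xi> k)"
    unfolding dist_norm power2_norm_eq_inner by (simp add: inner_diff_left inner_diff_right inner_commute)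
  then show ?thesis by (simp add: \<xi>_def inner_axis power2_eq_square algebra_simps)
qed

text \<open>The constants \<open>T0\<close> and \<open>\<theta>\<close> serve the entrance into the balls of radius \<open>\<epsilon>\<close>: as long as the defect
  \<open>1 - share (x t) k\<close> is below \<open>\<theta>\<close>, the norm comes close to 1 within the time \<open>T0\<close>. The last assumption
  keeps the defect below \<open>\<theta>\<close> for this time.\<close>

locale network_trajectory = three_cycle_signs +
  fixes \<alpha> :: "4 \<Rightarrow> 4 \<Rightarrow> real" and x :: "real \<Rightarrow> real^4" and s \<eta> m M \<epsilon> \<theta> T0 :: real
  assumes beta: "\<beta> = offdiag \<alpha>"
    and sol: "trajectory \<alpha> x" and s_nonneg: "0 \<le> s"
    and m_pos: "0 < m"
    and norm_bounds: "s \<le> t \<Longrightarrow> m \<le> norm (x t) \<and> norm (x t) \<le> M"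
    and near_x: "s \<le> t \<Longrightarrow> near_edges E \<eta> (share (x t))"
    and almost_nonneg: "s \<le> t \<Longrightarrow> - (1 / 4) \<le> x t $ i"
    and eta_pos': "0 < \<eta>" and eta_small': "\<eta> \<le> c\<^sup>2 / (2000 * A\<^sup>2)"
    and eta_large': "40 * A\<^sup>2 * (256 * A / c + 1) < c\<^sup>2 * (- ln \<eta>)"
    and eps: "0 < \<epsilon>" "\<epsilon> \<le> 1 / 4"
    and T0: "0 < T0" "(M\<^sup>2 + 1)\<^sup>2 < 2 * (m\<^sup>2 * (\<epsilon> / 4)\<^sup>2) * T0"
    and theta: "\<theta> \<le> \<epsilon>\<^sup>2 / 16" "8 * A * M ^ 4 * (M\<^sup>2 + 1) * \<theta> \<le> 2 * (m\<^sup>2 * (\<epsilon> / 4)\<^sup>2)"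
    and eta_theta: "4 * \<eta> * exp (6 * A * M\<^sup>2 * T0) \<le> \<theta>"
begin

lemma sol_within: "s \<le> t \<Longrightarrow> (x has_vector_derivative vf \<alpha> (x t)) (at t within {s..})"
  by (rule has_vector_derivative_within_subset[of _ _ _ "{0..}"])
    (use sol s_nonneg in \<open>auto simp: trajectory_def\<close>)

lemma x_nz: "s \<le> t \<Longrightarrow> x t \<noteq> 0"
  using norm_bounds[of t] m_pos by auto

lemma R_deriv: "s \<le> t \<Longrightarrow> ((\<lambda>t. (norm (x t))\<^sup>2) has_real_derivative
   2 * (norm (x t))\<^sup>2 * (1 - (norm (x t))\<^sup>2 + (norm (x t))\<^sup>2 * mean_fitness \<beta> (share (x t))))
   (at t within {s..})"
  unfolding beta by (rule norm_sq_deriv[OF sol_within])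

sublocale three_cycle_orbit \<beta> E c A "\<lambda>t. share (x t)" "\<lambda>t. 2 * (norm (x t))\<^sup>2" \<eta> s
proof unfold_locales
  show "0 \<le> share (x t) i" for t i by (rule share_nonneg)
  show "sum (share (x t)) UNIV = 1" if "s \<le> t" for t using share_sum[OF x_nz[OF that]] .
  show "0 < 2 * (norm (x t))\<^sup>2" if "s \<le> t" for t using x_nz[OF that] by simp
  have "continuous_on {s..} (\<lambda>t. (norm (x t))\<^sup>2)"
    using R_deriv by (meson DERIV_continuous atLeast_iff continuous_on_eq_continuous_within)
  then show "continuous_on {s..} (\<lambda>t. 2 * (norm (x t))\<^sup>2)" by (rule continuous_on_mult[OF continuous_on_const])
  show "((\<lambda>t. share (x t) i) has_real_derivative 2 * (norm (x t))\<^sup>2 *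
      (share (x t) i * (fitness \<beta> (share (x t)) i - mean_fitness \<beta> (share (x t))))) (at t within {s..})"
    if "s \<le> t" for t i
    unfolding beta by (rule share_deriv[OF sol_within[OF that] x_nz[OF that]])
qed (use near_x eta_pos' eta_small' eta_large' in auto)

lemma norm_sq_bounds: "s \<le> t \<Longrightarrow> m\<^sup>2 \<le> (norm (x t))\<^sup>2" "s \<le> t \<Longrightarrow> (norm (x t))\<^sup>2 \<le> M\<^sup>2"
  using norm_bounds[of t] m_pos by (auto intro: power_mono)

lemma defect_growth:
  assumes "s \<le> t" "t \<le> u"
  shows "1 - share (x u) k \<le> (1 - share (x t) k) * exp (6 * A * M\<^sup>2 * (u - t))"
proof -
  define L where "L = 6 * A * M\<^sup>2"
  define f where "f v = (share (x v) k - 1) * exp (- L * v)" for v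
  have "f t \<le> f u"
  proof (rule nondecreasing_within[OF assms(2)])
    fix v assume v: "v \<in> {t..u}"
    have sv: "s \<le> v" using v assms by auto
    let ?g = "fitness \<beta> (share (x v)) k - mean_fitness \<beta> (share (x v))"
    let ?q = "1 - share (x v) k"
    have d: "(f has_real_derivative (2 * (norm (x v))\<^sup>2 * (share (x v) k * ?g)) * exp (- L * v)
        + (exp (- L * v) * (- L)) * (share (x v) k - 1)) (at v within {t..u})"
      unfolding f_def
      by (rule DERIV_mult) (auto intro!: derivative_eq_intros deriv_Icc[OF assms(1) v])
    show "(f has_real_derivative (2 * (norm (x v))\<^sup>2 * (share (x v) k * ?g) + L * ?q) * exp (- L * v))
        (at v within {t..u})"
      using d by (simp add: algebra_simps)
    have "\<bar>?g\<bar> \<le> 3 * A * ?q"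
      using fitness_self[OF nonneg sum1, OF sv sv, of k] mean_fitness_bound[OF nonneg sum1, OF sv sv, of k]
      by linarith
    moreover have "\<bar>share (x v) k * ?g\<bar> \<le> \<bar>?g\<bar>"
      using p_le_1[OF nonneg sum1, OF sv sv, of k] share_nonneg[of "x v" k]
      by (simp add: abs_mult mult_left_le_one_le)
    ultimately have "\<bar>share (x v) k * ?g\<bar> \<le> 3 * A * ?q" by linarith
    then have "2 * (norm (x v))\<^sup>2 * \<bar>share (x v) k * ?g\<bar> \<le> 2 * M\<^sup>2 * (3 * A * ?q)"
      using norm_sq_bounds(2)[OF sv] by (intro mult_mono) auto
    moreover have "2 * M\<^sup>2 * (3 * A * ?q) = L * ?q" by (simp add: L_def)
    moreover have "- (2 * (norm (x v))\<^sup>2 * \<bar>share (x v) k * ?g\<bar>) \<le> 2 * (norm (x v))\<^sup>2 * (share (x v) k * ?g)"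
      using mult_left_mono[of "- \<bar>share (x v) k * ?g\<bar>" "share (x v) k * ?g" "2 * (norm (x v))\<^sup>2"] by simp
    ultimately show "0 \<le> (2 * (norm (x v))\<^sup>2 * (share (x v) k * ?g) + L * ?q) * exp (- L * v)"
      by (intro mult_nonneg_nonneg) (linarith, simp)
  qed
  then have "(1 - share (x u) k) * exp (- L * u) \<le> (1 - share (x t) k) * exp (- L * t)"
    by (simp add: f_def algebra_simps)
  then have "(1 - share (x u) k) * exp (- L * u) * exp (L * u) \<le> (1 - share (x t) k) * exp (- L * t) * exp (L * u)"
    by (intro mult_right_mono) auto
  then show ?thesis by (simp add: mult.assoc exp_add[symmetric] L_def right_diff_distrib add.commute)
qed

lemma close_to_vertex:
  assumes u: "s \<le> u" and q: "1 - share (x u) k \<le> \<theta>" and R: "\<bar>(norm (x u))\<^sup>2 - 1\<bar> < \<epsilon> / 4"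
  shows "dist (x u) (\<xi> k) < \<epsilon>"
proof -
  let ?R = "(norm (x u))\<^sup>2" and ?q = "1 - share (x u) k" and ?y = "x u $ k"
  have eps2: "\<epsilon>\<^sup>2 \<le> \<epsilon> / 4" using eps by (simp add: power2_eq_square)
  have q0: "0 \<le> ?q" using p_le_1[OF nonneg sum1, OF u u, of k] by simp
  have q1: "?q \<le> \<epsilon>\<^sup>2 / 16" using q theta by linarith
  have R2: "3 / 4 \<le> ?R" "?R \<le> 2" using R eps by linarith+
  have Rq: "0 \<le> ?R * ?q" "?R * ?q \<le> 2 * (\<epsilon>\<^sup>2 / 16)"
    using q0 R2 mult_mono[OF R2(2) q1 _ q0] by auto
  have y2: "?y\<^sup>2 = ?R - ?R * ?q" using share_mult_norm[of "x u" k] by (simp add: algebra_simps)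
  have "1 / 16 < ?y\<^sup>2" using y2 R2 Rq eps2 eps by linarith
  then have "(1 / 4)\<^sup>2 < \<bar>?y\<bar>\<^sup>2" by (simp add: power2_eq_square)
  then have "1 / 4 < \<bar>?y\<bar>" by (rule power2_less_imp_less) simp
  then have y0: "0 < ?y" using almost_nonneg[OF u, of k] by linarith
  have "\<bar>?y - 1\<bar> \<le> \<bar>?y - 1\<bar> * (?y + 1)" using y0 by (simp add: mult_left_le[of 1] algebra_simps)
  also have "\<dots> = \<bar>(?y - 1) * (?y + 1)\<bar>" using y0 by (simp add: abs_mult)
  also have "(?y - 1) * (?y + 1) = ?y\<^sup>2 - 1" by (simp add: power2_eq_square algebra_simps)
  finally have "\<bar>?y - 1\<bar> \<le> \<epsilon> / 2" using y2 R Rq eps2 by linarith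
  then have "(?y - 1)\<^sup>2 \<le> (\<epsilon> / 2)\<^sup>2" by (metis abs_ge_zero power2_abs power_mono)
  moreover have "?R - ?y\<^sup>2 \<le> \<epsilon>\<^sup>2 / 8" using y2 Rq by linarith
  ultimately have "(dist (x u) (\<xi> k))\<^sup>2 \<le> \<epsilon>\<^sup>2 / 4 + \<epsilon>\<^sup>2 / 8"
    unfolding dist_vertex_sq by (simp add: power_divide)
  also have "\<dots> < \<epsilon>\<^sup>2" using eps by simp
  finally show ?thesis by (rule power2_less_imp_less) (use eps in simp)
qed

text \<open>Between two connections the orbit comes so close to the vertex in the shares that it remains
  there for a time \<open>T0\<close>, in which its norm has to approach 1.\<close>

lemma enters_ball:
  assumes ab: "s \<le> a" "a \<le> b" and st: "stays k a b"
    and j: "(j, k) \<in> E" "share (x a) j = share (x a) k" and l: "(k, l) \<in> E" "share (x b) l = share (x b) k"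
  shows "\<exists>u\<in>{a..b}. dist (x u) (\<xi> k) < \<epsilon>"
proof -
  have dom: "dominates (share (x v)) k" if "v \<in> {a..b}" for v using st that by (simp add: stays_def)
  obtain t where t: "t \<in> {a..b}" "1 - share (x t) k \<le> 4 * \<eta>"
    using passes_near_vertex[OF ab dom j l] by blast
  have st': "s \<le> t" using t ab by simp
  have q: "1 - share (x u) k \<le> \<theta>" if "t \<le> u" "u \<le> t + T0" for u
  proof -
    have "1 - share (x u) k \<le> (1 - share (x t) k) * exp (6 * A * M\<^sup>2 * (u - t))"
      by (rule defect_growth[OF st' that(1)])
    also have "\<dots> \<le> (4 * \<eta>) * exp (6 * A * M\<^sup>2 * T0)"
      using t(2) that A_pos eta_pos by (intro mult_mono) (auto intro!: mult_left_mono)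
    finally show ?thesis using eta_theta by linarith
  qed
  have "t + T0 \<le> b"
  proof (rule ccontr)
    assume "\<not> ?thesis"
    then have "1 - share (x b) k \<le> \<theta>" using q[of b] t by simp
    moreover have sb: "s \<le> b" using ab by simp
    have "share (x b) k + share (x b) l \<le> 1"
      using sum_split2[of k l "share (x b)"] sum1[OF sb] edge_lower[OF l(1)]
        sum_nonneg[of "UNIV - {k, l}" "share (x b)"] share_nonneg by simp
    moreover have "\<epsilon>\<^sup>2 \<le> 1 / 16" using power_mono[of \<epsilon> "1 / 4" 2] eps by (simp add: power2_eq_square)
    ultimately show False using l(2) theta(1) by linarith
  qed
  have "\<exists>u\<in>{t..t + T0}. \<bar>(norm (x u))\<^sup>2 - 1\<bar> < \<epsilon> / 4"
  proof (rule ccontr)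
    assume "\<not> ?thesis"
    then have far: "\<epsilon> / 4 \<le> \<bar>(norm (x u))\<^sup>2 - 1\<bar>" if "u \<in> {t..t + T0}" for u using that by force
    define D where "D = m\<^sup>2 * (\<epsilon> / 4)\<^sup>2"
    define f where "f u = - ((norm (x u))\<^sup>2 - 1)\<^sup>2 - 2 * D * u" for u
    have "f t \<le> f (t + T0)"
    proof (rule nondecreasing_within[where f = f and a = t and b = "t + T0"])
      fix u assume u: "u \<in> {t..t + T0}"
      have su: "s \<le> u" using u st' by simp
      let ?R = "(norm (x u))\<^sup>2" and ?mu = "mean_fitness \<beta> (share (x u))"
      have dR: "((\<lambda>t. (norm (x t))\<^sup>2) has_real_derivative 2 * ?R * (1 - ?R + ?R * ?mu)) (at u within {t..t + T0})"
        by (rule DERIV_subset[OF R_deriv[OF su]]) (use st' in auto)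
      have "((\<lambda>u. - (g u - 1)\<^sup>2 - 2 * D * u) has_real_derivative - (2 * (g u - 1) * d) - 2 * D) (at u within S)"
        if "(g has_real_derivative d) (at u within S)" for g :: "real \<Rightarrow> real" and d S
        using that by (auto intro!: derivative_eq_intros)
      from this[OF dR] show "(f has_real_derivative - (2 * (?R - 1) * (2 * ?R * (1 - ?R + ?R * ?mu))) - 2 * D)
          (at u within {t..t + T0})" unfolding f_def .
      have z2: "(\<epsilon> / 4)\<^sup>2 \<le> (?R - 1)\<^sup>2"
        using far[OF u] eps by (metis abs_le_square_iff abs_of_nonneg divide_nonneg_nonneg less_imp_le zero_le_numeral)
      have 1: "4 * D \<le> 4 * (?R * (?R - 1)\<^sup>2)"
        unfolding D_def using norm_sq_bounds(1)[OF su] z2 by (intro mult_left_mono mult_mono) auto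
      have "\<bar>?mu\<bar> \<le> 2 * A * \<theta>"
      proof -
        have "\<bar>?mu\<bar> \<le> 2 * A * (1 - share (x u) k)" by (rule mean_fitness_bound[OF nonneg sum1, OF su su])
        also have "\<dots> \<le> 2 * A * \<theta>" using q[of u] u A_pos by (intro mult_left_mono) auto
        finally show ?thesis .
      qed
      moreover have "\<bar>?R - 1\<bar> \<le> M\<^sup>2 + 1" using norm_sq_bounds(2)[OF su] by (simp add: abs_le_iff) 
      moreover have "?R\<^sup>2 \<le> (M\<^sup>2)\<^sup>2" by (rule power_mono[OF norm_sq_bounds(2)[OF su]]) simp
      ultimately have "?R\<^sup>2 * (\<bar>?R - 1\<bar> * \<bar>?mu\<bar>) \<le> (M\<^sup>2)\<^sup>2 * ((M\<^sup>2 + 1) * (2 * A * \<theta>))"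
        by (intro mult_mono) auto
      then have "\<bar>?R\<^sup>2 * ((?R - 1) * ?mu)\<bar> \<le> (M\<^sup>2)\<^sup>2 * ((M\<^sup>2 + 1) * (2 * A * \<theta>))"
        by (simp add: abs_mult)
      moreover have "4 * ((M\<^sup>2)\<^sup>2 * ((M\<^sup>2 + 1) * (2 * A * \<theta>))) = 8 * A * M ^ 4 * (M\<^sup>2 + 1) * \<theta>"
        by (simp add: power_mult[symmetric])
      ultimately have 2: "4 * \<bar>?R\<^sup>2 * ((?R - 1) * ?mu)\<bar> \<le> 2 * D"
        using theta(2) unfolding D_def by linarith
      have "- (2 * (?R - 1) * (2 * ?R * (1 - ?R + ?R * ?mu))) - 2 * D
          = 4 * (?R * (?R - 1)\<^sup>2) - 4 * (?R\<^sup>2 * ((?R - 1) * ?mu)) - 2 * D"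
        by (simp add: power2_eq_square algebra_simps)
      then show "0 \<le> - (2 * (?R - 1) * (2 * ?R * (1 - ?R + ?R * ?mu))) - 2 * D"
        using 1 2 by linarith
    qed (use T0 in simp)
    then have "2 * D * T0 + ((norm (x (t + T0)))\<^sup>2 - 1)\<^sup>2 \<le> ((norm (x t))\<^sup>2 - 1)\<^sup>2"
      by (simp add: f_def distrib_left)
    then have "2 * D * T0 \<le> ((norm (x t))\<^sup>2 - 1)\<^sup>2"
      using zero_le_power2[of "(norm (x (t + T0)))\<^sup>2 - 1"] by linarith
    also have "\<dots> \<le> (M\<^sup>2 + 1)\<^sup>2"
    proof -
      have "\<bar>(norm (x t))\<^sup>2 - 1\<bar> \<le> \<bar>M\<^sup>2 + 1\<bar>" 
        using norm_sq_bounds(2)[OF st'] zero_le_power2[of M] zero_le_power2[of "norm (x t)"] by linarith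
      then show ?thesis by (simp only: abs_le_square_iff)
    qed
    finally show False using T0(2) unfolding D_def by linarith
  qed
  then obtain u where u: "u \<in> {t..t + T0}" "\<bar>(norm (x u))\<^sup>2 - 1\<bar> < \<epsilon> / 4" by blast
  have "s \<le> u" "t \<le> u" "u \<le> t + T0" using u(1) st' by auto
  then have "dist (x u) (\<xi> k) < \<epsilon>" using close_to_vertex[OF _ q u(2)] by blast
  moreover have "u \<in> {a..b}" using u(1) t(1) \<open>t + T0 \<le> b\<close> by auto
  ultimately show ?thesis by blast
qed

text \<open>If the orbit left \<open>\<xi> j\<close> along an edge to some other \<open>\<xi> l\<close>, it would have to pass \<open>\<xi> l\<close> before it reaches
  \<open>\<xi> k\<close>, and this passage would be recorded as a visit.\<close>

lemma crossing_between_visits: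
  assumes t: "s \<le> t0" "t0 < t1" and j: "dist (x t0) (\<xi> j) < \<epsilon>" and k: "dist (x t1) (\<xi> k) < \<epsilon>" "j \<noteq> k"
    and vis: "visited x \<epsilon> {t0..t1} \<subseteq> {j, k}"
  shows "\<exists>t\<in>{t0..t1}. crossing t j k"
proof -
  have dj: "dominates (share (x t0)) j" using ball_dominates(1)[of "x t0" j] j eps by simp
  have nd: "\<not> dominates (share (x t1)) i" if "i \<noteq> k" for i
    using ball_dominates(2)[of "x t1" k i] k that eps by simp
  obtain b l where b: "t0 \<le> b" "b < t1" "(j, l) \<in> E" "share (x b) l = share (x b) j"
    and domb: "\<And>v. v \<in> {t0..b} \<Longrightarrow> dominates (share (x v)) j"
    using exit_along_edge[OF t dj nd[OF k(2)]] by blast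
  have dl: "dominates (share (x b)) l" using domb[of b] b by (simp add: dominates_def)
  have cr: "crossing b j l" using b dl by (simp add: crossing_def)
  have "l = k"
  proof (rule ccontr)
    assume lk: "l \<noteq> k"
    have sb: "s \<le> b" using t b by simp
    obtain b' l' where b': "b \<le> b'" "b' < t1" "(l, l') \<in> E" "share (x b') l' = share (x b') l"
      and domb': "\<And>v. v \<in> {b..b'} \<Longrightarrow> dominates (share (x v)) l"
      using exit_along_edge[OF sb b(2) dl nd[OF lk]] by blast
    have "stays l b b'" using domb' by (simp add: stays_def)
    from enters_ball[OF sb b'(1) this b(3) b(4)[symmetric] b'(3,4)]
    obtain u where "u \<in> {b..b'}" "dist (x u) (\<xi> l) < \<epsilon>" by blast
    then have "l \<in> visited x \<epsilon> {t0..t1}" using b b' by (auto simp: visited_def intro!: bexI[of _ u])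
    moreover have "l \<noteq> j" using edge_lower[OF b(3)] by blast
    ultimately show False using vis lk by auto
  qed
  then show ?thesis using cr b by auto
qed

lemma itinerary_crossings:
  assumes "itinerary_segment x \<epsilon> s w"
  obtains d where "\<And>n. Suc n < length w \<Longrightarrow> s \<le> d n \<and> crossing (d n) (w ! n) (w ! Suc n)"
    "\<And>n m. n \<le> m \<Longrightarrow> Suc m < length w \<Longrightarrow> d n \<le> d m"
proof -
  obtain \<tau> where tau0: "\<tau> 0 = s"
    and tau: "\<And>n. n < length w \<Longrightarrow> \<tau> n < \<tau> (Suc n) \<and> visited x \<epsilon> {\<tau> n..<\<tau> (Suc n)} = {w ! n}"
    and ne: "\<And>n. Suc n < length w \<Longrightarrow> w ! n \<noteq> w ! Suc n"
    using assms by (auto simp: itinerary_segment_def)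
  have mono: "\<tau> n \<le> \<tau> m" if "n \<le> m" "m \<le> length w" for n m
    using that
  proof (induction m rule: dec_induct)
    case (step m) then show ?case using tau[of m] by force
  qed simp
  have "\<exists>t. n < length w \<longrightarrow> t \<in> {\<tau> n..<\<tau> (Suc n)} \<and> dist (x t) (\<xi> (w ! n)) < \<epsilon>" for n
  proof (cases "n < length w")
    case True
    then have "w ! n \<in> visited x \<epsilon> {\<tau> n..<\<tau> (Suc n)}" using tau[of n] by simp
    then show ?thesis unfolding visited_def by blast
  qed simp
  then obtain v where v: "\<And>n. n < length w \<Longrightarrow> v n \<in> {\<tau> n..<\<tau> (Suc n)} \<and> dist (x (v n)) (\<xi> (w ! n)) < \<epsilon>"
    by metis
  have vs: "s \<le> v n" if "n < length w" for n
    using v[OF that] mono[of 0 n] tau0 that by auto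
  have vlt: "v n < v m" if "n < m" "m < length w" for n m
    using v[of n] v[of m] mono[of "Suc n" m] that by auto
  have "\<exists>t. Suc n < length w \<longrightarrow> t \<in> {v n..v (Suc n)} \<and> crossing t (w ! n) (w ! Suc n)" for n
  proof (cases "Suc n < length w")
    case n: True
    have "visited x \<epsilon> {v n..v (Suc n)}
      \<subseteq> visited x \<epsilon> {\<tau> n..<\<tau> (Suc n)} \<union> visited x \<epsilon> {\<tau> (Suc n)..<\<tau> (Suc (Suc n))}"
    proof
      fix i assume "i \<in> visited x \<epsilon> {v n..v (Suc n)}"
      then obtain t where t: "t \<in> {v n..v (Suc n)}" "dist (x t) (\<xi> i) < \<epsilon>" by (auto simp: visited_def)
      have "t \<in> {\<tau> n..<\<tau> (Suc n)} \<or> t \<in> {\<tau> (Suc n)..<\<tau> (Suc (Suc n))}"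
        using t(1) v[of n] v[of "Suc n"] n by auto
      then show "i \<in> visited x \<epsilon> {\<tau> n..<\<tau> (Suc n)} \<union> visited x \<epsilon> {\<tau> (Suc n)..<\<tau> (Suc (Suc n))}"
        using t(2) unfolding visited_def by blast
    qed
    then have "visited x \<epsilon> {v n..v (Suc n)} \<subseteq> {w ! n, w ! Suc n}" using tau[of n] tau[of "Suc n"] n by auto
    then have "\<exists>t\<in>{v n..v (Suc n)}. crossing t (w ! n) (w ! Suc n)"
      using crossing_between_visits[of "v n" "v (Suc n)"] vs[of n] vlt[of n "Suc n"] v[of n] v[of "Suc n"] ne[OF n] n
      by simp
    then show ?thesis by blast
  qed simp
  then obtain d where d: "\<And>n. Suc n < length w \<Longrightarrow> d n \<in> {v n..v (Suc n)} \<and> crossing (d n) (w ! n) (w ! Suc n)"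
    by metis
  show ?thesis
  proof (rule that)
    show "s \<le> d n \<and> crossing (d n) (w ! n) (w ! Suc n)" if "Suc n < length w" for n
      using d[OF that] vs[of n] that by auto
    show "d n \<le> d m" if "n \<le> m" "Suc m < length w" for n m
    proof (cases "n = m")
      case False
      then have "v (Suc n) \<le> v m" using vlt[of "Suc n" m] that by (cases "Suc n = m") auto
      then show ?thesis using d[of n] d[of m] that False by auto
    qed simp
  qed
qed

text \<open>The orbit returns to every neighbourhood of a point in the first half of the connection. The
  outgoing share of at least \<open>1 / 4\<close> that it has there determines along which edge it leaves.\<close>

lemma frequent_crossing:
  assumes jk: "(j, k) \<in> E" "0 < \<alpha> j k" "\<alpha> k j < 0"
    and om: "connection \<alpha> j k \<subseteq> omega_limit x" "\<xi> k \<in> omega_limit x"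
    and T: "s \<le> T"
  obtains t where "T \<le> t" "crossing t j k"
proof -
  have ne: "j \<noteq> k" using edge_lower[OF jk(1)] by simp
  obtain y where y: "y \<in> connection \<alpha> j k" "y \<noteq> 0" "share y k = 1 / 3" "share y j = 2 / 3"
    using exists_intermediate_connection_point[of j k \<alpha>] ne jk by blast
  then obtain r where r: "filterlim r at_top sequentially" "(\<lambda>n. x (r n)) \<longlonglongrightarrow> y"
    using om(1) by (auto simp: omega_limit_def)
  have lim: "(\<lambda>n. share (x (r n)) i) \<longlonglongrightarrow> share y i" for i
    unfolding share_def using y(2) by (intro tendsto_intros r(2)) auto
  have "eventually (\<lambda>n. 1 / 4 < share (x (r n)) k) sequentially"
    by (rule order_tendstoD(1)[OF lim]) (simp add: y)
  moreover have "eventually (\<lambda>n. 1 / 2 < share (x (r n)) j) sequentially"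
    by (rule order_tendstoD(1)[OF lim]) (simp add: y)
  moreover have "eventually (\<lambda>n. T \<le> r n) sequentially"
    using r(1) by (simp add: filterlim_at_top)
  ultimately have "eventually (\<lambda>n. 1 / 4 < share (x (r n)) k \<and> 1 / 2 < share (x (r n)) j \<and> T \<le> r n) sequentially"
    by eventually_elim simp
  then obtain n where "1 / 4 < share (x (r n)) k \<and> 1 / 2 < share (x (r n)) j \<and> T \<le> r n"
    using eventually_happens' sequentially_bot by blast
  then obtain a where a: "1 / 4 < share (x a) k" "1 / 2 < share (x a) j" "T \<le> a" by blast
  have sa: "s \<le> a" using a T by simp
  have da: "dominates (share (x a)) j" unfolding dominates_def
  proof
    fix i show "share (x a) i \<le> share (x a) j"
    proof (cases "i = j")
      case False
      then have "share (x a) i + share (x a) j \<le> 1"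
        using sum_split2[of i j "share (x a)"] sum1[OF sa] sum_nonneg[of "UNIV - {i, j}" "share (x a)"]
          share_nonneg by simp
      then show ?thesis using a by simp
    qed simp
  qed
  obtain r' where r': "filterlim r' at_top sequentially" "(\<lambda>n. x (r' n)) \<longlonglongrightarrow> \<xi> k"
    using om(2) by (auto simp: omega_limit_def)
  have "eventually (\<lambda>n. dist (x (r' n)) (\<xi> k) < 1 / 4) sequentially" using r'(2) by (rule tendstoD) simp
  moreover have "eventually (\<lambda>n. a + 1 \<le> r' n) sequentially" using r'(1) by (simp add: filterlim_at_top)
  ultimately have "eventually (\<lambda>n. dist (x (r' n)) (\<xi> k) < 1 / 4 \<and> a + 1 \<le> r' n) sequentially"
    by eventually_elim simp
  then obtain n' where "dist (x (r' n')) (\<xi> k) < 1 / 4 \<and> a + 1 \<le> r' n'"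
    using eventually_happens' sequentially_bot by blast
  then have later: "a < r' n'" "\<not> dominates (share (x (r' n'))) j" using ball_dominates(2)[OF _ ne] by auto
  obtain b l where b: "a \<le> b" "(j, l) \<in> E" "share (x b) l = share (x b) j"
    and dom: "\<And>v. v \<in> {a..b} \<Longrightarrow> dominates (share (x v)) j"
    using exit_along_edge[OF sa later(1) da later(2)] by blast
  have sb: "s \<le> b" and db: "dominates (share (x b)) j" using sa b dom by auto
  have pk: "1 / 4 \<le> share (x b) k" using outgoing_share_persists[OF sa b(1) dom jk(1)] a by simp
  have "l \<noteq> j" using edge_lower[OF b(2)] by blast
  have "k = l"
  proof (rule ccontr)
    assume "k \<noteq> l"
    then have "share (x b) k \<le> \<eta>" using unique_tie(2)[OF sb db \<open>l \<noteq> j\<close> b(3) ne[symmetric]] by simp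
    then show False using pk eta_le by simp
  qed
  then have "crossing b j k" using b db by (simp add: crossing_def dominates_def)
  then show ?thesis using that[of b] a b by simp
qed

end

section \<open>Words without return\<close>

definition no_return :: "4 list \<Rightarrow> (4 \<times> 4) set \<Rightarrow> (4 \<times> 4) set \<Rightarrow> bool" where
  "no_return w J J' \<longleftrightarrow> (\<forall>n m. n \<le> m \<longrightarrow> Suc m < length w \<longrightarrow>
     (w ! n, w ! Suc n) \<in> J \<longrightarrow> (w ! m, w ! Suc m) \<notin> J')"

fun occurs :: "(4 \<times> 4) set \<Rightarrow> 4 list \<Rightarrow> bool" where
  "occurs J (a # b # w) \<longleftrightarrow> (a, b) \<in> J \<or> occurs J (b # w)"
| "occurs J w \<longleftrightarrow> False"

fun occurs_then :: "(4 \<times> 4) set \<Rightarrow> (4 \<times> 4) set \<Rightarrow> 4 list \<Rightarrow> bool" where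
  "occurs_then J J' (a # b # w) \<longleftrightarrow> (a, b) \<in> J \<and> occurs J' (b # w) \<or> occurs_then J J' (b # w)"
| "occurs_then J J' w \<longleftrightarrow> False"

lemma occurs_nth: "occurs J w \<Longrightarrow> \<exists>i. Suc i < length w \<and> (w ! i, w ! Suc i) \<in> J"
proof (induction J w rule: occurs.induct)
  case (1 J a b w)
  show ?case
  proof (cases "(a, b) \<in> J")
    case True then show ?thesis by (intro exI[of _ 0]) simp
  next
    case False
    then obtain i where "Suc i < length (b # w)" "((b # w) ! i, (b # w) ! Suc i) \<in> J" using 1 by auto
    then show ?thesis by (intro exI[of _ "Suc i"]) simp
  qed
qed auto

lemma occurs_then_nth:
  "occurs_then J J' w \<Longrightarrow>
   \<exists>i j. i < j \<and> Suc j < length w \<and> (w ! i, w ! Suc i) \<in> J \<and> (w ! j, w ! Suc j) \<in> J'"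
proof (induction J J' w rule: occurs_then.induct)
  case (1 J J' a b w)
  show ?case
  proof (cases "(a, b) \<in> J \<and> occurs J' (b # w)")
    case True
    then obtain j where "Suc j < length (b # w)" "((b # w) ! j, (b # w) ! Suc j) \<in> J'"
      using occurs_nth by blast
    then show ?thesis using True by (intro exI[of _ 0] exI[of _ "Suc j"]) simp
  next
    case False
    then obtain i j where "i < j" "Suc j < length (b # w)" "((b # w) ! i, (b # w) ! Suc i) \<in> J"
      "((b # w) ! j, (b # w) ! Suc j) \<in> J'"
      using 1 by auto
    then show ?thesis by (intro exI[of _ "Suc i"] exI[of _ "Suc j"]) simp
  qed
qed auto

text \<open>Take the last \<open>J\<close> before \<open>J'\<close> in \<open>Z\<close>. In two occurrences of \<open>Z\<close>, the \<open>J\<close> of the later one comes after the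
  \<open>J'\<close> of the earlier one, which is a return from \<open>J'\<close> to \<open>J\<close>, or it lies strictly between the \<open>J\<close> and the
  \<open>J'\<close> of the earlier one, against the choice of \<open>J\<close>.\<close>

lemma occurrence_unique:
  assumes Z: "occurs_then J J' Z" and nr: "no_return w J J' \<or> no_return w J' J"
    and n: "\<And>e. e < length Z \<Longrightarrow> w ! (n + e) = Z ! e" "n + length Z \<le> length w"
    and m: "\<And>e. e < length Z \<Longrightarrow> w ! (m + e) = Z ! e" "m + length Z \<le> length w"
  shows "n = m"
proof -
  obtain i0 j where j: "i0 < j" "Suc j < length Z" "(Z ! i0, Z ! Suc i0) \<in> J" "(Z ! j, Z ! Suc j) \<in> J'"
    using occurs_then_nth[OF Z] by blast
  define S where "S = {i. i < j \<and> (Z ! i, Z ! Suc i) \<in> J}"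
  have S: "finite S" "i0 \<in> S" using j by (auto simp: S_def)
  define i where "i = Max S"
  have "i \<in> S" unfolding i_def by (rule Max_in) (use S in auto)
  then have i: "i < j" "(Z ! i, Z ! Suc i) \<in> J" by (simp_all add: S_def)
  have last: "(Z ! e, Z ! Suc e) \<notin> J" if "i < e" "e < j" for e
  proof
    assume "(Z ! e, Z ! Suc e) \<in> J"
    then have "e \<in> S" using that by (simp add: S_def)
    then show False using Max_ge[OF S(1)] that(1) by (fastforce simp: i_def)
  qed
  have at: "(w ! (k + e), w ! Suc (k + e)) = (Z ! e, Z ! Suc e)"
    if "\<And>e. e < length Z \<Longrightarrow> w ! (k + e) = Z ! e" "Suc e < length Z" for k e
    using that(1)[of e] that(1)[of "Suc e"] that(2) by simp
  have not_lt: False if lt: "n < m" and n: "\<And>e. e < length Z \<Longrightarrow> w ! (n + e) = Z ! e" "n + length Z \<le> length w"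
    and m: "\<And>e. e < length Z \<Longrightarrow> w ! (m + e) = Z ! e" "m + length Z \<le> length w" for n m
    using nr
  proof
    assume r: "no_return w J J'"
    have "n + i \<le> n + j" "Suc (n + j) < length w" using i(1) j(2) n(2) by auto
    then have "(w ! (n + i), w ! Suc (n + i)) \<in> J \<Longrightarrow> (w ! (n + j), w ! Suc (n + j)) \<notin> J'"
      using r unfolding no_return_def by blast
    then show False using at[OF n(1), of i] at[OF n(1), of j] i j by simp
  next
    assume r: "no_return w J' J"
    show False
    proof (cases "m + i < n + j")
      case True
      define e where "e = m + i - n"
      have e: "n + e = m + i" "i < e" "e < j" using lt True by (auto simp: e_def)
      have "(w ! (n + e), w ! Suc (n + e)) = (Z ! i, Z ! Suc i)" using at[OF m(1), of i] e(1) i j by simp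
      then have "(Z ! e, Z ! Suc e) \<in> J" using at[OF n(1), of e] e j i by simp
      then show False using last e by blast
    next
      case False
      then have "n + j \<le> m + i" "Suc (m + i) < length w" using i(1) j(2) m(2) by auto
      then have "(w ! (n + j), w ! Suc (n + j)) \<in> J' \<Longrightarrow> (w ! (m + i), w ! Suc (m + i)) \<notin> J"
        using r unfolding no_return_def by blast
      then show False using at[OF n(1), of j] at[OF m(1), of i] i j by simp
    qed
  qed
  show ?thesis
  proof (rule linorder_cases[of n m])
    assume "n < m" then show ?thesis using not_lt[OF _ n m] by blast
  next
    assume "m < n" then show ?thesis using not_lt[OF _ m n] by blast
  qed
qed

lemma switch_at_nth:
  assumes "switch_at w X Y n"
  shows "e < length (X @ Y @ [hd Y]) \<Longrightarrow> w ! (n + e) = (X @ Y @ [hd Y]) ! e"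
    and "n + length (X @ Y @ [hd Y]) \<le> length w"
proof -
  obtain u v where w: "w = u @ (X @ Y @ [hd Y]) @ v" "length u = n"
    using assms by (auto simp: switch_at_def)
  show "e < length (X @ Y @ [hd Y]) \<Longrightarrow> w ! (n + e) = (X @ Y @ [hd Y]) ! e"
    unfolding w(1) w(2)[symmetric] nth_append_length_plus by (simp only: nth_append if_True)
  show "n + length (X @ Y @ [hd Y]) \<le> length w" using w by simp
qed

lemma switches_once:
  assumes nr: "no_return w J J' \<or> no_return w J' J"
    and oc: "\<forall>X\<in>root_sequences C. \<forall>Y\<in>root_sequences C'. hd X = hd Y \<longrightarrow> occurs_then J J' (X @ Y @ [hd Y])"
  shows "switches_at_most_once w C C'"
  unfolding switches_at_most_once_def
proof (intro ballI allI impI)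
  fix X Y n m
  assume XY: "X \<in> root_sequences C" "Y \<in> root_sequences C'" and sw: "switch_at w X Y n \<and> switch_at w X Y m"
  then have "occurs_then J J' (X @ Y @ [hd Y])" using oc by (auto simp: switch_at_def)
  from occurrence_unique[OF this nr switch_at_nth[OF conjunct1[OF sw]] switch_at_nth[OF conjunct2[OF sw]]]
  show "n = m" .
qed

lemma root_sequences_image: "C \<noteq> [] \<Longrightarrow> root_sequences C = (\<lambda>n. rotate n C) ` {..<length C}"
proof -
  assume C: "C \<noteq> []"
  have "rotate n C \<in> (\<lambda>n. rotate n C) ` {..<length C}" for n
    using C by (subst rotate_conv_mod) auto
  then show ?thesis by (auto simp: root_sequences_def)
qed

lemma root_sequences_cycles:
  "root_sequences [1, 2, 3] = {[1, 2, 3], [2, 3, 1], [3, 1, 2]}"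
  "root_sequences [1, 2, 4] = {[1, 2, 4], [2, 4, 1], [4, 1, 2]}"
  "root_sequences [1, 2, 3, 4] = {[1, 2, 3, 4], [2, 3, 4, 1], [3, 4, 1, 2], [4, 1, 2, 3]}"
  by (auto simp: root_sequences_image lessThan_Suc numeral_eq_Suc rotate_def)

lemma edges_cycles:
  "edges [1, 2, 3] = {(1, 2), (2, 3), (3, 1)}"
  "edges [1, 2, 4] = {(1, 2), (2, 4), (4, 1)}"
  "edges [1, 2, 3, 4] = {(1, 2), (2, 3), (3, 4), (4, 1)}"
proof -
  have e: "edges C = (\<lambda>i. (C ! i, C ! (Suc i mod length C))) ` {..<length C}" for C
    by (auto simp: edges_def)
  have len: "length [i, j, k] = 3" "length [i, j, k, l] = 4" for i j k l :: 4 by simp_all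
  have l: "{..<3} = {0, 1, 2 :: nat}" "{..<4} = {0, 1, 2, 3 :: nat}" by auto
  show "edges [1, 2, 3] = {(1, 2), (2, 3), (3, 1)}" "edges [1, 2, 4] = {(1, 2), (2, 4), (4, 1)}"
    "edges [1, 2, 3, 4] = {(1, 2), (2, 3), (3, 4), (4, 1)}"
    unfolding e len l by simp_all
qed

lemma component_cases:
  assumes "C \<in> component_cycles K" "C' \<in> component_cycles K" "C \<noteq> C'"
  shows "C = [1, 2, 3] \<and> C' = [1, 2, 4] \<or> C = [1, 2, 4] \<and> C' = [1, 2, 3] \<or>
    C = [1, 2, 4] \<and> C' = [1, 2, 3, 4] \<or> C = [1, 2, 3, 4] \<and> C' = [1, 2, 4] \<or>
    K = Tournament \<and> (C = [1, 2, 3] \<and> C' = [1, 2, 3, 4] \<or> C = [1, 2, 3, 4] \<and> C' = [1, 2, 3])"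
  using assms by (cases K) auto

text \<open>A switch between two of the cycles contains both branches of a choice: at \<open>\<xi>\<close>2 if one of the cycles
  is \<open>[1, 2, 4]\<close>, and at \<open>\<xi>\<close>3 otherwise.\<close>

lemma switches_at_most_once_if_no_return:
  assumes C: "C \<in> component_cycles K" "C' \<in> component_cycles K" "C \<noteq> C'"
    and two: "no_return w {(2, 4)} {(2, 3)} \<or> no_return w {(2, 3)} {(2, 4)}"
    and three: "K = Tournament \<Longrightarrow>
      no_return w {(3, 1)} {(3, 4), (2, 4)} \<or> no_return w {(3, 4), (2, 4)} {(3, 1)}"
  shows "switches_at_most_once w C C'"
proof -
  have two': "no_return w {(2, 3)} {(2, 4)} \<or> no_return w {(2, 4)} {(2, 3)}" using two by blast
  note rs = root_sequences_cycles
  consider "C = [1, 2, 4]" "C' = [1, 2, 3] \<or> C' = [1, 2, 3, 4]"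
    | "C = [1, 2, 3] \<or> C = [1, 2, 3, 4]" "C' = [1, 2, 4]"
    | "K = Tournament" "C = [1, 2, 3]" "C' = [1, 2, 3, 4]" | "K = Tournament" "C = [1, 2, 3, 4]" "C' = [1, 2, 3]"
    using component_cases[OF C] by blast
  then show ?thesis
  proof cases
    case 1 then show ?thesis by (intro switches_once[OF two]) (auto simp: rs)
  next
    case 2 then show ?thesis by (intro switches_once[OF two']) (auto simp: rs)
  next
    case 3 then show ?thesis by (intro switches_once[OF three]) (auto simp: rs)
  next
    case 4
    have three': "no_return w {(3, 4), (2, 4)} {(3, 1)} \<or> no_return w {(3, 1)} {(3, 4), (2, 4)}"
      using three 4 by blast
    show ?thesis using 4 by (intro switches_once[OF three']) (auto simp: rs)
  qed
qed

lemma switch_at_longer: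
  assumes "switch_at (map a [0..<l]) X Y n" "l \<le> l'"
  shows "switch_at (map a [0..<l']) X Y n"
proof -
  have "[0..<l'] = [0..<l] @ [l..<l']" using assms(2) by (metis le_add_diff_inverse upt_add_eq_append zero_le)
  then have "map a [0..<l'] = map a [0..<l] @ map a [l..<l']" by simp
  then show ?thesis using assms(1) unfolding switch_at_def by (metis append.assoc)
qed

text \<open>There are only finitely many pairs of root sequences.\<close>

lemma no_cycling_between:
  assumes once: "\<And>l C C'. C \<in> component_cycles K \<Longrightarrow> C' \<in> component_cycles K \<Longrightarrow> C \<noteq> C' \<Longrightarrow>
    switches_at_most_once (map a [0..<l]) C C'"
  shows "\<not> cycles_between K a"
proof -
  let ?S = "\<lambda>X Y. {n. \<exists>l. switch_at (map a [0..<l]) X Y n}"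
  have fin: "finite (?S X Y)"
    if C: "C \<in> component_cycles K" "C' \<in> component_cycles K" "C \<noteq> C'"
      and XY: "X \<in> root_sequences C" "Y \<in> root_sequences C'" for C C' X Y
  proof -
    have "n = n'" if nn: "n \<in> ?S X Y" "n' \<in> ?S X Y" for n n'
    proof -
      obtain l l' where "switch_at (map a [0..<l]) X Y n" "switch_at (map a [0..<l']) X Y n'"
        using nn by blast
      then have "switch_at (map a [0..<max l l']) X Y n" "switch_at (map a [0..<max l l']) X Y n'"
        by (auto intro: switch_at_longer)
      then show ?thesis using once[OF C] XY unfolding switches_at_most_once_def by blast
    qed
    then have "\<exists>n0. ?S X Y \<subseteq> {n0}" by blast
    then show ?thesis using finite_subset by blast
  qed
  have finC: "finite (component_cycles K)" by (cases K) auto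
  have finR: "finite (root_sequences C)" if "C \<in> component_cycles K" for C
    using that by (cases K) (auto simp: root_sequences_cycles)
  let ?U = "\<Union>C\<in>component_cycles K. \<Union>C'\<in>component_cycles K - {C}.
        \<Union>X\<in>root_sequences C. \<Union>Y\<in>root_sequences C'. ?S X Y"
  have finU: "finite ?U" by (intro finite_UN_I finite_Diff finC finR) (auto intro: fin)
  have sub: "{n. \<exists>C\<in>component_cycles K. \<exists>C'\<in>component_cycles K. C \<noteq> C' \<and>
       (\<exists>X\<in>root_sequences C. \<exists>Y\<in>root_sequences C'. \<exists>l. switch_at (map a [0..<l]) X Y n)} \<subseteq> ?U"
  proof (rule subsetI, unfold mem_Collect_eq, elim bexE conjE)
    fix n C C' X Y
    assume "C \<in> component_cycles K" "C' \<in> component_cycles K" "C \<noteq> C'"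
      "X \<in> root_sequences C" "Y \<in> root_sequences C'" "\<exists>l. switch_at (map a [0..<l]) X Y n"
    then show "n \<in> ?U" by (intro UN_I[of C] UN_I[of C'] UN_I[of X] UN_I[of Y]) auto
  qed
  show ?thesis unfolding cycles_between_def not_not by (rule finite_subset[OF sub finU])
qed

lemma (in network_trajectory) itinerary_no_return:
  assumes "never_after J J'" "itinerary_segment x \<epsilon> s w"
  shows "no_return w J J'"
proof -
  obtain d where d: "\<And>n. Suc n < length w \<Longrightarrow> s \<le> d n \<and> crossing (d n) (w ! n) (w ! Suc n)"
    and mono: "\<And>n m. n \<le> m \<Longrightarrow> Suc m < length w \<Longrightarrow> d n \<le> d m"
    using itinerary_crossings[OF assms(2)] by blast
  show ?thesis unfolding no_return_def
  proof (intro allI impI)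
    fix n m assume nm: "n \<le> m" "Suc m < length w" "(w ! n, w ! Suc n) \<in> J"
    then have "Suc n < length w" by simp
    then show "(w ! m, w ! Suc m) \<notin> J'"
      using assms(1) d[of n] d[of m] mono[OF nm(1,2)] nm unfolding never_after_def by blast
  qed
qed

section \<open>Choice of the neighbourhood\<close>

definition network_edges :: "network_kind \<Rightarrow> (4 \<times> 4) set" where
  "network_edges K = (\<Union>C\<in>component_cycles K. edges C)"

lemma network_edges_simps:
  "network_edges Kirk_Silber = {(1, 2), (2, 3), (3, 1), (2, 4), (4, 1)}"
  "network_edges Delta_Clique = {(1, 2), (2, 4), (4, 1), (2, 3), (3, 4)}"
  "network_edges Tournament = {(1, 2), (2, 3), (3, 1), (2, 4), (4, 1), (3, 4)}"
  by (auto simp: network_edges_def edges_cycles)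

lemma globally_transverse_pairs:
  "globally_transverse Kirk_Silber 3 4" "globally_transverse Kirk_Silber 4 3"
  "globally_transverse Delta_Clique 1 3" "globally_transverse Delta_Clique 3 1"
  by (auto simp: globally_transverse_def edges_cycles)

locale signed_network =
  fixes \<alpha> :: "4 \<Rightarrow> 4 \<Rightarrow> real" and K :: network_kind
  assumes signs: "network_signs \<alpha> K"
    and transverse: "\<forall>k j. globally_transverse K k j \<longrightarrow> \<alpha> k j < 0"
begin

lemma sign_facts:
  "0 < \<alpha> 1 2" "0 < \<alpha> 2 3" "0 < \<alpha> 2 4" "0 < \<alpha> 4 1"
  "\<alpha> 2 1 < 0" "\<alpha> 3 2 < 0" "\<alpha> 4 2 < 0" "\<alpha> 1 4 < 0" "\<alpha> 1 3 < 0" "\<alpha> 4 3 < 0"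
  "\<alpha> 3 1 \<noteq> 0" "\<alpha> 3 4 \<noteq> 0"
  "K = Tournament \<Longrightarrow> 0 < \<alpha> 3 1 \<and> 0 < \<alpha> 3 4"
  using signs transverse globally_transverse_pairs
  by (cases K; force simp: common_signs_def)+

lemma edge_signs: "(j, k) \<in> network_edges K \<Longrightarrow> 0 < \<alpha> j k \<and> \<alpha> k j < 0"
  using signs sign_facts by (cases K) (auto simp: network_edges_simps common_signs_def)

lemma nonzero: "i \<noteq> j \<Longrightarrow> \<alpha> i j \<noteq> 0"
proof -
  have "\<forall>i j. i \<noteq> j \<longrightarrow> \<alpha> i j \<noteq> 0"
    using sign_facts by (simp add: forall_4 less_imp_neq less_imp_neq[symmetric])
  then show "i \<noteq> j \<Longrightarrow> \<alpha> i j \<noteq> 0" by blast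
qed

lemma edges_subset: "network_edges K \<subseteq> {(1, 2), (2, 3), (2, 4), (3, 1), (3, 4), (4, 1)}"
  by (cases K) (auto simp: network_edges_simps)

lemma replicator_signs_exist: "\<exists>c A. replicator_signs (offdiag \<alpha>) (network_edges K) c A"
proof -
  define S where "S = (\<lambda>(i, j). \<bar>\<alpha> i j\<bar>) ` {(i, j). i \<noteq> j}"
  have S: "finite S" "\<bar>\<alpha> 1 2\<bar> \<in> S" by (auto simp: S_def intro!: image_eqI[of _ _ "(1, 2)"])
  then have ne: "S \<noteq> {}" by blast
  have pos: "0 < Min S" using S ne nonzero by (auto simp: S_def)
  have mem: "\<bar>\<alpha> i j\<bar> \<in> S" if "i \<noteq> j" for i j using that by (auto simp: S_def)
  have "replicator_signs (offdiag \<alpha>) (network_edges K) (Min S) (Max S)"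
  proof
    show "Min S \<le> \<bar>offdiag \<alpha> i j\<bar>" if "i \<noteq> j" for i j
      using Min_le[OF S(1) mem[OF that]] that by (simp add: offdiag_def)
    have "0 \<le> Max S" using Max_ge[OF S] by linarith
    then show "\<bar>offdiag \<alpha> i j\<bar> \<le> Max S" for i j
      using Max_ge[OF S(1) mem[of i j]] by (simp add: offdiag_def)
    show "0 < offdiag \<alpha> j k \<and> offdiag \<alpha> k j < 0" if "(j, k) \<in> network_edges K" for j k
      using edge_signs[OF that] by (auto simp: offdiag_def)
  qed (use pos in \<open>auto simp: offdiag_def\<close>)
  then show ?thesis by blast
qed

lemma network_edge_points:
  assumes "replicator_signs (offdiag \<alpha>) (network_edges K) c A" and y: "y \<in> network \<alpha> K"
  shows "edge_point (network_edges K) (sqrt (1 / (2 + 4 * A))) (sqrt (exp (1 + 4 * A / c))) y"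
proof -
  interpret replicator_signs "offdiag \<alpha>" "network_edges K" c A by fact
  obtain C where C: "C \<in> component_cycles K" "y \<in> cycle_set \<alpha> C" using y by (auto simp: network_def)
  from C(2) consider i where "i \<in> set C" "y = \<xi> i" | j k where "(j, k) \<in> edges C" "y \<in> connection \<alpha> j k"
    by (auto simp: cycle_set_def)
  then show ?thesis
  proof cases
    case 1
    then obtain n where "n < length C" "C ! n = i" by (auto simp: in_set_conv_nth)
    then have "(i, C ! (Suc n mod length C)) \<in> edges C" by (auto simp: edges_def)
    then have "(i, C ! (Suc n mod length C)) \<in> network_edges K" using C(1) by (auto simp: network_edges_def)
    then show ?thesis using edge_point_of_equilibrium 1(2) by blast
  next
    case 2
    then have "(j, k) \<in> network_edges K" using C(1) by (auto simp: network_edges_def)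
    then show ?thesis using edge_point_of_connection 2(2) by blast
  qed
qed

lemma xi_in_cycle: "C \<in> component_cycles K \<Longrightarrow> \<xi> 1 \<in> cycle_set \<alpha> C"
  by (cases K) (auto simp: cycle_set_def)

lemma network_nonempty: "network \<alpha> K \<noteq> {}"
  using xi_in_cycle by (cases K) (auto simp: network_def)

text \<open>The constants are chosen in the order \<open>T0\<close>, \<open>\<theta>\<close>, \<open>\<eta>\<close>, \<open>\<delta>\<close>, each one depending on the preceding ones.\<close>

lemma neighbourhood:
  assumes "replicator_signs (offdiag \<alpha>) (network_edges K) c A" and eps: "0 < \<epsilon>" "\<epsilon> \<le> 1 / 4"
  shows "\<exists>\<delta>>0. \<exists>\<eta> m M \<theta> T0. \<forall>x s. trajectory \<alpha> x \<longrightarrow> 0 \<le> s \<longrightarrow>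
    (\<forall>t\<ge>s. infdist (x t) (network \<alpha> K) < \<delta>) \<longrightarrow>
    network_trajectory (offdiag \<alpha>) (network_edges K) c A \<alpha> x s \<eta> m M \<epsilon> \<theta> T0"
proof -
  interpret replicator_signs "offdiag \<alpha>" "network_edges K" c A by fact
  define m where "m = sqrt (1 / (2 + 4 * A)) / 2"
  define M where "M = sqrt (exp (1 + 4 * A / c)) + 1"
  have mM: "0 < m" "0 < M" using A_pos by (auto simp: m_def M_def add_pos_pos)
  define D where "D = m\<^sup>2 * (\<epsilon> / 4)\<^sup>2"
  have D: "0 < D" using mM eps by (simp add: D_def)
  define T0 where "T0 = (M\<^sup>2 + 1)\<^sup>2 / D"
  have M1: "0 < M\<^sup>2 + 1" by (simp add: add_nonneg_pos)
  then have T0: "0 < T0" "(M\<^sup>2 + 1)\<^sup>2 < 2 * D * T0" using D by (auto simp: T0_def)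
  define F where "F = 8 * A * M ^ 4 * (M\<^sup>2 + 1)"
  have F: "0 < F" using A_pos mM M1 by (simp add: F_def)
  define \<theta> where "\<theta> = min (\<epsilon>\<^sup>2 / 16) (2 * D / F)"
  have th: "0 < \<theta>" "\<theta> \<le> \<epsilon>\<^sup>2 / 16" "F * \<theta> \<le> 2 * D"
  proof -
    have "F * \<theta> \<le> F * (2 * D / F)" using F by (intro mult_left_mono) (auto simp: \<theta>_def)
    then show "F * \<theta> \<le> 2 * D" using F by simp
  qed (use eps D F in \<open>auto simp: \<theta>_def\<close>)
  define Z where "Z = 40 * A\<^sup>2 * (256 * A / c + 1) / c\<^sup>2 + 1"
  define w where "w = exp (6 * A * M\<^sup>2 * T0)"
  have w: "0 < w" by (simp add: w_def)
  define \<eta> where "\<eta> = min (c\<^sup>2 / (2000 * A\<^sup>2)) (min (exp (- Z)) (\<theta> / (4 * w)))"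
  have et: "0 < \<eta>" "\<eta> \<le> c\<^sup>2 / (2000 * A\<^sup>2)" "\<eta> \<le> exp (- Z)" "\<eta> \<le> \<theta> / (4 * w)"
    using c_pos A_pos th w by (auto simp: \<eta>_def)
  have large: "40 * A\<^sup>2 * (256 * A / c + 1) < c\<^sup>2 * (- ln \<eta>)"
  proof -
    have "ln \<eta> \<le> ln (exp (- Z))" using et by (subst ln_le_cancel_iff) auto
    then have "c\<^sup>2 * Z \<le> c\<^sup>2 * (- ln \<eta>)" using c_pos by (intro mult_left_mono) auto
    moreover have "c\<^sup>2 * (X / c\<^sup>2 + 1) = X + c\<^sup>2" for X using c_pos by (simp add: distrib_left)
    then have "c\<^sup>2 * Z = 40 * A\<^sup>2 * (256 * A / c + 1) + c\<^sup>2" unfolding Z_def .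
    moreover have "0 < c\<^sup>2" using c_pos by simp
    ultimately show ?thesis by linarith
  qed
  have small: "4 * \<eta> * w \<le> \<theta>" using et(4) w by (simp add: field_simps)
  have m2: "sqrt (1 / (2 + 4 * A)) / 2 = m" "sqrt (exp (1 + 4 * A / c)) + 1 = M" by (simp_all add: m_def M_def)
  have sp: "0 < sqrt (1 / (2 + 4 * A))" using A_pos by simp
  obtain \<delta> where \<delta>: "\<delta> > 0" "\<And>x. infdist x (network \<alpha> K) < \<delta> \<Longrightarrow> m \<le> norm x \<and> norm x \<le> M \<and>
      near_edges (network_edges K) \<eta> (share x) \<and> (\<forall>i. - (1 / 4) \<le> x $ i)"
    using near_edge_points[OF network_nonempty network_edge_points[OF assms(1)] sp et(1), unfolded m2] by blast
  have "network_trajectory (offdiag \<alpha>) (network_edges K) c A \<alpha> x s \<eta> m M \<epsilon> \<theta> T0"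
    if "trajectory \<alpha> x" "0 \<le> s" "\<forall>t\<ge>s. infdist (x t) (network \<alpha> K) < \<delta>" for x s
  proof unfold_locales
    show "(M\<^sup>2 + 1)\<^sup>2 < 2 * (m\<^sup>2 * (\<epsilon> / 4)\<^sup>2) * T0" using T0(2) by (simp add: D_def)
    show "8 * A * M ^ 4 * (M\<^sup>2 + 1) * \<theta> \<le> 2 * (m\<^sup>2 * (\<epsilon> / 4)\<^sup>2)" using th(3) by (simp add: F_def D_def)
    show "4 * \<eta> * exp (6 * A * M\<^sup>2 * T0) \<le> \<theta>" using small by (simp add: w_def)
    show "0 < offdiag \<alpha> 1 2" "0 < offdiag \<alpha> 2 3" "0 < offdiag \<alpha> 2 4" "0 < offdiag \<alpha> 4 1"
      "offdiag \<alpha> 2 1 < 0" "offdiag \<alpha> 3 2 < 0" "offdiag \<alpha> 4 2 < 0" "offdiag \<alpha> 1 4 < 0"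
      "offdiag \<alpha> 1 3 < 0" "offdiag \<alpha> 4 3 < 0"
      using sign_facts by (simp_all add: offdiag_def)
    show "m \<le> norm (x t) \<and> norm (x t) \<le> M" "near_edges (network_edges K) \<eta> (share (x t))"
      "- (1 / 4) \<le> x t $ i" if "s \<le> t" for t i
      using \<delta>(2) \<open>\<forall>t\<ge>s. infdist (x t) (network \<alpha> K) < \<delta>\<close> that by blast+
  qed (rule that refl mM edges_subset et large eps T0(1) th(2))+
  then show ?thesis using \<delta>(1) by blast
qed

end

text \<open>Otherwise the trajectory would be at distance \<open>\<delta> / 2\<close> from the set infinitely often, and these
  points would accumulate outside of it.\<close>

lemma eventually_close:
  assumes N: "\<And>y. y \<in> N \<Longrightarrow> norm y \<le> M" and traj: "trajectory \<alpha> x"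
    and om: "omega_limit x \<subseteq> N" and q: "q \<in> omega_limit x" and \<delta>: "0 < \<delta>"
  shows "\<exists>s\<ge>0. \<forall>t\<ge>s. infdist (x t) N < \<delta>"
proof (rule ccontr)
  assume no: "\<not> ?thesis"
  have far: "\<exists>t\<ge>u. \<delta> \<le> infdist (x t) N" if "0 \<le> u" for u
    using no that by (meson not_le)
  have Nne: "N \<noteq> {}" using q om by blast
  have contx: "continuous_on {0..} x"
    unfolding continuous_on_eq_continuous_within
    using traj unfolding trajectory_def by (meson atLeast_iff has_vector_derivative_continuous)
  have ex: "\<exists>t\<ge>real n. infdist (x t) N = \<delta> / 2" for n
  proof -
    obtain r where r: "filterlim r at_top sequentially" "(\<lambda>n. x (r n)) \<longlonglongrightarrow> q"
      using q by (auto simp: omega_limit_def)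
    have "eventually (\<lambda>i. dist (x (r i)) q < \<delta> / 2) sequentially" using r(2) \<delta> by (intro tendstoD) auto
    moreover have "eventually (\<lambda>i. real n \<le> r i) sequentially" using r(1) by (simp add: filterlim_at_top)
    ultimately have "eventually (\<lambda>i. dist (x (r i)) q < \<delta> / 2 \<and> real n \<le> r i) sequentially"
      by eventually_elim simp
    then obtain i where i: "dist (x (r i)) q < \<delta> / 2 \<and> real n \<le> r i"
      using eventually_happens' sequentially_bot by blast
    then have r0: "0 \<le> r i" by (meson of_nat_0_le_iff order_trans)
    obtain t' where t': "r i \<le> t'" "\<delta> \<le> infdist (x t') N" using far[OF r0] by blast
    have "infdist (x (r i)) N \<le> dist (x (r i)) q" using q om by (intro infdist_le) blast
    then have "infdist (x (r i)) N \<le> \<delta> / 2" using i by linarith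
    moreover have "\<delta> / 2 \<le> infdist (x t') N" using t' \<delta> by linarith
    moreover have "continuous_on {r i..t'} (\<lambda>t. infdist (x t) N)"
      by (intro continuous_on_infdist continuous_on_subset[OF contx]) (use r0 in auto)
    ultimately obtain t where "r i \<le> t" "infdist (x t) N = \<delta> / 2"
      using IVT'[of "\<lambda>t. infdist (x t) N" "r i" "\<delta> / 2" t'] t'(1) by blast
    moreover have "real n \<le> t" using i \<open>r i \<le> t\<close> by linarith
    ultimately show ?thesis by blast
  qed
  then obtain f where f: "\<And>n. real n \<le> f n" "\<And>n. infdist (x (f n)) N = \<delta> / 2" by metis
  have in_ball: "\<forall>n. x (f n) \<in> cball 0 (M + \<delta>)"
  proof
    fix n
    have "infdist (x (f n)) N < \<delta>" using f(2)[of n] \<delta> by simp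
    then obtain y where y: "y \<in> N" "dist (x (f n)) y < \<delta>"
      using Nne by (auto simp: infdist_notempty dest!: cInf_lessD[rotated])
    have "norm (x (f n)) \<le> norm y + dist (x (f n)) y"
      using norm_triangle_ineq[of y "x (f n) - y"] by (simp add: dist_norm)
    then show "x (f n) \<in> cball 0 (M + \<delta>)" using N[OF y(1)] y(2) by simp
  qed
  have "\<exists>y\<in>cball 0 (M + \<delta>). \<exists>r. strict_mono r \<and> ((\<lambda>n. x (f n)) \<circ> r) \<longlonglongrightarrow> y"
    using compact_cball[of "0 :: real^4" "M + \<delta>", unfolded compact_def, THEN spec, THEN mp, OF in_ball] .
  then obtain y r where r: "strict_mono r" "((\<lambda>n. x (f n)) \<circ> r) \<longlonglongrightarrow> y" by blast
  have "filterlim (\<lambda>n. f (r n)) at_top sequentially"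
  proof (rule filterlim_at_top_mono[OF filterlim_real_sequentially])
    show "eventually (\<lambda>n. real n \<le> f (r n)) sequentially"
    proof (rule always_eventually, rule allI)
      fix n
      have "real n \<le> real (r n)" using seq_suble[OF r(1)] by simp
      then show "real n \<le> f (r n)" using f(1)[of "r n"] by linarith
    qed
  qed
  then have "y \<in> omega_limit x" unfolding omega_limit_def using r(2) by (auto simp: o_def)
  then have "infdist y N = 0" using om by (intro infdist_zero) blast
  moreover have "(\<lambda>n. infdist (x (f (r n))) N) \<longlonglongrightarrow> infdist y N"
    using tendsto_infdist[OF r(2)] by (simp add: o_def)
  then have "infdist y N = \<delta> / 2" using f(2) by (simp add: LIMSEQ_const_iff)
  ultimately show False using \<delta> by simp
qed

context network_trajectory
begin

lemma no_opposite_choices: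
  assumes "never_after J J' \<or> never_after J' J"
    and "\<And>T. s \<le> T \<Longrightarrow> \<exists>t\<ge>T. \<exists>(j, k)\<in>J. crossing t j k" "\<And>T. s \<le> T \<Longrightarrow> \<exists>t\<ge>T. \<exists>(j, k)\<in>J'. crossing t j k"
  shows False
  using assms(1)
proof
  assume na: "never_after J J'"
  obtain a j k where a: "s \<le> a" "(j, k) \<in> J" "crossing a j k" using assms(2)[OF order_refl] by auto
  obtain b m n where "a \<le> b" "(m, n) \<in> J'" "crossing b m n" using assms(3)[OF a(1)] by auto
  then show False using na a unfolding never_after_def by blast
next
  assume na: "never_after J' J"
  obtain a j k where a: "s \<le> a" "(j, k) \<in> J'" "crossing a j k" using assms(3)[OF order_refl] by auto
  obtain b m n where "a \<le> b" "(m, n) \<in> J" "crossing b m n" using assms(2)[OF a(1)] by auto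
  then show False using na a unfolding never_after_def by blast
qed

lemma cycle_crossings:
  assumes om: "cycle_set \<alpha> C \<subseteq> omega_limit x" and e: "(j, k) \<in> edges C" "edges C \<subseteq> E" and T: "s \<le> T"
  shows "\<exists>t\<ge>T. crossing t j k"
proof -
  have E: "(j, k) \<in> E" using e by blast
  have sg: "0 < \<alpha> j k" "\<alpha> k j < 0"
    using edge[OF E] by (auto simp: beta offdiag_def split: if_splits)
  obtain i where i: "i < length C" "k = C ! (Suc i mod length C)" using e(1) by (auto simp: edges_def)
  then have "Suc i mod length C < length C" by (intro mod_less_divisor) linarith
  then have "k \<in> set C" using i(2) by simp
  then have "\<xi> k \<in> omega_limit x" using om by (auto simp: cycle_set_def)
  moreover have "connection \<alpha> j k \<subseteq> omega_limit x" using om e(1) by (auto simp: cycle_set_def)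
  ultimately show ?thesis using frequent_crossing[OF E sg _ _ T] by blast
qed

end

context signed_network
begin

lemma tournament_signs: "K = Tournament \<Longrightarrow> 0 < offdiag \<alpha> 3 1" "K = Tournament \<Longrightarrow> 0 < offdiag \<alpha> 3 4"
  using sign_facts(13) by (simp_all add: offdiag_def)

lemma omega_limit_contains_one_cycle:
  assumes x: "trajectory \<alpha> x" "asymptotic_to x (network \<alpha> K)"
    and C: "C \<in> component_cycles K" "C' \<in> component_cycles K"
    and om: "cycle_set \<alpha> C \<subseteq> omega_limit x" "cycle_set \<alpha> C' \<subseteq> omega_limit x"
  shows "C = C'"
proof (rule ccontr)
  assume ne: "C \<noteq> C'"
  obtain c A where RS: "replicator_signs (offdiag \<alpha>) (network_edges K) c A"
    using replicator_signs_exist by blast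
  have eps: "0 < (1 / 4 :: real)" "1 / 4 \<le> (1 / 4 :: real)" by simp_all
  obtain \<delta> \<eta> m M \<theta> T0 where "0 < \<delta>" and nt: "\<forall>x s. trajectory \<alpha> x \<longrightarrow> 0 \<le> s \<longrightarrow>
      (\<forall>t\<ge>s. infdist (x t) (network \<alpha> K) < \<delta>) \<longrightarrow>
      network_trajectory (offdiag \<alpha>) (network_edges K) c A \<alpha> x s \<eta> m M (1 / 4) \<theta> T0"
    using neighbourhood[OF RS eps] by (elim exE conjE)
  have bounded: "norm y \<le> sqrt (exp (1 + 4 * A / c))" if "y \<in> network \<alpha> K" for y
    using network_edge_points[OF RS that] by (simp add: edge_point_def)
  have "\<xi> 1 \<in> omega_limit x" using om xi_in_cycle[OF C(1)] by blast
  moreover have "omega_limit x \<subseteq> network \<alpha> K" using x by (simp add: asymptotic_to_def)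
  ultimately have "\<exists>s\<ge>0. \<forall>t\<ge>s. infdist (x t) (network \<alpha> K) < \<delta>"
    using eventually_close[OF bounded x(1)] \<open>0 < \<delta>\<close> by blast
  then obtain s where s: "0 \<le> s" "\<forall>t\<ge>s. infdist (x t) (network \<alpha> K) < \<delta>" by blast
  interpret network_trajectory "offdiag \<alpha>" "network_edges K" c A \<alpha> x s \<eta> m M "1 / 4" \<theta> T0
    by (rule nt[rule_format]) (use x s in auto)
  have sub: "edges C \<subseteq> network_edges K" "edges C' \<subseteq> network_edges K"
    using C by (auto simp: network_edges_def)
  have cr: "\<exists>t\<ge>T. crossing t j k" if "(j, k) \<in> edges C \<union> edges C'" "s \<le> T" for j k T
    using that cycle_crossings[OF _ _ sub(1)] cycle_crossings[OF _ _ sub(2)] om by blast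
  have "(2, 4) \<in> edges C \<union> edges C' \<and> (2, 3) \<in> edges C \<union> edges C' \<or>
      K = Tournament \<and> (3, 1) \<in> edges C \<union> edges C' \<and> (3, 4) \<in> edges C \<union> edges C'"
    using component_cases[OF C ne] by (auto simp: edges_cycles)
  then show False
  proof (elim disjE conjE)
    assume e: "(2, 4) \<in> edges C \<union> edges C'" "(2, 3) \<in> edges C \<union> edges C'"
    show False by (rule no_opposite_choices[OF choice_at_2]) (use cr[OF e(1)] cr[OF e(2)] in auto)
  next
    assume e: "K = Tournament" "(3, 1) \<in> edges C \<union> edges C'" "(3, 4) \<in> edges C \<union> edges C'"
    show False by (rule no_opposite_choices[OF choice_at_3[OF tournament_signs[OF e(1)]]])
      (use cr[OF e(2)] cr[OF e(3)] in auto)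
  qed
qed

lemma switching_near_network:
  assumes eps: "0 < \<epsilon>" "\<epsilon> \<le> 1 / 4"
  obtains \<delta> where "\<delta> > 0"
    "\<And>x s w C C'. trajectory \<alpha> x \<Longrightarrow> 0 \<le> s \<Longrightarrow> \<forall>t\<ge>s. infdist (x t) (network \<alpha> K) < \<delta> \<Longrightarrow>
      itinerary_segment x \<epsilon> s w \<Longrightarrow> C \<in> component_cycles K \<Longrightarrow> C' \<in> component_cycles K \<Longrightarrow> C \<noteq> C' \<Longrightarrow>
      switches_at_most_once w C C'"
proof -
  obtain c A where RS: "replicator_signs (offdiag \<alpha>) (network_edges K) c A"
    using replicator_signs_exist by blast
  obtain \<delta> \<eta> m M \<theta> T0 where "0 < \<delta>" and nt: "\<forall>x s. trajectory \<alpha> x \<longrightarrow> 0 \<le> s \<longrightarrow>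
      (\<forall>t\<ge>s. infdist (x t) (network \<alpha> K) < \<delta>) \<longrightarrow>
      network_trajectory (offdiag \<alpha>) (network_edges K) c A \<alpha> x s \<eta> m M \<epsilon> \<theta> T0"
    using neighbourhood[OF RS eps] by (elim exE conjE)
  show ?thesis
  proof (rule that[OF \<open>0 < \<delta>\<close>])
    fix x s w C C'
    assume x: "trajectory \<alpha> x" "0 \<le> s" "\<forall>t\<ge>s. infdist (x t) (network \<alpha> K) < \<delta>"
      and w: "itinerary_segment x \<epsilon> s w"
      and C: "C \<in> component_cycles K" "C' \<in> component_cycles K" "C \<noteq> C'"
    interpret network_trajectory "offdiag \<alpha>" "network_edges K" c A \<alpha> x s \<eta> m M \<epsilon> \<theta> T0
      by (rule nt[rule_format]) (use x in auto)
    show "switches_at_most_once w C C'"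
    proof (rule switches_at_most_once_if_no_return[OF C])
      show "no_return w {(2, 4)} {(2, 3)} \<or> no_return w {(2, 3)} {(2, 4)}"
        using choice_at_2 itinerary_no_return[OF _ w] by blast
      show "no_return w {(3, 1)} {(3, 4), (2, 4)} \<or> no_return w {(3, 4), (2, 4)} {(3, 1)}"
        if "K = Tournament"
        using choice_at_3[OF tournament_signs[OF that]] itinerary_no_return[OF _ w] by blast
    qed
  qed
qed

end

theorem mainTheorem7:
  fixes \<alpha> :: "4 \<Rightarrow> 4 \<Rightarrow> real" and K :: network_kind
  assumes signs: "network_signs \<alpha> K"
    and transverse: "\<forall>k j. globally_transverse K k j \<longrightarrow> \<alpha> k j < 0"
  shows "(\<forall>x. trajectory \<alpha> x \<and> asymptotic_to x (network \<alpha> K) \<longrightarrow>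
            (\<forall>C\<in>component_cycles K. \<forall>C'\<in>component_cycles K.
               cycle_set \<alpha> C \<subseteq> omega_limit x \<and> cycle_set \<alpha> C' \<subseteq> omega_limit x \<longrightarrow> C = C'))
       \<and> (\<exists>\<epsilon>\<^sub>0>0. \<forall>\<epsilon>. 0 < \<epsilon> \<and> \<epsilon> \<le> \<epsilon>\<^sub>0 \<longrightarrow> (\<exists>\<delta>>0. \<forall>x s.
            trajectory \<alpha> x \<and> asymptotic_to x (network \<alpha> K) \<and>
            0 \<le> s \<and> (\<forall>t\<ge>s. infdist (x t) (network \<alpha> K) < \<delta>) \<longrightarrow>
              (\<forall>w. itinerary_segment x \<epsilon> s w \<longrightarrow>
                 (\<forall>C\<in>component_cycles K. \<forall>C'\<in>component_cycles K. C \<noteq> C' \<longrightarrow> switches_at_most_once w C C')) \<and>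
              (\<forall>a. infinite_itinerary x \<epsilon> s a \<longrightarrow>
                 \<not> regularly_cycles K a \<and> \<not> irregularly_cycles K a)))"
proof -
  interpret signed_network \<alpha> K by unfold_locales (fact signs, fact transverse)
  show ?thesis
  proof (intro conjI, use omega_limit_contains_one_cycle in blast, rule exI[of _ "1 / 4"], rule conjI, simp,
      intro allI impI, elim conjE)
    fix \<epsilon> :: real assume "0 < \<epsilon>" "\<epsilon> \<le> 1 / 4"
    then obtain \<delta> where "\<delta> > 0" and once: "\<And>x s w C C'. trajectory \<alpha> x \<Longrightarrow> 0 \<le> s \<Longrightarrow>
      \<forall>t\<ge>s. infdist (x t) (network \<alpha> K) < \<delta> \<Longrightarrow> itinerary_segment x \<epsilon> s w \<Longrightarrow>
      C \<in> component_cycles K \<Longrightarrow> C' \<in> component_cycles K \<Longrightarrow> C \<noteq> C' \<Longrightarrow> switches_at_most_once w C C'"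
      using switching_near_network by blast
    have "\<not> cycles_between K a" if "trajectory \<alpha> x" "0 \<le> s" "\<forall>t\<ge>s. infdist (x t) (network \<alpha> K) < \<delta>"
      "infinite_itinerary x \<epsilon> s a" for x s a
      using once[OF that(1-3)] that(4) unfolding infinite_itinerary_def by (intro no_cycling_between) blast
    then show "\<exists>\<delta>>0. \<forall>x s. trajectory \<alpha> x \<and> asymptotic_to x (network \<alpha> K) \<and>
            0 \<le> s \<and> (\<forall>t\<ge>s. infdist (x t) (network \<alpha> K) < \<delta>) \<longrightarrow>
              (\<forall>w. itinerary_segment x \<epsilon> s w \<longrightarrow>
                 (\<forall>C\<in>component_cycles K. \<forall>C'\<in>component_cycles K. C \<noteq> C' \<longrightarrow> switches_at_most_once w C C')) \<and>
              (\<forall>a. infinite_itinerary x \<epsilon> s a \<longrightarrow>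
                 \<not> regularly_cycles K a \<and> \<not> irregularly_cycles K a)"
      unfolding regularly_cycles_def irregularly_cycles_def
      using \<open>\<delta> > 0\<close> once by (intro exI[of _ \<delta>]) blast
  qed
qed

end
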